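(* For each integer $d\ge 2$, each $\Delta\in\mathbb{N}$ and each $\gamma>0$ there exists $C$ such that the random graph $G(n,p)$ asymptotically almost surely is (a) $\mathcal{H}(n,d,\Delta)$-universal if $p\ge C\big(\tfrac{\log n}{n}\big)^{1/(2d+1)}$, and (b) $\mathcal{H}((1-\gamma)n,d,\Delta)$-universal if $p\ge C\big(\tfrac{\log n}{n}\big)^{1/(2d)}$.
   Context: $G(n,p)$ is the binomial random graph on $n$ vertices in which each pair of vertices is an edge independently with probability $p=p(n)$. An event holds asymptotically almost surely (a.a.s.) if its probability tends to $1$ as $n\to\infty$. Logarithms are to base $2$. A graph is $\ell$-degenerate if each of its induced subgraphs has minimum degree at most $\ell$; its degeneracy is the least such $\ell$. $\mathcal{H}(N,d,\Delta)$ denotes the class of $N$-vertex graphs with maximum degree at most $\Delta$ and degeneracy at most $d$. A graph $G$ is $\mathcal{H}$-universal if $G$ contains a (not necessarily induced) copy of every $H\in\mathcal{H}$ as a subgraph. *)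

theory Defs
  imports "HOL-Probability.Probability" "HOL-Library.Ramsey"
begin

record 'a ugraph =
  verts :: "'a set"
  edges :: "'a set set"

definition finite_simple_graph :: "'a ugraph \<Rightarrow> bool" where
  "finite_simple_graph G \<longleftrightarrow> finite (verts G) \<and> edges G \<subseteq> [verts G]\<^bsup>2\<^esup>"

definition degree :: "'a ugraph \<Rightarrow> 'a \<Rightarrow> nat" where
  "degree G v = card {e \<in> edges G. v \<in> e}"

definition min_degree :: "'a ugraph \<Rightarrow> nat" where
  "min_degree G = Min (degree G ` verts G)"

text \<open>The inserted 0 only matters for the graph without vertices, which gets maximum degree 0.\<close>

definition max_degree :: "'a ugraph \<Rightarrow> nat" where
  "max_degree G = Max (insert 0 (degree G ` verts G))"

definition induced :: "'a ugraph \<Rightarrow> 'a set \<Rightarrow> 'a ugraph" where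
  "induced G S = \<lparr>verts = S, edges = {e \<in> edges G. e \<subseteq> S}\<rparr>"

text \<open>The minimum degree of the graph without vertices is meaningless, so only induced subgraphs
  on nonempty vertex sets are considered.\<close>

definition degenerate :: "nat \<Rightarrow> 'a ugraph \<Rightarrow> bool" where
  "degenerate l G \<longleftrightarrow> (\<forall>S \<subseteq> verts G. S \<noteq> {} \<longrightarrow> min_degree (induced G S) \<le> l)"

definition degeneracy :: "'a ugraph \<Rightarrow> nat" where
  "degeneracy G = (LEAST l. degenerate l G)"

text \<open>Every finite graph is isomorphic to one whose vertices are natural numbers, so it is no
  restriction to take the class over the vertex type \<^typ>\<open>nat\<close>.\<close>

definition graph_class :: "nat \<Rightarrow> nat \<Rightarrow> nat \<Rightarrow> nat ugraph set" where
  "graph_class N d \<Delta> = {H. finite_simple_graph H \<and> card (verts H) = N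
     \<and> max_degree H \<le> \<Delta> \<and> degeneracy H \<le> d}"

definition contains_copy :: "'a ugraph \<Rightarrow> 'b ugraph \<Rightarrow> bool" where
  "contains_copy G H \<longleftrightarrow> (\<exists>f. inj_on f (verts H) \<and> f ` verts H \<subseteq> verts G
     \<and> (\<forall>e \<in> edges H. f ` e \<in> edges G))"

definition universal :: "'b ugraph set \<Rightarrow> 'a ugraph \<Rightarrow> bool" where
  "universal \<H> G \<longleftrightarrow> (\<forall>H \<in> \<H>. contains_copy G H)"

definition gnp :: "nat \<Rightarrow> real \<Rightarrow> nat ugraph pmf" where
  "gnp n p = map_pmf (\<lambda>X. \<lparr>verts = {..<n}, edges = {e \<in> [{..<n}]\<^bsup>2\<^esup>. X e}\<rparr>)
     (Pi_pmf ([{..<n}]\<^bsup>2\<^esup>) False (\<lambda>_. bernoulli_pmf p))"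

text \<open>\<open>P n\<close> holds asymptotically almost surely for a sample from \<open>M n\<close>.\<close>

definition aas :: "(nat \<Rightarrow> 'a pmf) \<Rightarrow> (nat \<Rightarrow> 'a \<Rightarrow> bool) \<Rightarrow> bool" where
  "aas M P \<longleftrightarrow> (\<lambda>n. measure_pmf.prob (M n) {x. P n x}) \<longlonglongrightarrow> 1"

end

(*
The number of edges of a d-degenerate graph is less than d times its number of vertices, so in every
set M of vertices a constant proportion has at most 2d neighbours in M. Peel off boundedly many
linear-sized batches of such vertices, each at pairwise distance at least three, until a core of tiny
linear size is left. Embed the core first, one vertex at a time in a degenerate order, so that
each vertex has at most d embedded neighbours; candidates remain available because a random greedy
choice (derandomised by a potential) spreads the used vertices evenly over all common neighbourhoods.
Then re-insert the batches, each by Hall's theorem: distinct vertices of a batch have disjoint sets of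
at most 2d embedded neighbours, and p^(2d) n >> log n makes Hall's condition hold for all choices of
disjoint sets simultaneously.

For spanning subgraphs the last matching is perfect. There the vertices of the last batch have
common degree at most 2d, and the core contains the neighbourhoods of a linear number of them. The
potential also guarantees that every host vertex is joined to about p^j n of these (randomly placed)
neighbourhoods, where j is the common degree. This needs control of common neighbourhoods of d + 1
vertices, hence p^(2d+1) n >> log n.
*)

theory Submission
  imports Defs "HOL-Real_Asymp.Real_Asymp"
begin

section \<open>Matchings and bounded-degree degenerate graphs\<close>

text \<open>The exponent of the density is \<open>d + k\<close>: almost spanning graphs need
  \<open>k = d\<close>, spanning ones \<open>k = Suc d\<close>. The obstacle is that the sets in
  which used vertices are counted are common neighbourhoods of up to \<open>k\<close> vertices, and
  that the images already chosen depend on the graph as well. So even spreading is demanded of every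
  subset \<open>X\<close> of a block with at least \<open>p ^ k * a / 8\<close> elements and of
  every disjoint family of at most \<open>m\<close> sets. There are about exp (n + (d + 1) m log n)
  such choices, and each fails with probability exp (- 2 p^d m |X|). With \<open>m\<close> and
  \<open>a\<close> linear in n this forces p^(d+k) n to dominate log n. The extra vertex in the
  spanning case is a host vertex \<open>y\<close>: the number of candidates adjacent to
  \<open>y\<close> has to be compared with the number of all candidates. Randomness enters only
  through five properties of the host graph, collected in \<open>pseudorandom\<close>, which fail
  with probability of order 1/n. From them every guest graph is embedded deterministically, so no
  union bound over guest graphs occurs.\<close>

lemma hall_marriage:
  fixes A :: "'i \<Rightarrow> 'b set"
  assumes "finite I" "\<And>i. i \<in> I \<Longrightarrow> finite (A i)"
    and "\<And>J. J \<subseteq> I \<Longrightarrow> card J \<le> card (\<Union>(A ` J))"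
  shows "\<exists>f. inj_on f I \<and> (\<forall>i\<in>I. f i \<in> A i)"
  using assms
proof (induction "card I" arbitrary: I A rule: less_induct)
  case less
  show ?case
  proof (cases "I = {}")
    case True
    then show ?thesis by simp
  next
    case False
    then obtain i where i: "i \<in> I" by blast
    have finU: "finite (\<Union>(A ` J))" if "J \<subseteq> I" for J
      using that less.prems(1,2) by (meson finite_UN finite_subset subsetD)
    \<comment> \<open>The usual dichotomy: if every proper nonempty subfamily has a surplus, any
      element of \<open>A i\<close> may be spent on \<open>i\<close>; otherwise a tight subfamily is
      matched first and its union is deleted from the remaining sets.\<close>
    show ?thesis
    proof (cases "\<forall>J. J \<subset> I \<longrightarrow> J \<noteq> {} \<longrightarrow> card J < card (\<Union>(A ` J))")
      case True
      have "card {i} \<le> card (\<Union>(A ` {i}))" using less.prems(3)[of "{i}"] i by blast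
      then obtain x where x: "x \<in> A i" by fastforce
      define A' where "A' = (\<lambda>j. A j - {x})"
      have "\<exists>f. inj_on f (I - {i}) \<and> (\<forall>j\<in>I - {i}. f j \<in> A' j)"
      proof (rule less.hyps)
        show "card (I - {i}) < card I" using i less.prems(1) by (rule_tac card_Diff1_less)
        show "finite (I - {i})" using less.prems(1) by simp
        show "\<And>j. j \<in> I - {i} \<Longrightarrow> finite (A' j)" using less.prems(2) by (simp add: A'_def)
        fix J assume J: "J \<subseteq> I - {i}"
        show "card J \<le> card (\<Union>(A' ` J))"
        proof (cases "J = {}")
          case False
          have "J \<subset> I" using J i by blast
          then have "card J < card (\<Union>(A ` J))" using True False by blast
          moreover have "\<Union>(A' ` J) = \<Union>(A ` J) - {x}" by (auto simp: A'_def)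
          moreover have "card (\<Union>(A ` J)) \<le> card (\<Union>(A ` J) - {x}) + 1"
            using finU[of J] \<open>J \<subset> I\<close>
            by (cases "x \<in> \<Union>(A ` J)") (auto simp: card_Diff_singleton_if)
          ultimately show ?thesis by simp
        qed simp
      qed
      then obtain f where f: "inj_on f (I - {i})" "\<forall>j\<in>I - {i}. f j \<in> A' j" by blast
      have "inj_on (f(i := x)) I"
        using f by (auto simp: inj_on_def A'_def)
      moreover have "\<forall>j\<in>I. (f(i := x)) j \<in> A j" using f x by (auto simp: A'_def)
      ultimately show ?thesis by blast
    next
      case False
      then obtain J where J: "J \<subset> I" "J \<noteq> {}" "card (\<Union>(A ` J)) \<le> card J" by (meson not_less)
      have finJ: "finite J" using J less.prems(1) finite_subset by blast
      have cardJ: "card J < card I" using J(1) less.prems(1) by (simp add: psubset_card_mono)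
      have "\<exists>f. inj_on f J \<and> (\<forall>j\<in>J. f j \<in> A j)"
        by (rule less.hyps[OF cardJ finJ]) (use J less.prems in blast)+
      then obtain f where f: "inj_on f J" "\<forall>j\<in>J. f j \<in> A j" by blast
      define A' where "A' = (\<lambda>j. A j - \<Union>(A ` J))"
      have "\<exists>f. inj_on f (I - J) \<and> (\<forall>j\<in>I - J. f j \<in> A' j)"
      proof (rule less.hyps)
        show "card (I - J) < card I"
          using J less.prems(1) by (intro psubset_card_mono) auto
        show "finite (I - J)" using less.prems(1) by simp
        show "\<And>j. j \<in> I - J \<Longrightarrow> finite (A' j)" using less.prems(2) by (simp add: A'_def)
        fix L assume L: "L \<subseteq> I - J"
        have finL: "finite L" using L less.prems(1) by (meson Diff_subset finite_subset)
        have "card J + card L = card (J \<union> L)"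
          using L finJ finL by (subst card_Un_disjoint) auto
        also have "\<dots> \<le> card (\<Union>(A ` (J \<union> L)))"
          using L J by (intro less.prems(3)) auto
        also have "\<Union>(A ` (J \<union> L)) = \<Union>(A ` J) \<union> \<Union>(A' ` L)" by (auto simp: A'_def)
        also have "card \<dots> \<le> card (\<Union>(A ` J)) + card (\<Union>(A' ` L))" by (rule card_Un_le)
        finally show "card L \<le> card (\<Union>(A' ` L))" using J(3) by simp
      qed
      then obtain g where g: "inj_on g (I - J)" "\<forall>j\<in>I - J. g j \<in> A' j" by blast
      define h where "h = (\<lambda>j. if j \<in> J then f j else g j)"
      have "inj_on h I"
      proof (rule inj_onI)
        fix i j assume ij: "i \<in> I" "j \<in> I" "h i = h j"
        have *: "g j \<notin> \<Union>(A ` J)" if "j \<in> I" "j \<notin> J" for j using g that by (auto simp: A'_def)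
        have **: "f j \<in> \<Union>(A ` J)" if "j \<in> J" for j using f that by auto
        show "i = j"
          using ij f(1) g(1) *[of i] *[of j] **[of i] **[of j]
          by (cases "i \<in> J"; cases "j \<in> J") (auto simp: h_def inj_on_def)
      qed
      moreover have "\<forall>j\<in>I. h j \<in> A j" using f g by (auto simp: h_def A'_def)
      ultimately show ?thesis by blast
    qed
  qed
qed

section \<open>Guest graphs: low degrees and sets of pairwise distance three\<close>

abbreviation colours :: "nat \<Rightarrow> nat" where
  "colours \<Delta> \<equiv> \<Delta>\<^sup>2 + \<Delta> + 1"

locale degenerate_graph =
  fixes V :: "'a set" and adj :: "'a \<Rightarrow> 'a set" and d \<Delta> :: nat
  assumes finite_V: "finite V"
    and adj_subset: "v \<in> V \<Longrightarrow> adj v \<subseteq> V"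
    and adj_sym: "u \<in> adj v \<Longrightarrow> v \<in> adj u"
    and adj_irrefl: "v \<notin> adj v"
    and card_adj: "v \<in> V \<Longrightarrow> card (adj v) \<le> \<Delta>"
    and degenerate_ex: "S \<subseteq> V \<Longrightarrow> S \<noteq> {} \<Longrightarrow> \<exists>v\<in>S. card (adj v \<inter> S) \<le> d"
begin

text \<open>Pairwise distance at least three. Neighbourhoods of such vertices are disjoint and avoid
  the set, so the stars needed to embed them use disjoint sets of leaves.\<close>

definition indep2 :: "'a set \<Rightarrow> bool" where
  "indep2 B \<longleftrightarrow> (\<forall>u\<in>B. \<forall>v\<in>B. u \<noteq> v \<longrightarrow> v \<notin> adj u \<and> adj u \<inter> adj v = {})"

lemma indep2_subset: "indep2 B \<Longrightarrow> C \<subseteq> B \<Longrightarrow> indep2 C"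
  by (auto simp: indep2_def)

lemma indep2D:
  assumes "indep2 B" "u \<in> B" "v \<in> B" "u \<noteq> v"
  shows "v \<notin> adj u" and "adj u \<inter> adj v = {}"
  using assms unfolding indep2_def by meson+

lemma finite_adj: "v \<in> V \<Longrightarrow> finite (adj v)"
  using adj_subset finite_V finite_subset by blast

text \<open>Deleting a vertex of degree at most \<open>d\<close> lowers the degree sum by twice its
  degree. Counting degrees instead of edges keeps the argument within the neighbourhood
  function.\<close>

lemma sum_degrees_le:
  assumes "S \<subseteq> V"
  shows "(\<Sum>v\<in>S. card (adj v \<inter> S)) \<le> 2 * d * card S"
  using assms
proof (induction "card S" arbitrary: S)
  case 0
  have "finite S" using 0 finite_V finite_subset by blast
  then have "S = {}" using 0 by simp
  then show ?case by simp
next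
  case (Suc k)
  have finS: "finite S" using Suc finite_V finite_subset by blast
  have "S \<noteq> {}" using Suc by auto
  then obtain v where v: "v \<in> S" "card (adj v \<inter> S) \<le> d" using degenerate_ex[OF Suc.prems] by blast
  define S' where "S' = S - {v}"
  have S: "S = insert v S'" "v \<notin> S'" "finite S'" using v finS by (auto simp: S'_def)
  have IH: "(\<Sum>u\<in>S'. card (adj u \<inter> S')) \<le> 2 * d * card S'"
    by (rule Suc.hyps(1)) (use Suc.hyps(2) Suc.prems S in auto)
  have *: "card (adj u \<inter> S) = card (adj u \<inter> S') + (if u \<in> adj v then 1 else 0)" if "u \<in> S'" for u
  proof (cases "u \<in> adj v")
    case True
    then have "adj u \<inter> S = insert v (adj u \<inter> S')" using S adj_sym by auto
    then show ?thesis using True S by simp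
  next
    case False
    then have "adj u \<inter> S = adj u \<inter> S'" using S adj_sym by auto
    then show ?thesis using False by simp
  qed
  have "(\<Sum>u\<in>S. card (adj u \<inter> S)) = card (adj v \<inter> S) + (\<Sum>u\<in>S'. card (adj u \<inter> S))"
    using sum.insert[OF S(3,2), of "\<lambda>u. card (adj u \<inter> S)"] unfolding S(1)[symmetric] .
  also have "(\<Sum>u\<in>S'. card (adj u \<inter> S)) = (\<Sum>u\<in>S'. card (adj u \<inter> S')) + card (S' \<inter> adj v)"
    using * S(3) by (simp add: sum.distrib sum.If_cases)
  also have "card (S' \<inter> adj v) \<le> card (adj v \<inter> S)"
    using finS by (intro card_mono) (auto simp: S'_def)
  finally show ?case using IH v S by simp
qed

text \<open>Markov's inequality: each remaining vertex contributes at least \<open>2 * d + 1\<close>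
  to a degree sum of at most \<open>2 * d * card S\<close>.\<close>

lemma many_low_degree:
  assumes "S \<subseteq> V"
  shows "card S \<le> (2 * d + 1) * card {v\<in>S. card (adj v \<inter> S) \<le> 2 * d}"
proof -
  let ?L = "{v\<in>S. card (adj v \<inter> S) \<le> 2 * d}"
  have fin: "finite S" using assms finite_V finite_subset by blast
  have "(2 * d + 1) * card (S - ?L) = (\<Sum>v\<in>S - ?L. 2 * d + 1)" by simp
  also have "\<dots> \<le> (\<Sum>v\<in>S - ?L. card (adj v \<inter> S))" by (intro sum_mono) auto
  also have "\<dots> \<le> (\<Sum>v\<in>S. card (adj v \<inter> S))" using fin by (intro sum_mono2) auto
  also have "\<dots> \<le> 2 * d * card S" using assms by (rule sum_degrees_le)
  finally have 1: "(2 * d + 1) * card (S - ?L) \<le> 2 * d * card S" .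
  have "card S = card ?L + card (S - ?L)"
    using fin by (subst card_Un_disjoint[symmetric]) (auto intro!: arg_cong[of _ _ card])
  then have "(2 * d + 1) * card S = (2 * d + 1) * card ?L + (2 * d + 1) * card (S - ?L)"
    by (simp add: distrib_left)
  with 1 show ?thesis by simp
qed

text \<open>Greedy colouring of the square of the graph: \<open>conf v\<close> collects the at most
  \<open>\<Delta>\<close> neighbours and \<open>\<Delta>\<^sup>2\<close> neighbours of neighbours,
  so one colour more is always free.\<close>

lemma square_coloring:
  "\<exists>col. (\<forall>v\<in>V. col v < colours \<Delta>) \<and> (\<forall>c::nat. indep2 {v\<in>V. col v = c})"
proof -
  define conf where "conf v = adj v \<union> \<Union>(adj ` adj v)" for v
  have fconf: "finite (conf v)" if "v \<in> V" for v
    unfolding conf_def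
    using finite_adj[OF that] finite_adj[OF subsetD[OF adj_subset[OF that]]]
    by (intro finite_UnI finite_UN_I) assumption+
  have conf: "card (conf v) \<le> \<Delta>\<^sup>2 + \<Delta>" if "v \<in> V" for v
  proof -
    have "card (conf v) \<le> card (adj v) + card (\<Union>(adj ` adj v))"
      unfolding conf_def by (rule card_Un_le)
    also have "card (\<Union>(adj ` adj v)) \<le> (\<Sum>u\<in>adj v. card (adj u))"
      using finite_adj[OF that] by (rule card_UN_le)
    also have "\<dots> \<le> (\<Sum>u\<in>adj v. \<Delta>)"
      using adj_subset[OF that] card_adj by (intro sum_mono) blast
    also have "\<dots> \<le> \<Delta> * \<Delta>" using card_adj[OF that] by simp
    finally show ?thesis using card_adj[OF that] by (simp add: power2_eq_square)
  qed
  have conf_sym: "u \<in> conf v \<Longrightarrow> v \<in> conf u" for u v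
    unfolding conf_def by (blast dest: adj_sym)
  have "\<exists>col. (\<forall>v\<in>S. col v < colours \<Delta>) \<and>
      (\<forall>u\<in>S. \<forall>v\<in>S. u \<noteq> v \<longrightarrow> col u = (col v::nat) \<longrightarrow> u \<notin> conf v)" if "S \<subseteq> V" for S
    using finite_subset[OF that finite_V] that
  proof (induction S rule: finite_induct)
    case (insert w S)
    have SV: "S \<subseteq> V" and w: "w \<in> V" using insert.prems by blast+
    obtain col where col: "\<forall>v\<in>S. col v < colours \<Delta>"
      "\<forall>u\<in>S. \<forall>v\<in>S. u \<noteq> v \<longrightarrow> col u = (col v::nat) \<longrightarrow> u \<notin> conf v"
      using insert.IH[OF SV] by (elim exE conjE) (rule that; assumption)
    have "card (col ` conf w) \<le> \<Delta>\<^sup>2 + \<Delta>"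
      using conf[OF w] card_image_le[OF fconf[OF w], of col] by linarith
    then have "card (col ` conf w) < card {..<colours \<Delta>}" by simp
    then have "\<not> {..<colours \<Delta>} \<subseteq> col ` conf w"
      using card_mono[OF finite_imageI[OF fconf[OF w], of col], of "{..<colours \<Delta>}"]
      by linarith
    then obtain c where c: "c < colours \<Delta>" "c \<notin> col ` conf w" by blast
    define col' where "col' = col(w := c)"
    have 1: "u \<notin> conf w" if "u \<in> S" "col u = c" for u using c(2) that by blast
    have 2: "\<forall>v\<in>insert w S. col' v < colours \<Delta>"
      using col(1) c(1) by (simp add: col'_def)
    have 3: "u \<notin> conf v"
      if uv: "u \<in> insert w S" "v \<in> insert w S" "u \<noteq> v" "col' u = col' v" for u v
    proof -
      consider "u = w" "v \<in> S" "v \<noteq> w" | "v = w" "u \<in> S" "u \<noteq> w" | "u \<in> S" "v \<in> S" "u \<noteq> w" "v \<noteq> w"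
        using uv insert.hyps by blast
      then show ?thesis
      proof cases
        case 1
        then have "v \<notin> conf w" using uv(4) c(2) by (auto simp: col'_def)
        then show ?thesis using 1 conf_sym by blast
      next
        case 2
        then show ?thesis using uv(4) c(2) by (auto simp: col'_def)
      next
        case 3
        then show ?thesis using uv(3,4) col(2) by (simp add: col'_def)
      qed
    qed
    show ?case by (intro exI[of _ col'] conjI ballI impI) (rule 2[rule_format] 3; assumption)+
  qed simp
  note this[OF order_refl]
  then obtain col where col: "\<forall>v\<in>V. col v < colours \<Delta>"
    "\<forall>u\<in>V. \<forall>v\<in>V. u \<noteq> v \<longrightarrow> col u = (col v::nat) \<longrightarrow> u \<notin> conf v"
    by (elim exE conjE) (rule that; assumption)
  have "indep2 {v\<in>V. col v = c}" for c
    unfolding indep2_def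
  proof (intro ballI impI)
    fix u v assume "u \<in> {v\<in>V. col v = c}" "v \<in> {v\<in>V. col v = c}" "u \<noteq> v"
    then have "u \<notin> conf v" "v \<notin> conf u" using col(2) by auto
    then show "v \<notin> adj u \<and> adj u \<inter> adj v = {}" unfolding conf_def by (blast dest: adj_sym)
  qed
  with col(1) show ?thesis by blast
qed

text \<open>Pigeonhole over the classes of the square colouring.\<close>

lemma large_indep2:
  assumes "L \<subseteq> V"
  shows "\<exists>B\<subseteq>L. indep2 B \<and> card L \<le> colours \<Delta> * card B"
proof (rule ccontr)
  assume neg: "\<not> ?thesis"
  obtain col where col: "\<forall>v\<in>V. col v < colours \<Delta>" "\<forall>c::nat. indep2 {v\<in>V. col v = c}"
    using square_coloring by blast
  let ?r = "colours \<Delta>"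
  let ?B = "\<lambda>c. {v\<in>L. col v = c}"
  have fin: "finite L" using assms finite_V finite_subset by blast
  have "?r * card (?B c) < card L" for c
  proof -
    have 1: "?B c \<subseteq> L" by blast
    have 2: "indep2 (?B c)" by (rule indep2_subset[OF col(2)[rule_format, of c]]) (use assms in auto)
    show ?thesis
    proof (rule not_le_imp_less, rule notI)
      assume "card L \<le> ?r * card (?B c)"
      with 1 2 have "\<exists>B\<subseteq>L. indep2 B \<and> card L \<le> ?r * card B"
        by (intro exI[of _ "?B c"] conjI)
      with neg show False by (rule notE)
    qed
  qed
  then have "(\<Sum>c<?r. ?r * card (?B c)) < (\<Sum>c<?r. card L)"
    by (intro sum_strict_mono) auto
  moreover have "L = (\<Union>c<?r. ?B c)" using col(1) assms by auto
  then have "card L \<le> (\<Sum>c<?r. card (?B c))"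
    using card_UN_le[OF finite_lessThan, of ?B "?r"] by argo
  then have "?r * card L \<le> ?r * (\<Sum>c<?r. card (?B c))" by (rule mult_le_mono2)
  then have "?r * card L \<le> (\<Sum>c<?r. ?r * card (?B c))"
    unfolding sum_distrib_left .
  ultimately show False by simp
qed

end

section \<open>Embedding the core vertex by vertex\<close>

text \<open>The host graph lives on \<open>{..<n}\<close>. The core is embedded into the consecutive blocks \<open>cls a c\<close>,
  one for each colour \<open>c\<close> of a colouring of the square of the guest graph: the image of a vertex and
  the images of its neighbours lie in different blocks, and the neighbourhoods of vertices of one
  colour are disjoint.\<close>

definition com :: "nat \<Rightarrow> nat set set \<Rightarrow> nat set \<Rightarrow> nat set" where
  "com n E F = {x. x < n \<and> (\<forall>u\<in>F. {u, x} \<in> E)}"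

definition cls :: "nat \<Rightarrow> nat \<Rightarrow> nat set" where
  "cls a c = {c * a..<Suc c * a}"

lemma com_subset: "com n E F \<subseteq> {..<n}"
  by (auto simp: com_def)

lemma finite_com [simp]: "finite (com n E F)"
  by (rule finite_subset[OF com_subset]) simp

lemma com_insert: "com n E (insert y F) = com n E {y} \<inter> com n E F"
  by (auto simp: com_def)

lemma com_empty [simp]: "com n E {} = {..<n}"
  by (auto simp: com_def)

lemma card_cls [simp]: "card (cls a c) = a"
  by (simp add: cls_def)

lemma finite_cls [simp]: "finite (cls a c)"
  by (simp add: cls_def)

lemma cls_div: "x \<in> cls a c \<Longrightarrow> x div a = c"
  by (metis atLeastLessThan_iff cls_def div_nat_eqI mult.commute mult_Suc_right mult_Suc)

lemma cls_disjoint: "x \<in> cls a c \<Longrightarrow> x \<in> cls a c' \<Longrightarrow> c = c'"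
  using cls_div by blast

lemma cls_subset: "c < r \<Longrightarrow> cls a c \<subseteq> {..<r * a}"
proof
  fix x assume "c < r" "x \<in> cls a c"
  then have "x < Suc c * a" "Suc c * a \<le> r * a"
    using mult_le_mono1[of "Suc c" r a] by (auto simp: cls_def)
  then show "x \<in> {..<r * a}" by simp
qed

lemma card_small_subsets:
  assumes "finite A"
  shows "card {F. F \<subseteq> A \<and> card F \<le> k} \<le> (card A + 1) ^ k"
proof (induction k)
  case 0
  have "F = {}" if "F \<subseteq> A" "card F \<le> 0" for F
    using finite_subset[OF that(1) assms] that(2) by simp
  then have "{F. F \<subseteq> A \<and> card F \<le> 0} = {{}}" by auto
  then show ?case by simp
next
  case (Suc k)
  let ?S = "\<lambda>k. {F. F \<subseteq> A \<and> card F \<le> k}"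
  have finS: "finite (?S k)" for k
    by (rule finite_subset[of _ "Pow A"]) (use assms in auto)
  have sub: "?S (Suc k) \<subseteq> ?S k \<union> (\<lambda>(x, G). insert x G) ` (A \<times> ?S k)"
  proof
    fix F assume F: "F \<in> ?S (Suc k)"
    show "F \<in> ?S k \<union> (\<lambda>(x, G). insert x G) ` (A \<times> ?S k)"
    proof (cases "F = {}")
      case False
      then obtain x where x: "x \<in> F" by blast
      have "finite F" using F assms finite_subset by blast
      then have "(x, F - {x}) \<in> A \<times> ?S k" using F x by auto
      moreover have "F = (\<lambda>(x, G). insert x G) (x, F - {x})" using x by auto
      ultimately show ?thesis by (metis (lifting) UnI2 image_eqI)
    qed simp
  qed
  have "card (?S (Suc k)) \<le> card (?S k) + card ((\<lambda>(x, G). insert x G) ` (A \<times> ?S k))"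
    using card_mono[OF _ sub] card_Un_le finS assms
    by (meson finite_SigmaI finite_UnI finite_imageI order_trans)
  also have "card ((\<lambda>(x, G). insert x G) ` (A \<times> ?S k)) \<le> card A * card (?S k)"
    using card_image_le[of "A \<times> ?S k"] finS assms by (simp add: card_cartesian_product)
  also have "card (?S k) + card A * card (?S k) = (card A + 1) * card (?S k)" by simp
  also have "\<dots> \<le> (card A + 1) * (card A + 1) ^ k" using Suc by (intro mult_le_mono2)
  finally show ?case by simp
qed

section \<open>The potential and one greedy step\<close>

text \<open>\<open>R\<close> is the core; \<open>W0\<close> is a part of the last batch, of common
  degree \<open>k0\<close>, with all neighbours in the core. Plain embedding works with common
  neighbourhoods of at most \<open>d\<close> vertices; following the stars at \<open>W0\<close> adds
  one host vertex, whence \<open>W0_k\<close>.\<close>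

locale greedy_embedding = degenerate_graph V adj d \<Delta>
  for V :: "'a set" and adj d \<Delta> +
  fixes n a r k k0 m :: nat and E :: "nat set set" and p :: real
    and col :: "'a \<Rightarrow> nat" and R W0 :: "'a set"
  assumes p_pos: "0 < p" and p_le: "p \<le> 1"
    and R_subset: "R \<subseteq> V" and card_R: "card R \<le> m" and m_le: "640 * m \<le> a"
    and col_less: "v \<in> R \<Longrightarrow> col v < r"
    and col_indep: "indep2 {v\<in>R. col v = c}"
    and ra_le: "r * a \<le> n" and a_pos: "0 < a"
    and d_le_k: "d \<le> k"
    and W0_subset: "W0 \<subseteq> V" and adj_W0: "w \<in> W0 \<Longrightarrow> adj w \<subseteq> R"
    and card_adj_W0: "w \<in> W0 \<Longrightarrow> card (adj w) = k0"
    and indep_W0: "indep2 W0"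
    and W0_k: "W0 \<noteq> {} \<Longrightarrow> k = Suc d"
    and lower: "F \<subseteq> {..<n} \<Longrightarrow> card F \<le> k \<Longrightarrow> c < r \<Longrightarrow>
      p ^ card F * a / 8 \<le> card (com n E F \<inter> cls a c)"
    and upper: "F \<subseteq> {..<n} \<Longrightarrow> card F \<le> d \<Longrightarrow> c < r \<Longrightarrow>
      card (com n E F \<inter> cls a c) \<le> 4 * p ^ card F * a"
    and spread: "c < r \<Longrightarrow> X \<subseteq> cls a c \<Longrightarrow> p ^ k * a / 8 \<le> card X \<Longrightarrow>
      (\<And>F. F \<in> \<F> \<Longrightarrow> F \<subseteq> {..<n} - cls a c \<and> F \<noteq> {} \<and> card F \<le> d) \<Longrightarrow>
      disjoint \<F> \<Longrightarrow> card \<F> \<le> m \<Longrightarrow>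
      (\<Sum>F\<in>\<F>. card (com n E F \<inter> X) / p ^ card F) \<le> 4 * m * card X"
    and big: "32 * ln (real (r * (n + 1) ^ k + n)) \<le> p ^ k * a"
begin

abbreviation N :: "nat set \<Rightarrow> nat set" where "N \<equiv> com n E"

text \<open>\<open>64 = 16 * 4\<close>: at least \<open>p ^ Suc j * a / 16\<close> free candidates
  are adjacent to a given host vertex, out of at most \<open>4 * p ^ j * a\<close> candidates, where
  \<open>j\<close> is the number of embedded neighbours.\<close>

definition q :: real where "q = p / 64"

text \<open>A bound for the number of summands of \<open>potential\<close>, each of which equals 1
  while nothing is embedded.\<close>

definition \<Phi>0 :: real where "\<Phi>0 = real (r * (n + 1) ^ k + n)"

definition index :: "(nat set \<times> nat) set" where
  "index = {F. F \<subseteq> {..<n} \<and> card F \<le> k} \<times> {..<r}"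

text \<open>\<open>hist\<close> majorises the expected number of images falling into \<open>N F \<inter> cls a c\<close> when each vertex \<open>v\<close>
  chooses its image uniformly among the unused common neighbours of \<open>f ` B v\<close>. Then \<open>cost\<close> is a
  supermartingale, and so is \<open>\<Prod>w\<in>W0. chance f S y w\<close>, since \<open>q\<close> bounds from below the probability
  that the next vertex of \<open>adj w\<close> lands in \<open>N {y}\<close>. Choosing each image so that \<open>potential\<close> does not
  increase derandomises the random greedy embedding.\<close>

definition hist :: "('a \<Rightarrow> nat) \<Rightarrow> ('a \<Rightarrow> 'a set) \<Rightarrow> 'a set \<Rightarrow> nat set \<Rightarrow> nat \<Rightarrow> real" where
  "hist f B S F c = (\<Sum>v\<in>{v\<in>S. col v = c}.
     32 / a * card (N F \<inter> cls a c \<inter> N (f ` B v)) / p ^ card (B v))"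

definition cost :: "('a \<Rightarrow> nat) \<Rightarrow> ('a \<Rightarrow> 'a set) \<Rightarrow> 'a set \<Rightarrow> nat set \<Rightarrow> nat \<Rightarrow> real" where
  "cost f B S F c = exp (card (N F \<inter> cls a c \<inter> f ` S) - hist f B S F c)"

definition chance :: "('a \<Rightarrow> nat) \<Rightarrow> 'a set \<Rightarrow> nat \<Rightarrow> 'a \<Rightarrow> real" where
  "chance f S y w = (if f ` (adj w \<inter> S) \<subseteq> N {y} then 1 - q ^ card (adj w - S) / 2 else 1)"

definition potential :: "('a \<Rightarrow> nat) \<Rightarrow> ('a \<Rightarrow> 'a set) \<Rightarrow> 'a set \<Rightarrow> real" where
  "potential f B S = (\<Sum>(F, c)\<in>index. cost f B S F c) +
     (\<Sum>y<n. (\<Prod>w\<in>W0. chance f S y w) / (1 - q ^ k0 / 2) ^ card W0)"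

text \<open>\<open>B v\<close> records the neighbours present when \<open>v\<close> was placed. It
  is carried along because \<open>hist\<close> refers to the candidates at that moment, not to the
  current \<open>S\<close>.\<close>

definition partial_embedding :: "('a \<Rightarrow> nat) \<Rightarrow> ('a \<Rightarrow> 'a set) \<Rightarrow> 'a set \<Rightarrow> bool" where
  "partial_embedding f B S \<longleftrightarrow> inj_on f S \<and> (\<forall>v\<in>S. f v \<in> cls a (col v)) \<and>
     (\<forall>u\<in>S. \<forall>v\<in>adj u \<inter> S. {f u, f v} \<in> E) \<and> (\<forall>v\<in>S. B v \<subseteq> adj v \<inter> S \<and> card (B v) \<le> d)"

lemma q_bounds: "0 < q" "q \<le> 1" "0 \<le> q ^ j" "q ^ j \<le> 1"
  using p_pos p_le by (auto simp: q_def power_le_one)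

lemma chance_bounds: "1 / 2 \<le> chance f S y w" "chance f S y w \<le> 1" "0 \<le> chance f S y w"
  using q_bounds(3,4)[of "card (adj w - S)"] by (auto simp: chance_def)

lemma denominator_pos: "0 < (1 - q ^ k0 / 2) ^ card W0"
  using q_bounds(3,4)[of k0] by (intro zero_less_power) auto

lemma finite_index: "finite index"
  unfolding index_def by (intro finite_cartesian_product) auto

lemma finite_R: "finite R"
  using R_subset finite_V finite_subset by blast

lemma finite_W0: "finite W0"
  using W0_subset finite_V finite_subset by blast

lemma cost_nonneg: "0 \<le> cost f B S F c"
  by (simp add: cost_def)

lemma potential_parts:
  shows "0 \<le> (\<Sum>(F, c)\<in>index. cost f B S F c)"
    and "0 \<le> (\<Sum>y<n. (\<Prod>w\<in>W0. chance f S y w) / (1 - q ^ k0 / 2) ^ card W0)"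
  using denominator_pos
  by (auto intro!: sum_nonneg prod_nonneg divide_nonneg_pos simp: cost_nonneg chance_bounds)

lemma cost_le_potential:
  assumes "F \<subseteq> {..<n}" "card F \<le> k" "c < r"
  shows "cost f B S F c \<le> potential f B S"
proof -
  have "(F, c) \<in> index" using assms by (simp add: index_def)
  from member_le_sum[OF this, of "\<lambda>(F, c). cost f B S F c"] finite_index
  have "cost f B S F c \<le> (\<Sum>(F, c)\<in>index. cost f B S F c)" by (auto simp: cost_nonneg)
  then show ?thesis using potential_parts(2)[of f S] by (simp add: potential_def)
qed

text \<open>\<open>spread\<close> is applied to the images of the sets \<open>B v\<close>: for
  vertices of one colour they are disjoint and avoid the block of that colour. Vertices with empty
  \<open>B v\<close> are counted apart, since their images would collapse to a single member of the
  family; each of them contributes at most \<open>card X\<close>.\<close>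

lemma hist_le:
  assumes S: "S \<subseteq> R" and emb: "partial_embedding f B S"
    and F: "F \<subseteq> {..<n}" "card F \<le> k" and c: "c < r"
  shows "hist f B S F c \<le> card (N F \<inter> cls a c) / 4"
proof -
  define X where "X = N F \<inter> cls a c"
  define S0 where "S0 = {v\<in>S. col v = c \<and> B v = {}}"
  define S1 where "S1 = {v\<in>S. col v = c \<and> B v \<noteq> {}}"
  define h where "h = (\<lambda>v. card (N (f ` B v) \<inter> X) / p ^ card (B v))"
  have finS: "finite S" using S finite_R finite_subset by blast
  have fin: "finite S0" "finite S1" "S0 \<inter> S1 = {}" "{v\<in>S. col v = c} = S0 \<union> S1"
    using finS by (auto simp: S0_def S1_def)
  have card_S: "card S0 \<le> m" "card S1 \<le> m"
  proof -
    have "card S \<le> m" using card_mono[OF finite_R S] card_R by linarith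
    moreover have "card S0 \<le> card S" "card S1 \<le> card S"
      using finS by (auto intro!: card_mono simp: S0_def S1_def)
    ultimately show "card S0 \<le> m" "card S1 \<le> m" by linarith+
  qed
  have inj: "inj_on f S" and Bsub: "\<And>v. v \<in> S \<Longrightarrow> B v \<subseteq> adj v \<inter> S \<and> card (B v) \<le> d"
    and fcls: "\<And>v. v \<in> S \<Longrightarrow> f v \<in> cls a (col v)"
    using emb by (auto simp: partial_embedding_def)
  have disjB: "B u \<inter> B v = {}" if "u \<in> S1" "v \<in> S1" "u \<noteq> v" for u v
  proof -
    have "adj u \<inter> adj v = {}"
      using indep2D(2)[OF col_indep[of c], of u v] that S by (auto simp: S1_def)
    moreover have "B u \<subseteq> adj u" "B v \<subseteq> adj v" using Bsub that by (simp_all add: S1_def)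
    ultimately show ?thesis by blast
  qed
  have disjf: "f ` B u \<inter> f ` B v = {}" if "u \<in> S1" "v \<in> S1" "u \<noteq> v" for u v
  proof -
    have "B u \<subseteq> S" "B v \<subseteq> S" using Bsub that by (auto simp: S1_def)
    then have "f ` B u \<inter> f ` B v = f ` (B u \<inter> B v)" using inj by (simp add: inj_on_image_Int)
    then show ?thesis using disjB[OF that] by simp
  qed
  have cardf: "card (f ` B v) = card (B v)" if "v \<in> S" for v
    using Bsub[OF that] inj by (meson card_image inf.boundedE inj_on_subset)
  have inj1: "inj_on (\<lambda>v. f ` B v) S1"
  proof (rule inj_onI, rule ccontr)
    fix u v assume "u \<in> S1" "v \<in> S1" "f ` B u = f ` B v" "u \<noteq> v"
    then have "f ` B u = {}" using disjf by blast
    then show False using \<open>u \<in> S1\<close> by (simp add: S1_def)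
  qed
  have "(\<Sum>G\<in>(\<lambda>v. f ` B v) ` S1. card (N G \<inter> X) / p ^ card G) \<le> 4 * m * card X"
  proof (rule spread[OF c])
    show "X \<subseteq> cls a c" by (simp add: X_def)
    have "p ^ k \<le> p ^ card F" using F(2) p_pos p_le by (intro power_decreasing) auto
    then have "p ^ k * a / 8 \<le> p ^ card F * a / 8" by (simp add: mult_right_mono)
    also have "\<dots> \<le> card X" unfolding X_def using lower[OF F c] by simp
    finally show "p ^ k * a / 8 \<le> card X" .
    show "disjoint ((\<lambda>v. f ` B v) ` S1)"
      using disjf by (auto simp: disjoint_def)
    show "card ((\<lambda>v. f ` B v) ` S1) \<le> m" using card_image_le[OF fin(2)] card_S(2) le_trans by blast
    fix G assume "G \<in> (\<lambda>v. f ` B v) ` S1"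
    then obtain v where v: "v \<in> S1" "G = f ` B v" by blast
    then have vS: "v \<in> S" "col v = c" "B v \<noteq> {}" by (auto simp: S1_def)
    have "f u \<in> {..<n} - cls a c" if u: "u \<in> B v" for u
    proof -
      have uS: "u \<in> S" "u \<in> adj v" using u Bsub[OF vS(1)] by auto
      have "col u \<noteq> c"
      proof
        assume "col u = c"
        moreover have "u \<noteq> v" using uS adj_irrefl by blast
        ultimately have "u \<notin> adj v"
          using indep2D(1)[OF col_indep[of c], of v u] uS(1) vS S by auto
        then show False using uS by simp
      qed
      then have "f u \<notin> cls a c" using fcls[OF uS(1)] cls_disjoint by blast
      moreover have "f u \<in> {..<r * a}"
        using fcls[OF uS(1)] cls_subset[OF col_less, of u a] uS S by blast
      ultimately show ?thesis using ra_le by simp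
    qed
    then show "G \<subseteq> {..<n} - cls a c \<and> G \<noteq> {} \<and> card G \<le> d"
      using v vS cardf[OF vS(1)] Bsub[OF vS(1)] by auto
  qed
  also have "(\<Sum>G\<in>(\<lambda>v. f ` B v) ` S1. card (N G \<inter> X) / p ^ card G) = (\<Sum>v\<in>S1. h v)"
    unfolding h_def using inj1 cardf by (subst sum.reindex) (auto simp: S1_def)
  finally have 1: "(\<Sum>v\<in>S1. h v) \<le> 4 * m * card X" .
  have "h v \<le> card X" if "v \<in> S0" for v
  proof -
    have "h v = card ({..<n} \<inter> X)" using that by (simp add: h_def S0_def)
    also have "\<dots> \<le> card X" by (auto intro!: card_mono simp: X_def)
    finally show ?thesis .
  qed
  then have "(\<Sum>v\<in>S0. h v) \<le> card S0 * real (card X)"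
    using sum_bounded_above[of S0 h "real (card X)"] by simp
  also have "\<dots> \<le> m * real (card X)" using card_S(1) by (intro mult_right_mono) auto
  finally have 2: "(\<Sum>v\<in>S0. h v) \<le> m * real (card X)" .
  have "hist f B S F c = 32 / a * (\<Sum>v\<in>{v\<in>S. col v = c}. h v)"
    unfolding hist_def h_def X_def sum_distrib_left
    by (intro sum.cong) (auto simp: Int_ac)
  also have "(\<Sum>v\<in>{v\<in>S. col v = c}. h v) = (\<Sum>v\<in>S0. h v) + (\<Sum>v\<in>S1. h v)"
    using fin by (simp add: sum.union_disjoint)
  also have "32 / a * \<dots> \<le> 32 / a * (5 * m * card X)"
    using 1 2 by (intro mult_left_mono) auto
  \<comment> \<open>The 5 is 4 from \<open>S1\<close> plus 1 from \<open>S0\<close>, and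
    \<open>32 * 5 * 4 = 640\<close> is the constant in \<open>m_le\<close>.\<close>
  also have "\<dots> = (640 * m) / a * (card X / 4)" by simp
  also have "\<dots> \<le> 1 * (card X / 4)"
    using m_le a_pos by (intro mult_right_mono) (auto simp: divide_le_eq_1)
  finally show ?thesis by (simp add: X_def)
qed

text \<open>The logarithm of a single summand of \<open>potential\<close>: the used vertices exceed
  \<open>hist\<close> by at most \<open>ln \<Phi>0\<close>, and both terms are at most a quarter of
  the common neighbourhood, by \<open>hist_le\<close> and \<open>big\<close>.\<close>

lemma used_le_half:
  assumes S: "S \<subseteq> R" and emb: "partial_embedding f B S" and pot: "potential f B S \<le> \<Phi>0"
    and F: "F \<subseteq> {..<n}" "card F \<le> k" and c: "c < r"
  shows "card (N F \<inter> cls a c \<inter> f ` S) \<le> card (N F \<inter> cls a c) / 2"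
proof -
  have pos: "0 < \<Phi>0"
  proof -
    have "0 < cost f B S F c" by (simp add: cost_def)
    then show ?thesis using cost_le_potential[OF F c, of f B S] pot by linarith
  qed
  have "exp (card (N F \<inter> cls a c \<inter> f ` S) - hist f B S F c) \<le> \<Phi>0"
    using cost_le_potential[OF F c, of f B S] pot by (simp add: cost_def)
  then have "card (N F \<inter> cls a c \<inter> f ` S) - hist f B S F c \<le> ln \<Phi>0"
    using pos by (simp add: ln_ge_iff)
  moreover have "ln \<Phi>0 \<le> card (N F \<inter> cls a c) / 4"
  proof -
    have "p ^ k \<le> p ^ card F" using F(2) p_pos p_le by (intro power_decreasing) auto
    then have "p ^ k * a / 8 \<le> p ^ card F * a / 8" by (simp add: mult_right_mono)
    then show ?thesis using lower[OF F c] big by (simp add: \<Phi>0_def)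
  qed
  ultimately show ?thesis using hist_le[OF S emb F c] by simp
qed

lemma available_ge:
  assumes S: "S \<subseteq> R" and emb: "partial_embedding f B S" and pot: "potential f B S \<le> \<Phi>0"
    and F: "F \<subseteq> {..<n}" "card F \<le> k" and c: "c < r"
  shows "p ^ card F * a / 16 \<le> card (N F \<inter> cls a c - f ` S)"
proof -
  have "card (N F \<inter> cls a c) = card (N F \<inter> cls a c \<inter> f ` S) + card (N F \<inter> cls a c - f ` S)"
    by (metis Int_Diff_Un Int_Diff_disjoint card_Un_disjoint finite_Diff finite_Int finite_com)
  then show ?thesis using used_le_half[OF assms] lower[OF F c] by simp
qed

text \<open>Only costs of the colour of \<open>v\<close> change. A hit of \<open>Z\<close>
  multiplies the cost by \<open>exp 1 \<le> 1 + 2\<close>, and since at least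
  \<open>p ^ j * a / 16\<close> candidates exist, the average factor is at most
  \<open>1 + h \<le> exp h\<close>, which the increase \<open>h\<close> of \<open>hist\<close>
  cancels. This is the origin of \<open>32 = 2 * 16\<close> in \<open>hist\<close>.\<close>

lemma cost_step:
  fixes f B S v
  defines "A \<equiv> N (f ` (adj v \<inter> S)) \<inter> cls a (col v) - f ` S"
  assumes v: "v \<notin> S" "v \<in> R" and finS: "finite S"
    and B: "\<And>u. u \<in> S \<Longrightarrow> B u \<subseteq> S"
    and A: "p ^ card (adj v \<inter> S) * a / 16 \<le> card A"
  shows "(\<Sum>x\<in>A. cost (f(v := x)) (B(v := adj v \<inter> S)) (insert v S) F c) \<le> card A * cost f B S F c"
proof -
  let ?f = "\<lambda>x. f(v := x)" and ?B = "B(v := adj v \<inter> S)"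
  define Z where "Z = N F \<inter> cls a c"
  have finA: "finite A" by (simp add: A_def)
  have im: "?f x ` S = f ` S" "?f x ` insert v S = insert x (f ` S)" for x
    using v by auto
  have imB: "?f x ` B u = f ` B u" if "u \<in> S" for x u
    using v B[OF that] by auto
  have hist_old: "(\<Sum>u\<in>{u\<in>S. col u = c}. 32 / a * card (N F \<inter> cls a c \<inter> N (?f x ` ?B u)) / p ^ card (?B u))
      = hist f B S F c" for x
    unfolding hist_def using v imB by (intro sum.cong) auto
  show ?thesis
  proof (cases "col v = c")
    case False
    have "cost (?f x) ?B (insert v S) F c = cost f B S F c" if "x \<in> A" for x
    proof -
      have "x \<notin> cls a c" using that False cls_disjoint by (auto simp: A_def)
      then have 1: "N F \<inter> cls a c \<inter> insert x (f ` S) = N F \<inter> cls a c \<inter> f ` S" by auto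
      have 2: "{u \<in> insert v S. col u = c} = {u \<in> S. col u = c}" using False by auto
      show ?thesis unfolding cost_def im 1 using hist_old[of x] unfolding hist_def 2 by simp
    qed
    then show ?thesis by simp
  next
    case True
    define h where "h = 32 / a * card (Z \<inter> N (f ` (adj v \<inter> S))) / p ^ card (adj v \<inter> S)"
    have hist_new: "hist (?f x) ?B (insert v S) F c = h + hist f B S F c" for x
    proof -
      have 1: "{u \<in> insert v S. col u = c} = insert v {u \<in> S. col u = c}" using True by auto
      have 2: "?f x ` (adj v \<inter> S) = f ` (adj v \<inter> S)" using v by auto
      have "hist (?f x) ?B (insert v S) F c = 32 / a * card (N F \<inter> cls a c \<inter> N (?f x ` ?B v)) / p ^ card (?B v)
        + (\<Sum>u\<in>{u\<in>S. col u = c}. 32 / a * card (N F \<inter> cls a c \<inter> N (?f x ` ?B u)) / p ^ card (?B u))"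
        unfolding hist_def 1 using v finS by (subst sum.insert) auto
      then show ?thesis unfolding hist_old using 2 by (simp add: h_def Z_def)
    qed
    have card_new: "card (Z \<inter> ?f x ` insert v S) = card (Z \<inter> f ` S) + of_bool (x \<in> Z)"
      if "x \<in> A" for x
    proof -
      have "x \<notin> f ` S" using that by (simp add: A_def)
      then show ?thesis unfolding im using finS by auto
    qed
    have exp_le: "exp (of_bool P :: real) \<le> 1 + 2 * of_bool P" for P :: bool
      using exp_le by (cases P) auto
    have "(\<Sum>x\<in>A. cost (?f x) ?B (insert v S) F c)
        = (\<Sum>x\<in>A. cost f B S F c * exp (- h) * exp (of_bool (x \<in> Z)))"
      using card_new unfolding cost_def hist_new Z_def[symmetric]
      by (intro sum.cong) (auto simp flip: exp_add)
    also have "\<dots> \<le> (\<Sum>x\<in>A. cost f B S F c * exp (- h) * (1 + 2 * of_bool (x \<in> Z)))"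
      by (intro sum_mono mult_left_mono exp_le) (simp add: cost_nonneg)
    also have "\<dots> = cost f B S F c * exp (- h) * (card A + 2 * card (A \<inter> Z))"
      using finA by (simp add: sum_distrib_left[symmetric] sum.distrib)
    also have "\<dots> \<le> cost f B S F c * exp (- h) * (card A * exp h)"
    proof (rule mult_left_mono)
      have "card (A \<inter> Z) \<le> card (Z \<inter> N (f ` (adj v \<inter> S)))"
        by (intro card_mono) (auto simp: A_def)
      then have "2 * card (A \<inter> Z) \<le> 2 * real (card (Z \<inter> N (f ` (adj v \<inter> S))))" by simp
      also have "\<dots> = h * (p ^ card (adj v \<inter> S) * a / 16)"
        using p_pos a_pos by (simp add: h_def)
      also have "\<dots> \<le> h * card A"
        using A p_pos by (intro mult_left_mono) (auto simp: h_def)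
      finally have "card A + 2 * card (A \<inter> Z) \<le> card A * (1 + h)" by (simp add: algebra_simps)
      also have "\<dots> \<le> card A * exp h" by (intro mult_left_mono exp_ge_add_one_self) auto
      finally show "card A + 2 * card (A \<inter> Z) \<le> card A * exp h" by simp
    qed (simp add: cost_nonneg)
    also have "\<dots> = card A * cost f B S F c" by (simp add: exp_minus)
    finally show ?thesis .
  qed
qed

text \<open>At most one \<open>w\<close> in \<open>W0\<close> is adjacent to \<open>v\<close>,
  because neighbourhoods in \<open>W0\<close> are disjoint; so a single factor changes. If the star
  at \<open>w\<close> is still alive, a proportion of at least \<open>q\<close> of the candidates
  keeps it alive with one vertex fewer to go, and the average of the new factor is at most the old
  one.\<close>

lemma chance_step:
  fixes f S v
  defines "A \<equiv> N (f ` (adj v \<inter> S)) \<inter> cls a (col v) - f ` S"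
  assumes v: "v \<notin> S" "v \<in> R"
    and A: "\<And>w. w \<in> W0 \<Longrightarrow> q * card A \<le> card (A \<inter> N {y})"
  shows "(\<Sum>x\<in>A. \<Prod>w\<in>W0. chance (f(v := x)) (insert v S) y w) \<le> card A * (\<Prod>w\<in>W0. chance f S y w)"
proof -
  let ?f = "\<lambda>x. f(v := x)"
  have finA: "finite A" by (simp add: A_def)
  have same: "chance (?f x) (insert v S) y w = chance f S y w" if "v \<notin> adj w" for x w
  proof -
    have 1: "adj w \<inter> insert v S = adj w \<inter> S" "adj w - insert v S = adj w - S" using that by auto
    have 2: "?f x ` (adj w \<inter> S) = f ` (adj w \<inter> S)" using v by auto
    show ?thesis unfolding chance_def 1 2 ..
  qed
  show ?thesis
  proof (cases "\<exists>w\<in>W0. v \<in> adj w")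
    case False
    then have "(\<Prod>w\<in>W0. chance (?f x) (insert v S) y w) = (\<Prod>w\<in>W0. chance f S y w)" for x
      using same by (intro prod.cong) auto
    then show ?thesis by simp
  next
    case True
    then obtain w where w: "w \<in> W0" "v \<in> adj w" by blast
    define P where "P = (\<Prod>u\<in>W0 - {w}. chance f S y u)"
    have P: "(\<Prod>w\<in>W0. chance f S y w) = chance f S y w * P"
      unfolding P_def by (rule prod.remove[OF finite_W0 w(1)])
    have P_nonneg: "0 \<le> P" by (auto simp: P_def intro!: prod_nonneg chance_bounds)
    have new: "(\<Prod>w\<in>W0. chance (?f x) (insert v S) y w) = chance (?f x) (insert v S) y w * P" for x
    proof -
      have "v \<notin> adj u" if "u \<in> W0 - {w}" for u
      proof
        assume "v \<in> adj u"
        moreover have "adj u \<inter> adj w = {}" using indep2D(2)[OF indep_W0, of u w] that w(1) by blast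
        ultimately show False using w(2) by blast
      qed
      then have "(\<Prod>u\<in>W0 - {w}. chance (?f x) (insert v S) y u) = P"
        unfolding P_def using same by (intro prod.cong) auto
      then show ?thesis using prod.remove[OF finite_W0 w(1), of "chance (?f x) (insert v S) y"] by simp
    qed
    define b where "b = card (adj w - insert v S)"
    have fin_adj: "finite (adj w)" using w(1) W0_subset finite_adj by blast
    have b: "card (adj w - S) = Suc b"
    proof -
      have "adj w - S = insert v (adj w - insert v S)" using w v by auto
      moreover have "card (insert v (adj w - insert v S)) = Suc b"
        using fin_adj unfolding b_def by (intro card_insert_disjoint) auto
      ultimately show ?thesis by argo
    qed
    have im: "?f x ` (adj w \<inter> insert v S) = insert x (f ` (adj w \<inter> S))" for x
    proof -
      have "?f x ` (adj w \<inter> insert v S) = insert x (?f x ` (adj w \<inter> S))" using w(2) by auto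
      also have "?f x ` (adj w \<inter> S) = f ` (adj w \<inter> S)" using v by auto
      finally show ?thesis .
    qed
    have "(\<Sum>x\<in>A. chance (?f x) (insert v S) y w) \<le> card A * chance f S y w"
    proof (cases "f ` (adj w \<inter> S) \<subseteq> N {y}")
      case False
      then show ?thesis unfolding chance_def im by simp
    next
      case True
      have "(\<Sum>x\<in>A. chance (?f x) (insert v S) y w) = (\<Sum>x\<in>A. 1 - q ^ b / 2 * of_bool (x \<in> N {y}))"
        unfolding chance_def im b_def[symmetric] using True by (intro sum.cong) auto
      also have "\<dots> = card A - q ^ b / 2 * card (A \<inter> N {y})"
        unfolding sum_subtractf sum_distrib_left[symmetric] using finA by simp
      also have "\<dots> \<le> card A - q ^ b / 2 * (q * card A)"
        using A[OF w(1)] q_bounds(3)[of b] by (intro diff_left_mono mult_left_mono) auto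
      also have "\<dots> = card A * chance f S y w"
        unfolding chance_def b using True by (simp add: algebra_simps)
      finally show ?thesis .
    qed
    then have "(\<Sum>x\<in>A. chance (?f x) (insert v S) y w) * P \<le> card A * chance f S y w * P"
      using P_nonneg by (intro mult_right_mono)
    then show ?thesis unfolding new P sum_distrib_right by (simp add: mult.assoc)
  qed
qed

lemma embed_one:
  assumes S: "S \<subseteq> R" and v: "v \<in> R" "v \<notin> S" and deg: "card (adj v \<inter> S) \<le> d"
    and emb: "partial_embedding f B S" and pot: "potential f B S \<le> \<Phi>0"
  shows "\<exists>f B. partial_embedding f B (insert v S) \<and> potential f B (insert v S) \<le> \<Phi>0"
proof -
  define F where "F = f ` (adj v \<inter> S)"
  define A where "A = N F \<inter> cls a (col v) - f ` S"
  let ?f = "\<lambda>x. f(v := x)" and ?B = "B(v := adj v \<inter> S)"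
  have finA: "finite A" by (simp add: A_def)
  have finS: "finite S" using S finite_R finite_subset by blast
  have inj: "inj_on f S" and fcls: "\<And>u. u \<in> S \<Longrightarrow> f u \<in> cls a (col u)"
    and Bsub: "\<And>u. u \<in> S \<Longrightarrow> B u \<subseteq> adj u \<inter> S \<and> card (B u) \<le> d"
    and edge: "\<And>u w. u \<in> S \<Longrightarrow> w \<in> adj u \<inter> S \<Longrightarrow> {f u, f w} \<in> E"
    using emb by (auto simp: partial_embedding_def)
  have f_less: "f u < n" if "u \<in> S" for u
    using fcls[OF that] cls_subset[OF col_less, of u a] that S ra_le by fastforce
  have F: "F \<subseteq> {..<n}" using f_less by (auto simp: F_def)
  have cardF: "card F = card (adj v \<inter> S)"
    unfolding F_def using inj by (meson card_image inf_le2 inj_on_subset)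
  have cv: "col v < r" using col_less v by blast
  have Fk: "card F \<le> k" using cardF deg d_le_k by simp
  have A_ge: "p ^ card F * a / 16 \<le> card A"
    unfolding A_def by (rule available_ge[OF S emb pot F Fk cv])
  then have A_pos: "0 < card A" using p_pos a_pos by (smt (verit) divide_pos_pos mult_pos_pos of_nat_0_less_iff zero_less_power)
  have A_le: "card A \<le> 4 * p ^ card F * a"
  proof -
    have "card A \<le> card (N F \<inter> cls a (col v))" unfolding A_def by (intro card_mono) auto
    then show ?thesis using upper[OF F _ cv] cardF deg by linarith
  qed
  \<comment> \<open>\<open>available_ge\<close> is used for \<open>insert y F\<close>, which has up
    to \<open>Suc d\<close> elements. If \<open>y\<close> lies in \<open>F\<close> the set does not
    grow, which only helps because \<open>p \<le> 1\<close>.\<close>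
  have near: "q * card A \<le> card (A \<inter> N {y})" if w: "w \<in> W0" and y: "y < n" for w y
  proof -
    have k: "k = Suc d" using W0_k w by blast
    have ins: "insert y F \<subseteq> {..<n}" "card (insert y F) \<le> Suc (card F)"
      using F y card_insert_le_m1[of "Suc (card F)" F y] by auto
    have "p ^ Suc (card F) \<le> p ^ card (insert y F)"
      using ins(2) p_pos p_le by (intro power_decreasing) auto
    then have "p ^ Suc (card F) * a / 16 \<le> p ^ card (insert y F) * a / 16"
      by (simp add: mult_right_mono)
    also have "\<dots> \<le> card (N (insert y F) \<inter> cls a (col v) - f ` S)"
      using ins(2) cardF deg k by (intro available_ge[OF S emb pot ins(1) _ cv]) auto
    also have "N (insert y F) \<inter> cls a (col v) - f ` S = A \<inter> N {y}"
      by (subst com_insert) (auto simp: A_def)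
    finally have "p ^ Suc (card F) * a / 16 \<le> card (A \<inter> N {y})" .
    moreover have "q * card A \<le> q * (4 * p ^ card F * a)"
      using A_le q_bounds(1) by (intro mult_left_mono) auto
    moreover have "q * (4 * p ^ card F * a) = p ^ Suc (card F) * a / 16" by (simp add: q_def)
    ultimately show ?thesis by linarith
  qed
  have "(\<Sum>x\<in>A. potential (?f x) ?B (insert v S)) \<le> card A * potential f B S"
  proof -
    have "(\<Sum>x\<in>A. \<Sum>(F, c)\<in>index. cost (?f x) ?B (insert v S) F c)
        = (\<Sum>(F, c)\<in>index. \<Sum>x\<in>A. cost (?f x) ?B (insert v S) F c)"
      by (subst sum.swap) (simp add: case_prod_unfold)
    also have "\<dots> \<le> (\<Sum>(F, c)\<in>index. card A * cost f B S F c)"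
      unfolding case_prod_unfold
    proof (rule sum_mono)
      fix i
      show "(\<Sum>x\<in>A. cost (?f x) ?B (insert v S) (fst i) (snd i)) \<le> card A * cost f B S (fst i) (snd i)"
        unfolding A_def F_def
        by (rule cost_step) (use v finS Bsub A_ge cardF in \<open>auto simp: A_def F_def\<close>)
    qed
    also have "\<dots> = card A * (\<Sum>(F, c)\<in>index. cost f B S F c)"
      by (simp add: sum_distrib_left case_prod_unfold)
    finally have 1: "(\<Sum>x\<in>A. \<Sum>(F, c)\<in>index. cost (?f x) ?B (insert v S) F c)
      \<le> card A * (\<Sum>(F, c)\<in>index. cost f B S F c)" .
    let ?D = "(1 - q ^ k0 / 2) ^ card W0"
    have "(\<Sum>x\<in>A. \<Sum>y<n. (\<Prod>w\<in>W0. chance (?f x) (insert v S) y w) / ?D)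
        = (\<Sum>y<n. (\<Sum>x\<in>A. \<Prod>w\<in>W0. chance (?f x) (insert v S) y w) / ?D)"
      by (subst sum.swap) (simp add: sum_divide_distrib)
    also have "\<dots> \<le> (\<Sum>y<n. card A * (\<Prod>w\<in>W0. chance f S y w) / ?D)"
    proof (intro sum_mono divide_right_mono)
      fix y assume "y \<in> {..<n}"
      then have "q * card A \<le> card (A \<inter> N {y})" if "w \<in> W0" for w using near[OF that] by auto
      then show "(\<Sum>x\<in>A. \<Prod>w\<in>W0. chance (?f x) (insert v S) y w) \<le> card A * (\<Prod>w\<in>W0. chance f S y w)"
        unfolding A_def F_def by (intro chance_step v)
    qed (use denominator_pos in simp)
    also have "\<dots> = card A * (\<Sum>y<n. (\<Prod>w\<in>W0. chance f S y w) / ?D)"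
      by (simp add: sum_distrib_left)
    finally show ?thesis using 1 unfolding potential_def sum.distrib distrib_left by (rule_tac add_mono)
  qed
  also have "\<dots> \<le> card A * \<Phi>0" using pot by (intro mult_left_mono) auto
  finally have sum_le: "(\<Sum>x\<in>A. potential (?f x) ?B (insert v S)) \<le> card A * \<Phi>0" .
  have "\<exists>x\<in>A. potential (?f x) ?B (insert v S) \<le> \<Phi>0"
  proof (rule ccontr)
    assume "\<not> ?thesis"
    then have "(\<Sum>x\<in>A. \<Phi>0) < (\<Sum>x\<in>A. potential (?f x) ?B (insert v S))"
      using A_pos finA by (intro sum_strict_mono) auto
    then show False using sum_le by simp
  qed
  then obtain x where x: "x \<in> A" "potential (?f x) ?B (insert v S) \<le> \<Phi>0" by blast
  have "partial_embedding (?f x) ?B (insert v S)"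
    unfolding partial_embedding_def
  proof (intro conjI ballI)
    show "inj_on (?f x) (insert v S)"
      using inj x(1) v by (auto simp: inj_on_def A_def)
    show "?f x u \<in> cls a (col u)" if "u \<in> insert v S" for u
      using that fcls x(1) v by (auto simp: A_def)
    show "{?f x u, ?f x w} \<in> E" if uw: "u \<in> insert v S" "w \<in> adj u \<inter> insert v S" for u w
    proof -
      have xE: "{f t, x} \<in> E" if "t \<in> adj v" "t \<in> S" for t
        using x(1) that by (auto simp: A_def F_def com_def)
      consider "u = v" "w \<in> S" "w \<in> adj v" | "w = v" "u \<in> S" "u \<in> adj v" | "u \<in> S" "w \<in> adj u \<inter> S" "u \<noteq> v" "w \<noteq> v"
        using uw v adj_irrefl adj_sym by blast
      then show ?thesis
      proof cases
        case 1
        then show ?thesis using xE[of w] v by (auto simp: insert_commute)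
      next
        case 2
        then show ?thesis using xE[of u] v by auto
      next
        case 3
        then show ?thesis using edge by simp
      qed
    qed
    show "?B u \<subseteq> adj u \<inter> insert v S" if "u \<in> insert v S" for u
      using that Bsub v by auto
    show "card (?B u) \<le> d" if "u \<in> insert v S" for u
      using that Bsub v deg by auto
  qed
  with x(2) show ?thesis by blast
qed

lemma embed_subset:
  assumes "S \<subseteq> R"
  shows "\<exists>f B. partial_embedding f B S \<and> potential f B S \<le> \<Phi>0"
  using assms
proof (induction "card S" arbitrary: S)
  case 0
  then have S: "S = {}" using finite_R finite_subset by fastforce
  have "potential f B {} \<le> \<Phi>0" for f B
  proof -
    have "cost f B {} F c = 1" for F c by (simp add: cost_def hist_def)
    then have 1: "(\<Sum>(F, c)\<in>index. cost f B {} F c) = card index" by (simp add: case_prod_unfold)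
    have "(\<Prod>w\<in>W0. chance f {} y w) = (1 - q ^ k0 / 2) ^ card W0" for y
      using card_adj_W0 by (simp add: chance_def)
    then have 2: "(\<Sum>y<n. (\<Prod>w\<in>W0. chance f {} y w) / (1 - q ^ k0 / 2) ^ card W0) = n"
      using denominator_pos less_imp_neq[OF denominator_pos] by auto
    have "card index \<le> (n + 1) ^ k * r"
      using card_small_subsets[of "{..<n}" k] by (simp add: index_def card_cartesian_product)
    then show ?thesis using 1 2 by (simp add: potential_def \<Phi>0_def mult.commute flip: of_nat_mult of_nat_power of_nat_Suc of_nat_add)
  qed
  then show ?case unfolding S by (auto simp: partial_embedding_def)
next
  case (Suc j)
  have "S \<noteq> {}" "finite S" using Suc.hyps(2) Suc.prems finite_R finite_subset by auto
  moreover have "S \<subseteq> V" using Suc.prems R_subset by blast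
  \<comment> \<open>The vertex split off by the induction is placed last, so at that time at most
    \<open>d\<close> of its neighbours are embedded.\<close>
  ultimately obtain v where v: "v \<in> S" "card (adj v \<inter> S) \<le> d" using degenerate_ex by meson
  have "j = card (S - {v})" using Suc.hyps(2) v \<open>finite S\<close> by simp
  then obtain f B where fB: "partial_embedding f B (S - {v})" "potential f B (S - {v}) \<le> \<Phi>0"
    using Suc.hyps(1)[of "S - {v}"] Suc.prems by auto
  have "card (adj v \<inter> (S - {v})) \<le> d"
    using v(2) \<open>finite S\<close> by (meson Diff_subset Int_mono card_mono finite_Int order_refl order_trans)
  from embed_one[OF _ _ _ this fB] Suc.prems v
  have "\<exists>f B. partial_embedding f B (insert v (S - {v})) \<and> potential f B (insert v (S - {v})) \<le> \<Phi>0"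
    by auto
  then show ?case using v(1) by (simp add: insert_absorb)
qed

text \<open>At the end each star at \<open>w\<close> that lies in \<open>N {y}\<close> leaves a
  factor 1/2 in the product and every other \<open>w\<close> a factor 1. The product is thus a power
  of 1/2 whose exponent is the wanted count; comparing with \<open>\<Phi>0\<close> and taking
  logarithms bounds it below.\<close>

lemma residue_embedding:
  "\<exists>f. inj_on f R \<and> f ` R \<subseteq> {..<r * a} \<and> (\<forall>u\<in>R. \<forall>v\<in>adj u \<inter> R. {f u, f v} \<in> E) \<and>
    (\<forall>y<n. card W0 * (p / 64) ^ k0 / 2 - ln (real (r * (n + 1) ^ k + n)) \<le> card {w\<in>W0. f ` adj w \<subseteq> N {y}})"
proof -
  obtain f B where emb: "partial_embedding f B R" and pot: "potential f B R \<le> \<Phi>0"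
    using embed_subset by blast
  have fcls: "\<And>v. v \<in> R \<Longrightarrow> f v \<in> cls a (col v)" using emb by (auto simp: partial_embedding_def)
  have "f ` R \<subseteq> {..<r * a}" using fcls cls_subset[OF col_less] by blast
  moreover have "card W0 * q ^ k0 / 2 - ln \<Phi>0 \<le> card {w\<in>W0. f ` adj w \<subseteq> N {y}}" if y: "y < n" for y
  proof -
    let ?s = "card {w\<in>W0. f ` adj w \<subseteq> N {y}}" and ?D = "(1 - q ^ k0 / 2) ^ card W0"
    have "chance f R y w = (if f ` adj w \<subseteq> N {y} then 1 / 2 else 1)" if "w \<in> W0" for w
    proof -
      have *: "adj w \<inter> R = adj w" "adj w - R = {}" using adj_W0[OF that] by auto
      show ?thesis unfolding chance_def * by simp
    qed
    then have "(\<Prod>w\<in>W0. chance f R y w) = (\<Prod>w\<in>W0. if f ` adj w \<subseteq> N {y} then 1 / 2 else 1)"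
      by (intro prod.cong) auto
    also have "\<dots> = (1 / 2) ^ ?s"
      using finite_W0 by (simp add: prod.If_cases Collect_conj_eq)
    finally have prod_eq: "(\<Prod>w\<in>W0. chance f R y w) = (1 / 2) ^ ?s" .
    have "(\<Prod>w\<in>W0. chance f R y w) / ?D \<le> (\<Sum>y<n. (\<Prod>w\<in>W0. chance f R y w) / ?D)"
      using y denominator_pos
      by (intro member_le_sum) (auto intro!: divide_nonneg_pos prod_nonneg chance_bounds)
    also have "\<dots> \<le> \<Phi>0" using pot potential_parts(1)[of f B R] by (simp add: potential_def)
    finally have "(1 / 2) ^ ?s / ?D \<le> \<Phi>0" unfolding prod_eq .
    then have le: "(1 / 2) ^ ?s \<le> \<Phi>0 * ?D" using denominator_pos by (simp add: field_simps)
    have Phi_pos: "0 < \<Phi>0" using y by (simp add: \<Phi>0_def add_nonneg_pos)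
    have pos1: "0 < 1 - q ^ k0 / 2" using q_bounds(3,4)[of k0] by auto
    have "ln ((1 / 2) ^ ?s) \<le> ln (\<Phi>0 * ?D)"
      using le by (subst ln_le_cancel_iff) (auto simp: Phi_pos denominator_pos)
    also have "\<dots> = ln \<Phi>0 + card W0 * ln (1 - q ^ k0 / 2)"
      using Phi_pos denominator_pos pos1 by (simp add: ln_mult ln_realpow)
    also have "card W0 * ln (1 - q ^ k0 / 2) \<le> card W0 * (- (q ^ k0 / 2))"
      using ln_le_minus_one[OF pos1] by (intro mult_left_mono) auto
    finally have "ln ((1 / 2) ^ ?s) \<le> ln \<Phi>0 - card W0 * q ^ k0 / 2" by simp
    moreover have "ln ((1 / 2 :: real) ^ ?s) = - (?s * ln 2)" by (simp add: ln_realpow ln_div)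
    moreover have "?s * ln 2 \<le> real ?s" using ln_2_less_1 by (simp add: mult_left_le)
    ultimately show ?thesis by linarith
  qed
  ultimately show ?thesis using emb unfolding partial_embedding_def q_def \<Phi>0_def by blast
qed

end

section \<open>Embedding the rest by matchings\<close>

definition common_lower :: "nat \<Rightarrow> nat set set \<Rightarrow> real \<Rightarrow> nat \<Rightarrow> nat \<Rightarrow> nat \<Rightarrow> bool" where
  "common_lower n E p k r a \<longleftrightarrow> (\<forall>F c. F \<subseteq> {..<n} \<longrightarrow> card F \<le> k \<longrightarrow> c < r \<longrightarrow>
     p ^ card F * a / 8 \<le> real (card (com n E F \<inter> cls a c)))"

definition common_upper :: "nat \<Rightarrow> nat set set \<Rightarrow> real \<Rightarrow> nat \<Rightarrow> nat \<Rightarrow> nat \<Rightarrow> bool" where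
  "common_upper n E p d r a \<longleftrightarrow> (\<forall>F c. F \<subseteq> {..<n} \<longrightarrow> card F \<le> d \<longrightarrow> c < r \<longrightarrow>
     real (card (com n E F \<inter> cls a c)) \<le> 4 * p ^ card F * a)"

text \<open>The division by \<open>p ^ card F\<close> makes every term comparable to
  \<open>card X\<close>. The lower bound on \<open>card X\<close> is the one that
  \<open>common_lower\<close> gives for a common neighbourhood of \<open>k\<close> vertices inside a
  block.\<close>

definition star_spread :: "nat \<Rightarrow> nat set set \<Rightarrow> real \<Rightarrow> nat \<Rightarrow> nat \<Rightarrow> nat \<Rightarrow> nat \<Rightarrow> nat \<Rightarrow> bool" where
  "star_spread n E p d k r a m \<longleftrightarrow> (\<forall>c X \<F>. c < r \<longrightarrow> X \<subseteq> cls a c \<longrightarrow> p ^ k * a / 8 \<le> real (card X) \<longrightarrow>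
     (\<forall>F\<in>\<F>. F \<subseteq> {..<n} - cls a c \<and> F \<noteq> {} \<and> card F \<le> d) \<longrightarrow> disjoint \<F> \<longrightarrow> card \<F> \<le> m \<longrightarrow>
     (\<Sum>F\<in>\<F>. real (card (com n E F \<inter> X)) / p ^ card F) \<le> 4 * m * card X)"

text \<open>The slack \<open>\<Lambda>\<close> makes one property serve two purposes: \<open>Z\<close> is smaller than \<open>\<F>\<close> in Hall's condition
  inside an interval, and \<open>Z\<close> is arbitrary once \<open>\<F>\<close> has linear size.\<close>

definition star_hall :: "nat \<Rightarrow> nat set set \<Rightarrow> nat \<Rightarrow> real \<Rightarrow> real \<Rightarrow> bool" where
  "star_hall n E d \<Lambda> \<mu> \<longleftrightarrow> (\<forall>l u Z \<F>. u \<le> n \<longrightarrow> Z \<subseteq> {l..<u} \<longrightarrow> \<F> \<noteq> {} \<longrightarrow> disjoint \<F> \<longrightarrow>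
     (\<forall>F\<in>\<F>. F \<subseteq> {..<n} \<and> card F \<le> 2 * d \<and> F \<inter> ({l..<u} - Z) = {}) \<longrightarrow>
     real (card Z) \<le> \<Lambda> * card \<F> \<longrightarrow> \<mu> \<le> real (card ({l..<u} - Z)) \<longrightarrow>
     (\<exists>F\<in>\<F>. com n E F \<inter> ({l..<u} - Z) \<noteq> {}))"

text \<open>With at most \<open>card T \<le> \<mu>\<close> disjoint sets the expected number of
  stars is at most \<open>\<mu> * p ^ j * card T\<close>; the property is meant for
  \<open>\<theta>\<close> larger than \<open>\<mu>\<close> by a constant factor.\<close>

definition star_sparse :: "nat \<Rightarrow> nat set set \<Rightarrow> real \<Rightarrow> nat \<Rightarrow> real \<Rightarrow> real \<Rightarrow> bool" where
  "star_sparse n E p d \<theta> \<mu> \<longleftrightarrow> (\<forall>j T \<F>. j \<le> 2 * d \<longrightarrow> T \<subseteq> {..<n} \<longrightarrow> T \<noteq> {} \<longrightarrow> real (card T) \<le> \<mu> \<longrightarrow>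
     disjoint \<F> \<longrightarrow> card \<F> \<le> card T \<longrightarrow>
     (\<forall>F\<in>\<F>. F \<subseteq> {..<n} \<and> card F = j \<and> F \<inter> T = {}) \<longrightarrow>
     (\<Sum>F\<in>\<F>. real (card (com n E F \<inter> T))) < \<theta> * p ^ j * card T)"

lemma disjoint_image_family:
  assumes "\<And>u v. u \<in> B \<Longrightarrow> v \<in> B \<Longrightarrow> u \<noteq> v \<Longrightarrow> F u \<inter> F v = {}"
  shows "disjoint (F ` B)" and "(\<And>v. v \<in> B \<Longrightarrow> F v \<noteq> {}) \<Longrightarrow> inj_on F B"
proof -
  show "disjoint (F ` B)" using assms unfolding disjoint_def by blast
  show "inj_on F B" if "\<And>v. v \<in> B \<Longrightarrow> F v \<noteq> {}"
  proof (rule inj_onI, rule ccontr)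
    fix u v assume "u \<in> B" "v \<in> B" "F u = F v" "u \<noteq> v"
    then show False using assms[of u v] that[of u] by simp
  qed
qed

text \<open>Indices with an empty set are treated apart: several of them would give one member of
  the family only. Such an index has the whole host as common neighbourhood.\<close>

lemma star_hall_indexed:
  fixes F :: "'b \<Rightarrow> nat set" and \<Lambda> \<mu> :: real
  assumes hall: "star_hall n E d \<Lambda> \<mu>" and mu: "0 < \<mu>"
    and u: "u \<le> n" and Z: "Z \<subseteq> {l..<u}" "card Z \<le> \<Lambda> * card B" "\<mu> \<le> card ({l..<u} - Z)"
    and B: "B \<noteq> {}"
    and F: "\<And>v. v \<in> B \<Longrightarrow> F v \<subseteq> {..<n} \<and> card (F v) \<le> 2 * d \<and> F v \<inter> ({l..<u} - Z) = {}"
    and disj: "\<And>u v. u \<in> B \<Longrightarrow> v \<in> B \<Longrightarrow> u \<noteq> v \<Longrightarrow> F u \<inter> F v = {}"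
  shows "\<exists>v\<in>B. com n E (F v) \<inter> ({l..<u} - Z) \<noteq> {}"
proof (cases "\<exists>v\<in>B. F v = {}")
  case True
  then obtain v where v: "v \<in> B" "F v = {}" by blast
  have "{l..<u} - Z \<noteq> {}" using Z(3) mu by (metis card.empty not_le of_nat_0)
  moreover have "{l..<u} - Z \<subseteq> {..<n}" using u by auto
  ultimately have "com n E (F v) \<inter> ({l..<u} - Z) \<noteq> {}" unfolding v(2) com_empty by blast
  then show ?thesis using v(1) by blast
next
  case False
  have "inj_on F B" by (rule disjoint_image_family(2)) (use disj False in auto)
  then have card: "card (F ` B) = card B" by (rule card_image)
  have dis: "disjoint (F ` B)" by (rule disjoint_image_family(1)) (use disj in auto)
  have "\<exists>G\<in>F ` B. com n E G \<inter> ({l..<u} - Z) \<noteq> {}"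
  proof (rule hall[unfolded star_hall_def, rule_format, OF u Z(1) _ dis _ _ Z(3)])
    show "F ` B \<noteq> {}" using B by simp
    show "real (card Z) \<le> \<Lambda> * card (F ` B)" using Z(2) card by simp
    show "G \<subseteq> {..<n} \<and> card G \<le> 2 * d \<and> G \<inter> ({l..<u} - Z) = {}" if "G \<in> F ` B" for G
      using that F by (elim imageE) simp
  qed
  then show ?thesis by blast
qed

section \<open>Batches, peeling and the last matching\<close>

context degenerate_graph
begin

definition embeds :: "nat set set \<Rightarrow> ('a \<Rightarrow> nat) \<Rightarrow> 'a set \<Rightarrow> bool" where
  "embeds E f M \<longleftrightarrow> inj_on f M \<and> (\<forall>u\<in>M. \<forall>v\<in>adj u \<inter> M. {f u, f v} \<in> E)"

text \<open>Hall's theorem picks images among the common neighbours of the embedded neighbours;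
  \<open>indep2 B\<close> leaves no edge inside \<open>B\<close> to be realised.\<close>

lemma extend_by_matching:
  assumes f: "embeds E f M" and B: "B \<inter> M = {}" "finite B" "indep2 B"
    and Y: "Y \<inter> f ` M = {}"
    and hall: "\<And>B'. B' \<subseteq> B \<Longrightarrow> card B' \<le> card (\<Union>v\<in>B'. com n E (f ` (adj v \<inter> M)) \<inter> Y)"
  shows "\<exists>g. embeds E g (M \<union> B) \<and> (\<forall>v\<in>M. g v = f v) \<and> g ` B \<subseteq> Y"
proof -
  obtain h where h: "inj_on h B" "\<forall>v\<in>B. h v \<in> com n E (f ` (adj v \<inter> M)) \<inter> Y"
    using hall_marriage[of B "\<lambda>v. com n E (f ` (adj v \<inter> M)) \<inter> Y", OF B(2) _ hall] by auto
  define g where "g v = (if v \<in> M then f v else h v)" for v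
  have gM: "g v = f v" if "v \<in> M" for v using that by (simp add: g_def)
  have gB: "g v = h v" if "v \<in> B" for v using that B(1) by (auto simp: g_def)
  have edge: "{f u, h v} \<in> E" if "v \<in> B" "u \<in> adj v" "u \<in> M" for u v
    using h(2) that by (auto simp: com_def)
  have "inj_on g (M \<union> B)"
  proof (rule inj_onI)
    fix u v assume uv: "u \<in> M \<union> B" "v \<in> M \<union> B" "g u = g v"
    have *: "f s \<noteq> h t" if "s \<in> M" "t \<in> B" for s t
    proof -
      have "h t \<in> Y" "f s \<in> f ` M" using h(2) that by auto
      then show ?thesis using Y by (metis disjoint_iff)
    qed
    show "u = v"
    proof (cases "u \<in> M"; cases "v \<in> M")
      assume "u \<in> M" "v \<in> M"
      then show ?thesis using uv f gM by (auto simp: embeds_def inj_on_def)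
    next
      assume "u \<in> M" "v \<notin> M"
      then show ?thesis using uv gM gB * by auto
    next
      assume "u \<notin> M" "v \<in> M"
      then show ?thesis using uv gM gB * by (metis Un_iff)
    next
      assume "u \<notin> M" "v \<notin> M"
      then show ?thesis using uv gB h(1) by (auto simp: inj_on_def)
    qed
  qed
  moreover have "{g u, g v} \<in> E" if u: "u \<in> M \<union> B" and v: "v \<in> adj u \<inter> (M \<union> B)" for u v
  proof -
    have uv: "v \<in> adj u" "u \<in> adj v" using v adj_sym by auto
    consider "u \<in> M" "v \<in> M" | "u \<in> M" "v \<in> B" | "u \<in> B" "v \<in> M" | "u \<in> B" "v \<in> B"
      using u v by blast
    then show ?thesis
    proof cases
      case 1
      then show ?thesis using f uv gM by (auto simp: embeds_def)
    next
      case 2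
      then show ?thesis using edge[of v u] uv gM gB by simp
    next
      case 3
      then show ?thesis using edge[of u v] uv gM gB by (simp add: insert_commute)
    next
      case 4
      moreover have "u \<noteq> v" using uv adj_irrefl by blast
      ultimately show ?thesis using indep2D(1)[OF B(3), of u v] uv by blast
    qed
  qed
  moreover have "g ` B \<subseteq> Y" using gB h(2) by auto
  ultimately show ?thesis using gM unfolding embeds_def by blast
qed

lemma disjoint_neighbour_images:
  assumes f: "inj_on f M" and B: "indep2 B" and uv: "u \<in> B" "v \<in> B" "u \<noteq> v"
  shows "f ` (adj u \<inter> M) \<inter> f ` (adj v \<inter> M) = {}"
proof -
  have "f ` (adj u \<inter> M) \<inter> f ` (adj v \<inter> M) = f ` ((adj u \<inter> M) \<inter> (adj v \<inter> M))"
    using f by (subst inj_on_image_Int) auto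
  also have "(adj u \<inter> M) \<inter> (adj v \<inter> M) = {}" using indep2D(2)[OF B uv] by blast
  finally show ?thesis by simp
qed

text \<open>The batch goes into a fresh interval with \<open>h\<close> surplus vertices. A violation
  of Hall's condition covers fewer than \<open>card B\<close> of its \<open>card B + h\<close>
  vertices, so at least \<open>\<mu>\<close> vertices receive no star from \<open>B'\<close>,
  against \<open>star_hall\<close>.\<close>

lemma extend_batch:
  assumes hall: "star_hall n E d \<Lambda> \<mu>" and mu: "0 < \<mu>" "\<mu> \<le> real h" and Lam: "1 \<le> \<Lambda>"
    and f: "embeds E f M" and M: "M \<subseteq> V" "f ` M \<subseteq> {..<b}"
    and B: "B \<subseteq> V" "B \<inter> M = {}" "indep2 B" "\<And>v. v \<in> B \<Longrightarrow> card (adj v \<inter> M) \<le> 2 * d"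
    and n: "b + card B + h \<le> n"
  shows "\<exists>g. embeds E g (M \<union> B) \<and> (\<forall>v\<in>M. g v = f v) \<and> g ` (M \<union> B) \<subseteq> {..<b + card B + h}"
proof -
  define Y where "Y = {b..<b + card B + h}"
  define F where "F v = f ` (adj v \<inter> M)" for v
  have finB: "finite B" using B(1) finite_V finite_subset by blast
  have inj: "inj_on f M" using f by (simp add: embeds_def)
  have "\<exists>g. embeds E g (M \<union> B) \<and> (\<forall>v\<in>M. g v = f v) \<and> g ` B \<subseteq> Y"
  proof (rule extend_by_matching[OF f B(2) finB B(3)])
    show "Y \<inter> f ` M = {}" using M(2) by (auto simp: Y_def)
    fix B' assume B': "B' \<subseteq> B"
    define Z where "Z = (\<Union>v\<in>B'. com n E (F v) \<inter> Y)"
    show "card B' \<le> card (\<Union>v\<in>B'. com n E (f ` (adj v \<inter> M)) \<inter> Y)"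
    proof (rule ccontr)
      assume "\<not> ?thesis"
      then have less: "card Z < card B'" by (simp add: Z_def F_def)
      have Z: "Z \<subseteq> Y" by (auto simp: Z_def)
      have cardB': "card B' \<le> card B" using B' finB by (rule card_mono[rotated])
      have "card (Y - Z) = card B + h - card Z"
        using Z by (subst card_Diff_subset) (auto simp: Y_def intro: finite_subset)
      then have big: "\<mu> \<le> card (Y - Z)" using less cardB' mu(2) by linarith
      have "card Z \<le> \<Lambda> * card B'"
      proof -
        have "real (card Z) \<le> 1 * real (card B')" using less by simp
        also have "\<dots> \<le> \<Lambda> * card B'" using Lam by (intro mult_right_mono) auto
        finally show ?thesis .
      qed
      moreover have "B' \<noteq> {}" using less by auto
      moreover have "F v \<subseteq> {..<n} \<and> card (F v) \<le> 2 * d \<and> F v \<inter> (Y - Z) = {}" if "v \<in> B'" for v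
      proof (intro conjI)
        have sub: "F v \<subseteq> {..<b}" using M(2) by (auto simp: F_def)
        show "F v \<subseteq> {..<n}" using sub n by fastforce
        show "F v \<inter> (Y - Z) = {}" using sub by (auto simp: Y_def)
        have "finite (adj v \<inter> M)" using M(1) finite_V finite_subset by blast
        then show "card (F v) \<le> 2 * d"
          using card_image_le[of "adj v \<inter> M" f] B(4)[of v] that B' unfolding F_def by fastforce
      qed
      moreover have "F u \<inter> F v = {}" if "u \<in> B'" "v \<in> B'" "u \<noteq> v" for u v
        unfolding F_def by (rule disjoint_neighbour_images[OF inj B(3)]) (use that B' in auto)
      ultimately have "\<exists>v\<in>B'. com n E (F v) \<inter> (Y - Z) \<noteq> {}"
        using Z big unfolding Y_def by (intro star_hall_indexed[OF hall mu(1) n]) auto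
      then show False by (auto simp: Z_def)
    qed
  qed
  then obtain g where g: "embeds E g (M \<union> B)" "\<forall>v\<in>M. g v = f v" "g ` B \<subseteq> Y" by blast
  have "g v < b + card B + h" if "v \<in> M \<union> B" for v
  proof (cases "v \<in> M")
    case True
    then have "g v < b" using g(2) M(2) by auto
    then show ?thesis by simp
  next
    case False
    then show ?thesis using that g(3) by (auto simp: Y_def)
  qed
  with g show ?thesis by blast
qed

text \<open>At least \<open>card M / (2 * d + 1)\<close> vertices have low degree, and
  \<open>R0\<close>, which must stay in the core, takes away at most half of them.\<close>

lemma peel_batch:
  assumes M: "M \<subseteq> V" and R0: "finite R0" "2 * (2 * d + 1) * card R0 < card M"
  shows "\<exists>B\<subseteq>M - R0. indep2 B \<and> (\<forall>v\<in>B. card (adj v \<inter> M) \<le> 2 * d) \<and>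
    card M \<le> 2 * (2 * d + 1) * colours \<Delta> * card B"
proof -
  define L where "L = {v\<in>M. card (adj v \<inter> M) \<le> 2 * d}"
  have "L - R0 \<subseteq> V" using M by (auto simp: L_def)
  then obtain B where B: "B \<subseteq> L - R0" "indep2 B" "card (L - R0) \<le> colours \<Delta> * card B"
    using large_indep2 by blast
  have 1: "card M \<le> (2 * d + 1) * card L" unfolding L_def using M by (rule many_low_degree)
  have "card L \<le> card (L - R0) + card R0"
    using diff_card_le_card_Diff[OF R0(1), of L] by simp
  from mult_le_mono2[OF this, of "2 * d + 1"] 1
  have "card M \<le> (2 * d + 1) * card (L - R0) + (2 * d + 1) * card R0"
    unfolding distrib_left by linarith
  then have "card M \<le> 2 * (2 * d + 1) * card (L - R0)" using R0(2) by linarith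
  also have "\<dots> \<le> 2 * (2 * d + 1) * (colours \<Delta> * card B)" using B(3) by (rule mult_le_mono2)
  finally have "card M \<le> 2 * (2 * d + 1) * colours \<Delta> * card B" by (simp only: mult.assoc)
  moreover have "B \<subseteq> M - R0" using B(1) by (auto simp: L_def)
  moreover have "\<forall>v\<in>B. card (adj v \<inter> M) \<le> 2 * d" using B(1) by (auto simp: L_def)
  ultimately show ?thesis using B(2) by (intro exI[of _ B] conjI)
qed

definition peel_factor :: nat where
  "peel_factor = 2 * (2 * d + 1) * colours \<Delta>"

text \<open>The proportion of the current set that one batch is sure to remove.\<close>

definition peel_rate :: real where
  "peel_rate = 1 / peel_factor"

lemma peel_rate_bounds: "0 < peel_rate" "peel_rate \<le> 1"
proof -
  have "1 \<le> peel_factor" by (simp add: peel_factor_def)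
  then show "0 < peel_rate" "peel_rate \<le> 1" by (simp_all add: peel_rate_def)
qed

text \<open>Quantified over all embeddings of \<open>R\<close>, since the core is embedded only
  after peeling has determined it. \<open>t\<close> sums up the surplus of the intervals used by the
  batches.\<close>

definition extends_to :: "nat \<Rightarrow> nat set set \<Rightarrow> 'a set \<Rightarrow> 'a set \<Rightarrow> nat \<Rightarrow> bool" where
  "extends_to n E R M t \<longleftrightarrow> (\<forall>f b. embeds E f R \<longrightarrow> f ` R \<subseteq> {..<b} \<longrightarrow> b + (card M - card R) + t \<le> n \<longrightarrow>
     (\<exists>g. embeds E g M \<and> (\<forall>v\<in>R. g v = f v) \<and> g ` M \<subseteq> {..<b + (card M - card R) + t}))"

lemma extends_toD:
  assumes "extends_to n E R M t" "embeds E f R" "f ` R \<subseteq> {..<b}" "b + (card M - card R) + t \<le> n"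
  shows "\<exists>g. embeds E g M \<and> (\<forall>v\<in>R. g v = f v) \<and> g ` M \<subseteq> {..<b + (card M - card R) + t}"
  using assms(1)[unfolded extends_to_def, rule_format, OF assms(2-4)] .

text \<open>The batch removed first is re-inserted last, so the induction hypothesis is applied to
  \<open>M - B\<close>. Once \<open>card M \<le> m\<close> the protected set \<open>R0\<close> might
  contain all low-degree vertices; peeling then stops, hence the maximum in the bound.\<close>

lemma peel:
  assumes hall: "star_hall n E d \<Lambda> \<mu>" and mu: "0 < \<mu>" "\<mu> \<le> real h" and Lam: "1 \<le> \<Lambda>"
    and R0: "finite R0" "2 * (2 * d + 1) * card R0 \<le> m"
    and "R0 \<subseteq> M" "M \<subseteq> V"
  shows "\<exists>R. R0 \<subseteq> R \<and> R \<subseteq> M \<and> real (card R) \<le> max m ((1 - peel_rate) ^ K * card M) \<and> extends_to n E R M (K * h)"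
  using assms(7,8)
proof (induction K arbitrary: M)
  case 0
  have "extends_to n E M M 0" by (auto simp: extends_to_def)
  then show ?case using 0 by (intro exI[of _ M] conjI) simp_all
next
  case (Suc K)
  have finM: "finite M" using Suc.prems(2) finite_V finite_subset by blast
  show ?case
  proof (cases "card M \<le> m")
    case True
    have "extends_to n E M M (Suc K * h)"
      unfolding extends_to_def by (intro allI impI, rule_tac x = f in exI) auto
    then show ?thesis using True Suc.prems by (intro exI[of _ M]) auto
  next
    case False
    then obtain B where B: "B \<subseteq> M - R0" "indep2 B" "\<forall>v\<in>B. card (adj v \<inter> M) \<le> 2 * d"
      "card M \<le> 2 * (2 * d + 1) * colours \<Delta> * card B"
      using peel_batch[OF Suc.prems(2) R0(1)] R0(2) by force
    define M' where "M' = M - B"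
    have M': "R0 \<subseteq> M'" "M' \<subseteq> V" "M = M' \<union> B" "B \<inter> M' = {}" "B \<subseteq> V"
      using B(1) Suc.prems by (auto simp: M'_def)
    have finM': "finite M'" using finM by (simp add: M'_def)
    have card_M: "card M = card M' + card B"
      using M'(3,4) finM by (metis Int_commute card_Un_disjoint finite_Un)
    have "real (card M) \<le> real (peel_factor * card B)"
      using B(4) by (simp only: of_nat_le_iff peel_factor_def)
    also have "\<dots> = card B / peel_rate" by (simp add: peel_rate_def)
    finally have "peel_rate * card M \<le> card B" using peel_rate_bounds by (simp add: field_simps)
    then have card_M': "card M' \<le> (1 - peel_rate) * card M" using card_M by (simp add: algebra_simps)
    obtain R where R: "R0 \<subseteq> R" "R \<subseteq> M'" "real (card R) \<le> max m ((1 - peel_rate) ^ K * card M')"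
      "extends_to n E R M' (K * h)"
      using Suc.IH[OF M'(1,2)] by blast
    have "(1 - peel_rate) ^ K * card M' \<le> (1 - peel_rate) ^ K * ((1 - peel_rate) * card M)"
      using card_M' peel_rate_bounds by (intro mult_left_mono) auto
    then have bound: "real (card R) \<le> max m ((1 - peel_rate) ^ Suc K * card M)"
      using R(3) by (auto simp: mult_ac)
    have card_R: "card R \<le> card M'" using R(2) finM' by (rule card_mono[rotated])
    have "extends_to n E R M (Suc K * h)"
      unfolding extends_to_def
    proof (intro allI impI)
      fix f b assume f: "embeds E f R" "f ` R \<subseteq> {..<b}" "b + (card M - card R) + Suc K * h \<le> n"
      define b' where "b' = b + (card M' - card R) + K * h"
      have b': "b' + card B + h = b + (card M - card R) + Suc K * h"
        using card_M card_R by (simp add: b'_def)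
      have le: "b + (card M' - card R) + K * h \<le> n" using b' f(3) unfolding b'_def by linarith
      obtain g where g: "embeds E g M'" "\<forall>v\<in>R. g v = f v" "g ` M' \<subseteq> {..<b'}"
        using extends_toD[OF R(4) f(1,2) le, folded b'_def] by (elim exE conjE) (rule that; assumption)
      have "\<exists>g'. embeds E g' (M' \<union> B) \<and> (\<forall>v\<in>M'. g' v = g v) \<and> g' ` (M' \<union> B) \<subseteq> {..<b' + card B + h}"
      proof (rule extend_batch[OF hall mu Lam g(1) M'(2) g(3) M'(5,4) B(2)])
        fix v assume v: "v \<in> B"
        have "card (adj v \<inter> M') \<le> card (adj v \<inter> M)" using finM M'(3) by (intro card_mono) auto
        then show "card (adj v \<inter> M') \<le> 2 * d" using B(3) v by fastforce
      qed (use b' f(3) in linarith)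
      then show "\<exists>g. embeds E g M \<and> (\<forall>v\<in>R. g v = f v) \<and> g ` M \<subseteq> {..<b + (card M - card R) + Suc K * h}"
        unfolding b' M'(3)[symmetric] using g(2) R(2) by (metis subsetD)
    qed
    moreover have "R \<subseteq> M" using R(2) by (auto simp: M'_def)
    ultimately show ?thesis using R(1) bound by blast
  qed
qed

text \<open>\<open>W\<close> is left out for a later perfect matching. The neighbours of
  \<open>W0\<close> are put into the protected set \<open>R0'\<close>, so their images are fixed
  together with the core and the star count from \<open>residue_embedding\<close> survives the
  re-insertion of the batches.\<close>

lemma almost_embedding:
  fixes E :: "nat set set" and p :: real
  defines "r \<equiv> colours \<Delta>"
  assumes p: "0 < p" "p \<le> 1" and m: "640 * m \<le> a" and a: "0 < a" and dk: "d \<le> k"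
    and lower: "common_lower n E p k r a" and upper: "common_upper n E p d r a"
    and spread: "star_spread n E p d k r a m"
    and hall: "star_hall n E d \<Lambda> \<mu>" and mu: "0 < \<mu>" "\<mu> \<le> real h" and Lam: "1 \<le> \<Lambda>"
    and big: "32 * ln (real (r * (n + 1) ^ k + n)) \<le> p ^ k * a"
    and W: "W \<subseteq> V" "indep2 W" and W0: "W0 \<subseteq> W" "\<And>w. w \<in> W0 \<Longrightarrow> card (adj w) = k0"
    and W0_k: "W0 \<noteq> {} \<Longrightarrow> k = Suc d"
    and R0: "2 * (2 * d + 1) * (k0 * card W0) \<le> m"
    and K: "(1 - peel_rate) ^ K * card V \<le> m"
    and n: "r * a + card (V - W) + K * h \<le> n"
  shows "\<exists>g. embeds E g (V - W) \<and> g ` (V - W) \<subseteq> {..<r * a + card (V - W) + K * h} \<and>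
    (\<forall>y<n. card W0 * (p / 64) ^ k0 / 2 - ln (real (r * (n + 1) ^ k + n)) \<le> card {w\<in>W0. g ` adj w \<subseteq> com n E {y}})"
proof -
  define R0' where "R0' = \<Union>(adj ` W0)"
  have W0V: "W0 \<subseteq> V" using W0 W by blast
  have finW0: "finite W0" using W0V finite_V finite_subset by blast
  have R0V: "R0' \<subseteq> V - W"
  proof
    fix u assume "u \<in> R0'"
    then obtain w where w: "w \<in> W0" "u \<in> adj w" by (auto simp: R0'_def)
    have "u \<noteq> w" using w adj_irrefl by blast
    then have "u \<notin> W" using indep2D(1)[OF W(2), of w u] w W0(1) by blast
    then show "u \<in> V - W" using w W0V adj_subset by blast
  qed
  have finR0: "finite R0'" using R0V finite_V finite_subset by blast
  have "card R0' \<le> (\<Sum>w\<in>W0. card (adj w))" unfolding R0'_def using finW0 by (rule card_UN_le)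
  also have "\<dots> = k0 * card W0" using W0(2) by simp
  finally have "2 * (2 * d + 1) * card R0' \<le> 2 * (2 * d + 1) * (k0 * card W0)" by (rule mult_le_mono2)
  then have "2 * (2 * d + 1) * card R0' \<le> m" using R0 by linarith
  from peel[OF hall mu Lam finR0 this R0V Diff_subset, of K]
  obtain R where R: "R0' \<subseteq> R" "R \<subseteq> V - W" "real (card R) \<le> max m ((1 - peel_rate) ^ K * card (V - W))"
    and ext: "extends_to n E R (V - W) (K * h)"
    by blast
  have RV: "R \<subseteq> V" using R(2) by blast
  have "0 \<le> 1 - peel_rate" using peel_rate_bounds by simp
  moreover have "card (V - W) \<le> card V" using finite_V by (intro card_mono) auto
  ultimately have "(1 - peel_rate) ^ K * card (V - W) \<le> (1 - peel_rate) ^ K * card V"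
    by (intro mult_left_mono zero_le_power) auto
  then have cardR: "card R \<le> m" using R(3) K by auto
  obtain col where col: "\<forall>v\<in>V. col v < r" "\<forall>c::nat. indep2 {v\<in>V. col v = c}"
    using square_coloring unfolding r_def by blast
  interpret greedy_embedding V adj d \<Delta> n a r k k0 m E p col R W0
  proof unfold_locales
    show "indep2 {v \<in> R. col v = c}" for c
      by (rule indep2_subset[OF col(2)[rule_format, of c]]) (use RV in auto)
    show "indep2 W0" using W(2) W0(1) by (rule indep2_subset)
    show "adj w \<subseteq> R" if "w \<in> W0" for w using R(1) that by (auto simp: R0'_def)
    show "r * a \<le> n" using n by linarith
    show "col v < r" if "v \<in> R" for v using col(1) RV that by blast
    show "p ^ card F * a / 8 \<le> card (com n E F \<inter> cls a c)"
      if "F \<subseteq> {..<n}" "card F \<le> k" "c < r" for F c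
      using lower that unfolding common_lower_def by blast
    show "card (com n E F \<inter> cls a c) \<le> 4 * p ^ card F * a"
      if "F \<subseteq> {..<n}" "card F \<le> d" "c < r" for F c
      using upper that unfolding common_upper_def by blast
    show "(\<Sum>F\<in>\<F>. card (com n E F \<inter> X) / p ^ card F) \<le> 4 * m * card X"
      if "c < r" "X \<subseteq> cls a c" "p ^ k * a / 8 \<le> card X"
        "\<And>F. F \<in> \<F> \<Longrightarrow> F \<subseteq> {..<n} - cls a c \<and> F \<noteq> {} \<and> card F \<le> d"
        "disjoint \<F>" "card \<F> \<le> m" for c X \<F>
      using spread[unfolded star_spread_def, rule_format, OF that] by simp
    show "card (adj w) = k0" if "w \<in> W0" for w using W0(2) that .
    show "k = Suc d" if "W0 \<noteq> {}" using W0_k that .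
  qed (fact p m a dk W0V RV cardR big)+
  obtain f where f: "inj_on f R" "f ` R \<subseteq> {..<r * a}" "\<forall>u\<in>R. \<forall>v\<in>adj u \<inter> R. {f u, f v} \<in> E"
    "\<forall>y<n. card W0 * (p / 64) ^ k0 / 2 - ln (real (r * (n + 1) ^ k + n)) \<le> card {w\<in>W0. f ` adj w \<subseteq> com n E {y}}"
    using residue_embedding by blast
  have f_emb: "embeds E f R" using f by (simp add: embeds_def)
  have "r * a + (card (V - W) - card R) + K * h \<le> n" using n by linarith
  from extends_toD[OF ext f_emb f(2) this] obtain g where
    g: "embeds E g (V - W)" "\<forall>v\<in>R. g v = f v"
      "g ` (V - W) \<subseteq> {..<r * a + (card (V - W) - card R) + K * h}"
    by (elim exE conjE) (rule that; assumption)
  have "g ` adj w = f ` adj w" if "w \<in> W0" for w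
    using adj_W0[OF that] g(2) by (intro image_cong) auto
  then have "{w\<in>W0. g ` adj w \<subseteq> com n E {y}} = {w\<in>W0. f ` adj w \<subseteq> com n E {y}}" for y
    by auto
  moreover have "g ` (V - W) \<subseteq> {..<r * a + card (V - W) + K * h}" using g(3) by fastforce
  ultimately show ?thesis using g(1) f(4) by (intro exI[of _ g]) simp
qed

text \<open>In the last matching no slack is left. Hall's condition for a set \<open>B\<close> that misses the set \<open>T\<close> of
  unused vertices follows from \<open>star_hall\<close> if \<open>B\<close> is small or \<open>T\<close> is large. Otherwise the vertices of
  \<open>T\<close> each see many neighbourhoods of vertices of \<open>W0\<close>, all of them outside \<open>B\<close>, and \<open>star_sparse\<close>
  forbids so many stars between \<open>T\<close> and fewer than \<open>card T\<close> disjoint sets.\<close>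

lemma spanning_step:
  assumes hall: "star_hall n E d \<Lambda> \<mu>" and mu: "0 < \<mu>" and sparse: "star_sparse n E p d \<theta> \<mu>"
    and W: "W \<subseteq> V" "indep2 W" "\<And>w. w \<in> W \<Longrightarrow> card (adj w) = k0" and k0: "k0 \<le> 2 * d"
    and W0: "W0 \<subseteq> W" and n: "card V = n" and b: "b \<le> n"
    and g: "embeds E g (V - W)" "g ` (V - W) \<subseteq> {..<b}"
    and near: "\<And>y. y < n \<Longrightarrow> \<theta> * p ^ k0 \<le> card {w\<in>W0. g ` adj w \<subseteq> com n E {y}}"
    and Lam: "1 \<le> \<Lambda>" "real n \<le> \<Lambda> * (real (n - b) - \<mu>)"
  shows "\<exists>f. embeds E f V \<and> f ` V \<subseteq> {..<n}"
proof -
  define F where "F v = g ` adj v" for v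
  define Y where "Y = {..<n} - g ` (V - W)"
  have finW: "finite W" using W(1) finite_V finite_subset by blast
  have inj: "inj_on g (V - W)" using g(1) by (simp add: embeds_def)
  have sub: "g ` (V - W) \<subseteq> {..<n}" using g(2) b by fastforce
  have cardY: "card Y = card W"
  proof -
    have "card Y = n - card (V - W)"
      using sub finite_V unfolding Y_def by (simp add: card_Diff_subset card_image[OF inj])
    also have "\<dots> = card W"
      using n W(1) card_mono[OF finite_V W(1)] finW by (simp add: card_Diff_subset)
    finally show ?thesis .
  qed
  have adjW: "adj v \<inter> (V - W) = adj v" if "v \<in> W" for v
  proof -
    have "u \<notin> W" if "u \<in> adj v" for u
      using indep2D(1)[OF W(2), of v u] that \<open>v \<in> W\<close> adj_irrefl by blast
    then show ?thesis using adj_subset that W(1) by blast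
  qed
  have F: "F v \<subseteq> {..<b}" "card (F v) = k0" if "v \<in> W" for v
  proof -
    have sub': "adj v \<subseteq> V - W" using adjW[OF that] by blast
    then show "F v \<subseteq> {..<b}" using g(2) by (auto simp: F_def)
    have "card (F v) = card (adj v)" unfolding F_def using inj_on_subset[OF inj sub'] by (rule card_image)
    then show "card (F v) = k0" using W(3)[OF that] by simp
  qed
  have F_Y: "F v \<inter> Y = {}" if "v \<in> W" for v
    using adjW[OF that] by (auto simp: F_def Y_def)
  have F_disj: "F u \<inter> F v = {}" if "u \<in> W" "v \<in> W" "u \<noteq> v" for u v
    using disjoint_neighbour_images[OF inj W(2) that] adjW that by (simp add: F_def)
  have "\<exists>f. embeds E f ((V - W) \<union> W) \<and> (\<forall>v\<in>V - W. f v = g v) \<and> f ` W \<subseteq> Y"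
  proof (rule extend_by_matching[where n = n and Y = Y, OF g(1) _ finW W(2)])
    fix B assume B: "B \<subseteq> W"
    define Z where "Z = (\<Union>v\<in>B. com n E (F v) \<inter> Y)"
    have Z_eq: "(\<Union>v\<in>B. com n E (g ` (adj v \<inter> (V - W))) \<inter> Y) = Z"
      unfolding Z_def F_def using B adjW by (intro SUP_cong) auto
    have finB: "finite B" using B finW finite_subset by blast
    have cardB: "card B \<le> card W" using B finW by (rule card_mono[rotated])
    have ZY: "Z \<subseteq> Y" "finite Y" by (auto simp: Z_def Y_def)
    have "card B \<le> card Z"
    proof (rule ccontr)
      assume "\<not> ?thesis"
      then have less: "card Z < card B" by (rule not_le_imp_less)
      then have Bne: "B \<noteq> {}" by auto
      define T where "T = Y - Z"
      have cardT: "card T = card W - card Z"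
        using ZY cardY by (simp add: T_def card_Diff_subset finite_subset)
      have T: "T \<subseteq> {..<n}" by (auto simp: T_def Y_def)
      have no_star: "com n E (F v) \<inter> T = {}" if "v \<in> B" for v
        using that by (auto simp: Z_def T_def)
      have F_T: "F v \<subseteq> {..<n} \<and> card (F v) \<le> 2 * d \<and> F v \<inter> T = {}" if "v \<in> B" for v
        using F[of v] F_Y[of v] that B b k0 unfolding T_def by fastforce
      have F_disjB: "F u \<inter> F v = {}" if "u \<in> B" "v \<in> B" "u \<noteq> v" for u v
        using F_disj that B by blast
      consider "card B \<le> real (n - b) - \<mu>" | "real (n - b) - \<mu> < card B" "\<mu> \<le> card T" | "card T < \<mu>"
        by linarith
      then show False
      proof cases
        case 1
        \<comment> \<open>The interval \<open>{b..<n}\<close> is still untouched. \<open>Z\<close>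
          covers fewer than \<open>card B\<close> of its vertices, which leaves at least
          \<open>\<mu>\<close> of them.\<close>
        define Z' where "Z' = Z \<inter> {b..<n}"
        have sub1: "{b..<n} - Z' \<subseteq> T" using g(2) by (auto simp: Z'_def T_def Y_def)
        have Z': "card Z' \<le> card Z" "Z' \<subseteq> {b..<n}" "finite Z'"
          using ZY finite_subset by (auto simp: Z'_def intro!: card_mono)
        have "real (card Z') \<le> 1 * real (card B)" using Z'(1) less by simp
        also have "\<dots> \<le> \<Lambda> * card B" using Lam(1) by (intro mult_right_mono) auto
        finally have c1: "card Z' \<le> \<Lambda> * card B" .
        have "card ({b..<n} - Z') = (n - b) - card Z'" using Z' by (simp add: card_Diff_subset)
        then have c2: "\<mu> \<le> card ({b..<n} - Z')" using 1 Z'(1) less by linarith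
        have "\<exists>v\<in>B. com n E (F v) \<inter> ({b..<n} - Z') \<noteq> {}"
          using F_T F_disjB sub1 by (intro star_hall_indexed[OF hall mu order_refl Z'(2) c1 c2 Bne]) blast+
        then show False using no_star sub1 by blast
      next
        case 2
        \<comment> \<open>Here \<open>card B\<close> is linear in \<open>n\<close>, so the slack
          allows the whole complement of \<open>T\<close> as exceptional set:
          \<open>n \<le> \<Lambda> * card B\<close>.\<close>
        define Z' where "Z' = {0..<n} - T"
        have eq: "{0..<n} - Z' = T" using T by (auto simp: Z'_def)
        have "card Z' \<le> card {0..<n}" unfolding Z'_def by (intro card_mono) auto
        then have "real (card Z') \<le> real n" by simp
        also have "\<dots> \<le> \<Lambda> * (real (n - b) - \<mu>)" by (rule Lam(2))
        also have "\<dots> \<le> \<Lambda> * card B" using 2 Lam(1) by (intro mult_left_mono) auto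
        finally have c1: "card Z' \<le> \<Lambda> * card B" .
        have "\<exists>v\<in>B. com n E (F v) \<inter> ({0..<n} - Z') \<noteq> {}"
          using F_T F_disjB 2 Bne c1 unfolding eq[symmetric]
          by (intro star_hall_indexed[OF hall mu order_refl]) (auto simp: Z'_def)
        then show False using no_star unfolding eq by blast
      next
        case 3
        \<comment> \<open>\<open>W'\<close> avoids \<open>B\<close>, so it has at most
          \<open>card W - card B\<close> elements, fewer than \<open>card T\<close>. The pairs of
          \<open>T\<close> and \<open>W'\<close> are now counted from both sides:
          \<open>near\<close> bounds them below, \<open>star_sparse\<close> above.\<close>
        define W' where "W' = {v\<in>W0. \<exists>y\<in>T. F v \<subseteq> com n E {y}}"
        have star_iff: "y \<in> com n E (F v) \<longleftrightarrow> F v \<subseteq> com n E {y}" if "v \<in> W" "y < n" for v y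
          using F(1)[OF that(1)] that(2) b by (fastforce simp: com_def insert_commute)
        have "W' \<inter> B = {}"
        proof (rule ccontr)
          assume "W' \<inter> B \<noteq> {}"
          then obtain v y where v: "v \<in> B" "y \<in> T" "F v \<subseteq> com n E {y}" by (auto simp: W'_def)
          then have "y \<in> com n E (F v)" using star_iff[of v y] B T by blast
          then show False using no_star v by blast
        qed
        moreover have W'W: "W' \<subseteq> W" using W0 by (auto simp: W'_def)
        ultimately have "W' \<subseteq> W - B" by blast
        then have "card W' \<le> card (W - B)" using finW by (intro card_mono) auto
        also have "card (W - B) = card W - card B" using B finB by (rule card_Diff_subset[rotated])
        finally have cardW': "card W' \<le> card T" "0 < card T" using cardT less cardB by linarith+
        have finW': "finite W'" using W'W finW finite_subset by blast
        have k0_pos: "k0 \<noteq> 0"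
        proof
          assume "k0 = 0"
          obtain v where v: "v \<in> B" using Bne by blast
          then have "F v = {}" using F[of v] \<open>k0 = 0\<close> B finite_subset[of "F v" "{..<b}"] by auto
          then have "com n E (F v) \<inter> T = T" using T by auto
          then show False using no_star[OF v] cardW'(2) by simp
        qed
        have Fne: "F v \<noteq> {}" if "v \<in> W'" for v using F(2)[of v] that W'W k0_pos by fastforce
        have inj_F: "inj_on F W'"
          by (rule disjoint_image_family(2)) (use F_disj W'W Fne in blast)+
        have dis: "disjoint (F ` W')"
          by (rule disjoint_image_family(1)) (use F_disj W'W in blast)
        have lt: "(\<Sum>G\<in>F ` W'. real (card (com n E G \<inter> T))) < \<theta> * p ^ k0 * card T"
        proof (rule sparse[unfolded star_sparse_def, rule_format, OF k0 T _ _ dis])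
          show "T \<noteq> {}" using cardW'(2) by auto
          show "card T \<le> \<mu>" using 3 by simp
          show "card (F ` W') \<le> card T" using card_image[OF inj_F] cardW' by simp
          show "G \<subseteq> {..<n} \<and> card G = k0 \<and> G \<inter> T = {}" if G: "G \<in> F ` W'" for G
          proof -
            obtain v where v: "v \<in> W" "G = F v" using G W'W by blast
            then show ?thesis using F[of v] F_Y[of v] b by (fastforce simp: T_def)
          qed
        qed
        have "(\<Sum>G\<in>F ` W'. real (card (com n E G \<inter> T))) = (\<Sum>v\<in>W'. real (card (com n E (F v) \<inter> T)))"
          using inj_F by (simp add: sum.reindex)
        also have "\<dots> = (\<Sum>v\<in>W'. \<Sum>y\<in>T. of_bool (y \<in> com n E (F v)))"
        proof (rule sum.cong[OF refl])
          fix v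
          have "finite T" using T finite_subset by blast
          then show "real (card (com n E (F v) \<inter> T)) = (\<Sum>y\<in>T. of_bool (y \<in> com n E (F v)))"
            by (simp add: Int_commute)
        qed
        also have "\<dots> = (\<Sum>y\<in>T. \<Sum>v\<in>W'. of_bool (y \<in> com n E (F v)))" by (rule sum.swap)
        also have "\<dots> = (\<Sum>y\<in>T. real (card {w\<in>W0. g ` adj w \<subseteq> com n E {y}}))"
        proof (rule sum.cong[OF refl])
          fix y assume y: "y \<in> T"
          have "W' \<inter> {v. y \<in> com n E (F v)} = {w\<in>W0. g ` adj w \<subseteq> com n E {y}}"
            using star_iff[of _ y] y T W'W W0 by (fastforce simp: W'_def F_def)
          then show "(\<Sum>v\<in>W'. of_bool (y \<in> com n E (F v))) = real (card {w\<in>W0. g ` adj w \<subseteq> com n E {y}})"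
            using finW' by simp
        qed
        finally have eq: "(\<Sum>G\<in>F ` W'. real (card (com n E G \<inter> T)))
          = (\<Sum>y\<in>T. real (card {w\<in>W0. g ` adj w \<subseteq> com n E {y}}))" .
        have "(\<Sum>y\<in>T. \<theta> * p ^ k0) \<le> (\<Sum>y\<in>T. real (card {w\<in>W0. g ` adj w \<subseteq> com n E {y}}))"
          using near T by (intro sum_mono) auto
        then show False using lt eq by (simp add: mult_ac)
      qed
    qed
    then show "card B \<le> card (\<Union>v\<in>B. com n E (g ` (adj v \<inter> (V - W))) \<inter> Y)"
      unfolding Z_eq .
  qed (auto simp: Y_def)
  then obtain f where f: "embeds E f ((V - W) \<union> W)" "\<forall>v\<in>V - W. f v = g v" "f ` W \<subseteq> Y" by blast
  have "(V - W) \<union> W = V" using W(1) by blast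
  moreover have "f v < n" if "v \<in> V" for v
  proof (cases "v \<in> W")
    case True
    then show ?thesis using f(3) by (auto simp: Y_def)
  next
    case False
    then show ?thesis using f(2) that sub by auto
  qed
  ultimately show ?thesis using f(1) by auto
qed

end

section \<open>Tail bounds for stars in the random graph\<close>

lemma prob_le_expectation:
  fixes M :: "'a pmf" and g :: "'a \<Rightarrow> real"
  assumes "finite (set_pmf M)" "\<And>x. 0 \<le> g x" "\<And>x. x \<in> A \<Longrightarrow> 1 \<le> g x"
  shows "measure_pmf.prob M A \<le> measure_pmf.expectation M g"
proof -
  have "measure_pmf.prob M A = measure_pmf.expectation M (indicator A)" by simp
  also have "\<dots> \<le> measure_pmf.expectation M g"
    using assms by (intro integral_mono integrable_measure_pmf_finite) (auto simp: indicator_def)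
  finally show ?thesis .
qed

lemma union_bound:
  fixes B :: real
  assumes "finite I" "\<And>i. i \<in> I \<Longrightarrow> measure_pmf.prob M {x. P i x} \<le> B"
    and "\<And>x. x \<in> A \<Longrightarrow> \<exists>i\<in>I. P i x"
  shows "measure_pmf.prob M A \<le> card I * B"
proof -
  have "measure_pmf.prob M A \<le> measure_pmf.prob M (\<Union>i\<in>I. {x. P i x})"
    using assms(3) by (intro measure_pmf.finite_measure_mono) auto
  also have "\<dots> \<le> (\<Sum>i\<in>I. measure_pmf.prob M {x. P i x})"
    using assms(1) by (intro measure_pmf.finite_measure_subadditive_finite) auto
  also have "\<dots> \<le> card I * B" using assms(2) by (rule sum_bounded_above)
  finally show ?thesis .
qed

lemma one_plus_prod_le_exp:
  fixes x :: "'i \<Rightarrow> real"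
  assumes "\<And>i. i \<in> I \<Longrightarrow> - 1 \<le> x i"
  shows "(\<Prod>i\<in>I. (1 + x i) ^ t) \<le> exp (\<Sum>i\<in>I. x i * t)"
proof (cases "finite I")
  case True
  have "(\<Prod>i\<in>I. (1 + x i) ^ t) \<le> (\<Prod>i\<in>I. exp (x i) ^ t)"
    using assms by (intro prod_mono conjI power_mono zero_le_power) (fastforce simp: add.commute)+
  also have "\<dots> = exp (\<Sum>i\<in>I. x i * t)"
    using True by (simp add: exp_sum exp_of_nat2_mult)
  finally show ?thesis .
qed simp

lemma exp_minus_1_le: "exp (- 1) \<le> (1 / 2 :: real)"
proof -
  have "(2::real) \<le> exp 1" using exp_ge_add_one_self[of "1::real"] by simp
  then show ?thesis by (simp add: exp_minus field_simps)
qed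

text \<open>By convexity the exponential lies below its chord on the unit interval, and
  \<open>exp 1 \<le> 3\<close>.\<close>

lemma exp_le_chord:
  fixes x :: real
  assumes "0 \<le> x" "x \<le> 1"
  shows "exp x \<le> 1 + 2 * x"
proof -
  have "exp ((1 - x) * 0 + x * 1) \<le> (1 - x) * exp 0 + x * exp 1"
    using convex_onD[OF exp_convex, of x 0 1] assms by simp
  then show ?thesis using mult_left_mono[OF exp_le assms(1)] by simp
qed

locale random_edges =
  fixes n :: nat and p :: real
  assumes p_nonneg: "0 \<le> p" and p_le_1: "p \<le> 1"
begin

definition edge_pmf :: "(nat set \<Rightarrow> bool) pmf" where
  "edge_pmf = Pi_pmf ([{..<n}]\<^bsup>2\<^esup>) False (\<lambda>_. bernoulli_pmf p)"

abbreviation prob :: "(nat set \<Rightarrow> bool) set \<Rightarrow> real" where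
  "prob \<equiv> measure_pmf.prob edge_pmf"

abbreviation expect :: "((nat set \<Rightarrow> bool) \<Rightarrow> real) \<Rightarrow> real" where
  "expect \<equiv> measure_pmf.expectation edge_pmf"

definition edges_of :: "(nat set \<Rightarrow> bool) \<Rightarrow> nat set set" where
  "edges_of X = {e \<in> [{..<n}]\<^bsup>2\<^esup>. X e}"

abbreviation joined :: "(nat set \<Rightarrow> bool) \<Rightarrow> nat set \<Rightarrow> nat set" where
  "joined X \<equiv> com n (edges_of X)"

lemma finite_pairs: "finite ([{..<n}]\<^bsup>2\<^esup>)"
  by (intro finite_imp_finite_nsets) simp

lemma finite_set_edge_pmf: "finite (set_pmf edge_pmf)"
  unfolding edge_pmf_def
  by (rule finite_subset[OF set_Pi_pmf_subset'[OF finite_pairs]], rule finite_PiE_dflt[OF finite_pairs])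
    (auto intro: finite_subset[of _ UNIV])

lemma expectation_all_present:
  assumes S: "S \<subseteq> [{..<n}]\<^bsup>2\<^esup>"
  shows "expect (\<lambda>X. of_bool (\<forall>e\<in>S. X e)) = p ^ card S"
proof -
  let ?U = "[{..<n}]\<^bsup>2\<^esup>"
  have fin: "finite S" using S finite_pairs finite_subset by blast
  have US: "?U \<inter> S = S" using S by blast
  define f where "f = (\<lambda>e b. if e \<in> S then of_bool b else 1 :: real)"
  have prod_f: "(\<Prod>e\<in>?U. f e (X e)) = of_bool (\<forall>e\<in>S. X e)" for X
  proof -
    have "(\<Prod>e\<in>?U. f e (X e)) = (\<Prod>e\<in>?U \<inter> S. of_bool (X e))"
      unfolding f_def by (rule prod.inter_restrict[OF finite_pairs, symmetric])
    also have "\<dots> = of_bool (\<forall>e\<in>S. X e)" unfolding US using fin by (induction S) auto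
    finally show ?thesis .
  qed
  have "expect (\<lambda>X. of_bool (\<forall>e\<in>S. X e))
      = expect (\<lambda>X. \<Prod>e\<in>?U. f e (X e))" unfolding prod_f ..
  also have "\<dots> = (\<Prod>e\<in>?U. measure_pmf.expectation (bernoulli_pmf p) (f e))"
    unfolding edge_pmf_def
  proof (rule expectation_prod_Pi_pmf[OF finite_pairs])
    show "integrable (measure_pmf (bernoulli_pmf p)) (f e)" for e
      by (rule integrable_measure_pmf_finite) simp
    show "0 \<le> f e b" for e b by (simp add: f_def)
  qed
  also have "\<dots> = (\<Prod>e\<in>?U. if e \<in> S then p else 1)"
    using p_nonneg p_le_1 by (intro prod.cong) (auto simp: f_def)
  also have "\<dots> = (\<Prod>e\<in>?U \<inter> S. p)" by (rule prod.inter_restrict[OF finite_pairs, symmetric])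
  also have "\<dots> = p ^ card S" unfolding US by simp
  finally show ?thesis .
qed

text \<open>Expand \<open>\<Prod>i\<in>I. 1 + (a i - 1) * of_bool (\<forall>e\<in>D i. X e)\<close>: only the probabilities that prescribed
  edge sets are present are needed, not the independence of the indicators.\<close>

lemma expectation_prod_disjoint:
  fixes a :: "'i \<Rightarrow> real"
  assumes fin: "finite I" and D: "\<And>i. i \<in> I \<Longrightarrow> D i \<subseteq> [{..<n}]\<^bsup>2\<^esup>"
    and disj: "\<And>i j. i \<in> I \<Longrightarrow> j \<in> I \<Longrightarrow> i \<noteq> j \<Longrightarrow> D i \<inter> D j = {}"
  shows "expect (\<lambda>X. \<Prod>i\<in>I. if \<forall>e\<in>D i. X e then a i else 1)
    = (\<Prod>i\<in>I. 1 + (a i - 1) * p ^ card (D i))"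
proof -
  have finD: "finite (D i)" if "i \<in> I" for i using D[OF that] finite_pairs finite_subset by blast
  have expand: "(\<Prod>i\<in>I. if \<forall>e\<in>D i. X e then a i else 1)
      = (\<Sum>J\<in>Pow I. (\<Prod>i\<in>J. a i - 1) * of_bool (\<forall>e\<in>\<Union>(D ` J). X e))" for X
  proof -
    have "(\<Prod>i\<in>I. if \<forall>e\<in>D i. X e then a i else 1)
        = (\<Prod>i\<in>I. (a i - 1) * of_bool (\<forall>e\<in>D i. X e) + 1)"
      by (intro prod.cong) auto
    also have "\<dots> = (\<Sum>J\<in>Pow I. \<Prod>i\<in>J. (a i - 1) * of_bool (\<forall>e\<in>D i. X e))"
      by (subst prod_add[OF fin]) simp
    also have "\<dots> = (\<Sum>J\<in>Pow I. (\<Prod>i\<in>J. a i - 1) * of_bool (\<forall>e\<in>\<Union>(D ` J). X e))"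
    proof (rule sum.cong[OF refl])
      fix J assume "J \<in> Pow I"
      then have "finite J" using fin finite_subset by blast
      then have "(\<Prod>i\<in>J. of_bool (\<forall>e\<in>D i. X e) :: real) = of_bool (\<forall>e\<in>\<Union>(D ` J). X e)"
        by (induction J) auto
      then show "(\<Prod>i\<in>J. (a i - 1) * of_bool (\<forall>e\<in>D i. X e))
          = (\<Prod>i\<in>J. a i - 1) * of_bool (\<forall>e\<in>\<Union>(D ` J). X e)"
        by (simp only: prod.distrib)
    qed
    finally show ?thesis .
  qed
  have "expect (\<lambda>X. \<Prod>i\<in>I. if \<forall>e\<in>D i. X e then a i else 1)
      = (\<Sum>J\<in>Pow I. (\<Prod>i\<in>J. a i - 1) *
          expect (\<lambda>X. of_bool (\<forall>e\<in>\<Union>(D ` J). X e)))"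
    unfolding expand
    by (subst Bochner_Integration.integral_sum)
      (auto intro!: integrable_measure_pmf_finite finite_set_edge_pmf simp del: UN_ball_bex_simps)
  also have "\<dots> = (\<Sum>J\<in>Pow I. \<Prod>i\<in>J. (a i - 1) * p ^ card (D i))"
  proof (rule sum.cong[OF refl])
    fix J assume J: "J \<in> Pow I"
    then have finJ: "finite J" using fin finite_subset by blast
    have "\<Union>(D ` J) \<subseteq> [{..<n}]\<^bsup>2\<^esup>" using D J by blast
    moreover have "card (\<Union>(D ` J)) = (\<Sum>i\<in>J. card (D i))"
      by (rule card_UN_disjoint) (use finJ finD J disj in blast)+
    ultimately show "(\<Prod>i\<in>J. a i - 1) * expect (\<lambda>X. of_bool (\<forall>e\<in>\<Union>(D ` J). X e))
        = (\<Prod>i\<in>J. (a i - 1) * p ^ card (D i))"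
      by (simp only: expectation_all_present power_sum prod.distrib)
  qed
  also have "\<dots> = (\<Prod>i\<in>I. (a i - 1) * p ^ card (D i) + 1)"
    by (subst prod_add[OF fin]) simp
  finally show ?thesis by (simp only: add.commute)
qed

text \<open>Distinct pairs \<open>(F, y)\<close> give stars with disjoint edge sets:
  \<open>Y\<close> avoids the sets in \<open>\<F>\<close>, so an edge reveals which endpoint is the
  centre, and the other endpoint determines \<open>F\<close> by disjointness. Hence the formula is
  exact.\<close>

lemma star_mgf:
  fixes w :: "nat set \<Rightarrow> real"
  assumes \<F>: "\<And>F. F \<in> \<F> \<Longrightarrow> F \<subseteq> {..<n} \<and> F \<inter> Y = {}" "disjoint \<F>" and Y: "Y \<subseteq> {..<n}"
  shows "expect (\<lambda>X. \<Prod>F\<in>\<F>. w F ^ card (joined X F \<inter> Y))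
    = (\<Prod>F\<in>\<F>. (1 + (w F - 1) * p ^ card F) ^ card Y)"
proof -
  define D where "D = (\<lambda>(F, y). (\<lambda>u. {u, y}) ` F :: nat set set)"
  have "\<F> \<subseteq> Pow {..<n}" using \<F> by blast
  then have fin\<F>: "finite \<F>" using finite_subset by blast
  have finY: "finite Y" using Y finite_subset by blast
  have star: "(\<forall>e\<in>D (F, y). X e) \<longleftrightarrow> y \<in> joined X F" if "F \<in> \<F>" "y \<in> Y" for F y X
  proof -
    have "{u, y} \<in> [{..<n}]\<^bsup>2\<^esup>" if "u \<in> F" for u
      using \<F>(1)[OF \<open>F \<in> \<F>\<close>] that \<open>y \<in> Y\<close> Y by auto
    then show ?thesis using that Y by (auto simp: D_def com_def edges_of_def)
  qed
  have cardD: "card (D (F, y)) = card F" if "F \<in> \<F>" "y \<in> Y" for F y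
    unfolding D_def using \<F>(1)[OF that(1)] that(2)
    by (auto intro!: card_image inj_onI simp: doubleton_eq_iff)
  have "(\<Prod>F\<in>\<F>. w F ^ card (joined X F \<inter> Y))
      = (\<Prod>i\<in>\<F> \<times> Y. if \<forall>e\<in>D i. X e then w (fst i) else 1)" for X
  proof -
    have "(\<Prod>i\<in>\<F> \<times> Y. if \<forall>e\<in>D i. X e then w (fst i) else 1)
        = (\<Prod>(F, y)\<in>\<F> \<times> Y. if y \<in> joined X F then w F else 1)"
    proof (rule prod.cong[OF refl])
      fix i assume "i \<in> \<F> \<times> Y"
      then obtain F y where i: "i = (F, y)" "F \<in> \<F>" "y \<in> Y" by auto
      show "(if \<forall>e\<in>D i. X e then w (fst i) else 1) =
          (case i of (F, y) \<Rightarrow> if y \<in> joined X F then w F else 1)"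
        unfolding i(1) star[OF i(2,3)] by simp
    qed
    also have "\<dots> = (\<Prod>F\<in>\<F>. \<Prod>y\<in>Y. if y \<in> joined X F then w F else 1)"
      by (rule prod.cartesian_product[symmetric])
    also have "\<dots> = (\<Prod>F\<in>\<F>. w F ^ card (joined X F \<inter> Y))"
      using finY by (intro prod.cong) (auto simp: prod.If_cases Int_commute)
    finally show ?thesis by simp
  qed
  then have "expect (\<lambda>X. \<Prod>F\<in>\<F>. w F ^ card (joined X F \<inter> Y))
      = expect (\<lambda>X. \<Prod>i\<in>\<F> \<times> Y. if \<forall>e\<in>D i. X e then w (fst i) else 1)"
    by simp
  also have "\<dots> = (\<Prod>i\<in>\<F> \<times> Y. 1 + (w (fst i) - 1) * p ^ card (D i))"
  proof (rule expectation_prod_disjoint)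
    show "finite (\<F> \<times> Y)" using fin\<F> finY by simp
    show "D i \<subseteq> [{..<n}]\<^bsup>2\<^esup>" if "i \<in> \<F> \<times> Y" for i
      using that \<F>(1) Y by (fastforce simp: D_def)
    show "D i \<inter> D j = {}" if ij: "i \<in> \<F> \<times> Y" "j \<in> \<F> \<times> Y" "i \<noteq> j" for i j
    proof (rule ccontr)
      assume "D i \<inter> D j \<noteq> {}"
      then obtain u v where uv: "u \<in> fst i" "v \<in> fst j" "{u, snd i} = {v, snd j}"
        by (auto simp: D_def case_prod_unfold)
      have "fst i \<in> \<F>" "fst j \<in> \<F>" "snd j \<in> Y" using ij(1,2) by auto
      then have "fst i \<inter> Y = {}" using \<F>(1) by blast
      then have "u \<noteq> snd j" using uv(1) \<open>snd j \<in> Y\<close> by blast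
      then have "u = v" "snd i = snd j" using uv(3) by (auto simp: doubleton_eq_iff)
      moreover have "fst i = fst j"
        using disjointD[OF \<F>(2) \<open>fst i \<in> \<F>\<close> \<open>fst j \<in> \<F>\<close>] uv(1,2) \<open>u = v\<close> by blast
      ultimately show False using ij(3) by (simp add: prod_eq_iff)
    qed
  qed
  also have "\<dots> = (\<Prod>(F, y)\<in>\<F> \<times> Y. 1 + (w F - 1) * p ^ card F)"
    by (intro prod.cong) (auto simp: cardD)
  also have "\<dots> = (\<Prod>F\<in>\<F>. \<Prod>y\<in>Y. 1 + (w F - 1) * p ^ card F)"
    by (rule prod.cartesian_product[symmetric])
  also have "\<dots> = (\<Prod>F\<in>\<F>. (1 + (w F - 1) * p ^ card F) ^ card Y)" by simp
  finally show ?thesis .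
qed

lemma star_mgf_le:
  fixes w :: "nat set \<Rightarrow> real"
  assumes "\<And>F. F \<in> \<F> \<Longrightarrow> F \<subseteq> {..<n} \<and> F \<inter> Y = {}" "disjoint \<F>" "Y \<subseteq> {..<n}"
    and w: "\<And>F. F \<in> \<F> \<Longrightarrow> 0 \<le> w F"
    and le: "\<And>F. F \<in> \<F> \<Longrightarrow> (w F - 1) * p ^ card F \<le> t"
  shows "expect (\<lambda>X. \<Prod>F\<in>\<F>. w F ^ card (joined X F \<inter> Y))
    \<le> exp (t * card \<F> * card Y)"
proof -
  have "expect (\<lambda>X. \<Prod>F\<in>\<F>. w F ^ card (joined X F \<inter> Y))
      \<le> exp (\<Sum>F\<in>\<F>. (w F - 1) * p ^ card F * card Y)"
  proof (subst star_mgf[OF assms(1-3)], assumption, rule one_plus_prod_le_exp)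
    fix F assume "F \<in> \<F>"
    have "p ^ card F \<le> 1" "0 \<le> p ^ card F" using p_nonneg p_le_1 by (auto simp: power_le_one)
    then have "- 1 \<le> - (p ^ card F)" by simp
    also have "\<dots> \<le> (w F - 1) * p ^ card F"
      using w[OF \<open>F \<in> \<F>\<close>] \<open>0 \<le> p ^ card F\<close> by (simp add: algebra_simps)
    finally show "- 1 \<le> (w F - 1) * p ^ card F" .
  qed
  also have "(\<Sum>F\<in>\<F>. (w F - 1) * p ^ card F * card Y) \<le> (\<Sum>F\<in>\<F>. t * card Y)"
    using le by (intro sum_mono mult_right_mono) auto
  finally show ?thesis by (simp add: mult_ac)
qed

text \<open>Markov's inequality for a product of weights, one weight per set. The tail bounds that
  follow differ only in the choice of \<open>w\<close>.\<close>

lemma prob_star_le: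
  fixes w :: "nat set \<Rightarrow> real"
  assumes "\<And>F. F \<in> \<F> \<Longrightarrow> F \<subseteq> {..<n} \<and> F \<inter> Y = {}" "disjoint \<F>" "Y \<subseteq> {..<n}"
    and w: "\<And>F. F \<in> \<F> \<Longrightarrow> 0 \<le> w F"
    and le: "\<And>F. F \<in> \<F> \<Longrightarrow> (w F - 1) * p ^ card F \<le> t"
    and c: "\<And>X. X \<in> A \<Longrightarrow> exp c \<le> (\<Prod>F\<in>\<F>. w F ^ card (joined X F \<inter> Y))"
  shows "prob A \<le> exp (t * card \<F> * card Y - c)"
proof -
  let ?g = "\<lambda>X. \<Prod>F\<in>\<F>. w F ^ card (joined X F \<inter> Y)"
  have "prob A \<le> expect (\<lambda>X. exp (- c) * ?g X)"
  proof (rule prob_le_expectation[OF finite_set_edge_pmf])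
    show "0 \<le> exp (- c) * ?g X" for X using w by (intro mult_nonneg_nonneg prod_nonneg) auto
    show "1 \<le> exp (- c) * ?g X" if "X \<in> A" for X
      using mult_left_mono[OF c[OF that], of "exp (- c)"] by (simp add: exp_minus)
  qed
  also have "\<dots> = exp (- c) * expect ?g" by simp
  also have "\<dots> \<le> exp (- c) * exp (t * card \<F> * card Y)"
    using star_mgf_le[OF assms(1-5)] by (intro mult_left_mono) auto
  also have "\<dots> = exp (t * card \<F> * card Y - c)" by (simp flip: exp_add)
  finally show ?thesis .
qed

text \<open>With weight 0 and \<open>0 ^ 0 = 1\<close> the product is the indicator of the event
  itself.\<close>

lemma prob_no_star:
  assumes "\<And>F. F \<in> \<F> \<Longrightarrow> F \<subseteq> {..<n} \<and> F \<inter> Y = {}" "disjoint \<F>" "Y \<subseteq> {..<n}"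
    and card: "\<And>F. F \<in> \<F> \<Longrightarrow> card F \<le> j"
  shows "prob {X. \<forall>F\<in>\<F>. joined X F \<inter> Y = {}}
    \<le> exp (- (p ^ j * card \<F> * card Y))"
proof -
  have "prob {X. \<forall>F\<in>\<F>. joined X F \<inter> Y = {}}
      \<le> exp (- (p ^ j) * card \<F> * card Y - 0)"
    using card p_nonneg p_le_1
    by (intro prob_star_le[where w = "\<lambda>_. 0", OF assms(1-3)]) (auto intro!: power_decreasing)
  then show ?thesis by simp
qed

lemma prob_few_common:
  fixes t :: real
  assumes F: "F \<subseteq> {..<n}" and Y: "Y \<subseteq> {..<n}" "F \<inter> Y = {}"
  shows "prob {X. card (joined X F \<inter> Y) < t}
    \<le> exp (t - p ^ card F * card Y / 2)"
proof -
  have "prob {X. card (joined X F \<inter> Y) < t}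
      \<le> exp (- (p ^ card F / 2) * card {F} * card Y - (- t))"
  proof (rule prob_star_le[where w = "\<lambda>_. exp (- 1)"])
    show "(exp (- 1) - 1) * p ^ card G \<le> - (p ^ card F / 2)" if "G \<in> {F}" for G
      using mult_right_mono[of "exp (-1) - 1" "- 1 / 2 :: real" "p ^ card F"] exp_minus_1_le p_nonneg that
      by simp
    show "exp (- t) \<le> (\<Prod>F\<in>{F}. exp (- 1) ^ card (joined X F \<inter> Y))"
      if "X \<in> {X. card (joined X F \<inter> Y) < t}" for X
      using that by (simp add: exp_of_nat_mult[symmetric])
  qed (use F Y in \<open>auto simp: disjoint_def\<close>)
  then show ?thesis by simp
qed

lemma prob_many_common:
  fixes t :: real
  assumes F: "F \<subseteq> {..<n}" and Y: "Y \<subseteq> {..<n}" "F \<inter> Y = {}"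
  shows "prob {X. t < card (joined X F \<inter> Y)}
    \<le> exp (2 * p ^ card F * card Y - t)"
proof -
  have "prob {X. t < card (joined X F \<inter> Y)}
      \<le> exp ((2 * p ^ card F) * card {F} * card Y - t)"
  proof (rule prob_star_le[where w = "\<lambda>_. exp 1"])
    show "(exp 1 - 1) * p ^ card G \<le> 2 * p ^ card F" if "G \<in> {F}" for G
      using mult_right_mono[of "exp 1 - 1" "2 :: real" "p ^ card F"] exp_le p_nonneg that
      by simp
    show "exp t \<le> (\<Prod>F\<in>{F}. exp 1 ^ card (joined X F \<inter> Y))"
      if "X \<in> {X. t < card (joined X F \<inter> Y)}" for X
      using that by (simp add: exp_of_nat_mult[symmetric])
  qed (use F Y in \<open>auto simp: disjoint_def\<close>)
  then show ?thesis by simp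
qed

text \<open>The weight is the exponential of \<open>p ^ d / p ^ card F\<close>, so the normalised
  sum, scaled by \<open>p ^ d\<close>, appears in the exponent. The scaling keeps this number at
  most 1, where the chord bound loses only a factor 2; the moment then uses up half of the threshold
  \<open>4 * m * card Y\<close>.\<close>

lemma prob_spread:
  assumes \<F>: "\<And>F. F \<in> \<F> \<Longrightarrow> F \<subseteq> {..<n} \<and> F \<inter> Y = {} \<and> card F \<le> d" "disjoint \<F>"
    and Y: "Y \<subseteq> {..<n}" and m: "card \<F> \<le> m" and p: "0 < p"
  shows "prob {X. 4 * m * card Y < (\<Sum>F\<in>\<F>. card (joined X F \<inter> Y) / p ^ card F)}
    \<le> exp (- (2 * p ^ d * m * card Y))"
proof -
  have "prob {X. 4 * m * card Y < (\<Sum>F\<in>\<F>. card (joined X F \<inter> Y) / p ^ card F)}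
    \<le> exp ((2 * p ^ d) * card \<F> * card Y - p ^ d * (4 * m * card Y))"
  proof (rule prob_star_le[where w = "\<lambda>F. exp (p ^ (d - card F))"])
    fix F assume F: "F \<in> \<F>"
    have eq: "p ^ (d - card F) * p ^ card F = p ^ d" using \<F>(1)[OF F] by (simp flip: power_add)
    have "exp (p ^ (d - card F)) - 1 \<le> 2 * p ^ (d - card F)"
      using exp_le_chord[of "p ^ (d - card F)"] p p_le_1 by (simp add: power_le_one)
    then have "(exp (p ^ (d - card F)) - 1) * p ^ card F \<le> 2 * p ^ (d - card F) * p ^ card F"
      using p by (intro mult_right_mono) auto
    then show "(exp (p ^ (d - card F)) - 1) * p ^ card F \<le> 2 * p ^ d" using eq by (simp add: mult.assoc)
  next
    fix X assume "X \<in> {X. 4 * m * card Y < (\<Sum>F\<in>\<F>. card (joined X F \<inter> Y) / p ^ card F)}"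
    then have "p ^ d * (4 * m * card Y) \<le> p ^ d * (\<Sum>F\<in>\<F>. card (joined X F \<inter> Y) / p ^ card F)"
      using p by (intro mult_left_mono) auto
    also have "\<dots> = (\<Sum>F\<in>\<F>. card (joined X F \<inter> Y) * p ^ (d - card F))"
      unfolding sum_distrib_left
      using \<F>(1) p by (intro sum.cong refl) (simp add: power_diff)
    finally have "exp (p ^ d * (4 * m * card Y)) \<le> exp (\<Sum>F\<in>\<F>. card (joined X F \<inter> Y) * p ^ (d - card F))"
      by simp
    also have "\<dots> = (\<Prod>F\<in>\<F>. exp (p ^ (d - card F)) ^ card (joined X F \<inter> Y))"
    proof -
      have "\<F> \<subseteq> Pow {..<n}" using \<F> by blast
      then have "finite \<F>" using finite_subset by blast
      then show ?thesis by (simp add: exp_sum exp_of_nat_mult)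
    qed
    finally show "exp (p ^ d * (4 * m * card Y)) \<le> (\<Prod>F\<in>\<F>. exp (p ^ (d - card F)) ^ card (joined X F \<inter> Y))" .
  qed (use \<F> Y in auto)
  also have "\<dots> \<le> exp (- (2 * p ^ d * m * card Y))"
  proof -
    have "2 * p ^ d * card \<F> * card Y \<le> 2 * p ^ d * m * card Y"
      using m p by (intro mult_right_mono mult_left_mono) auto
    then show ?thesis by (simp add: mult_ac)
  qed
  finally show ?thesis .
qed

text \<open>\<open>card \<F> \<le> \<mu> \<le> \<theta> / 4\<close> keeps the contribution of the
  moment, with \<open>exp 1 - 1 \<le> 2\<close>, at half of the threshold.\<close>

lemma prob_dense:
  fixes \<mu> \<theta> :: real
  assumes \<F>: "\<And>F. F \<in> \<F> \<Longrightarrow> F \<subseteq> {..<n} \<and> F \<inter> T = {} \<and> card F = j" "disjoint \<F>"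
    and T: "T \<subseteq> {..<n}" "card T \<le> \<mu>" "card \<F> \<le> card T" and \<theta>: "4 * \<mu> \<le> \<theta>"
  shows "prob {X. \<theta> * p ^ j * card T \<le> (\<Sum>F\<in>\<F>. real (card (joined X F \<inter> T)))}
    \<le> exp (- (\<theta> * p ^ j / 2 * card T))"
proof -
  have "prob {X. \<theta> * p ^ j * card T \<le> (\<Sum>F\<in>\<F>. real (card (joined X F \<inter> T)))}
    \<le> exp ((2 * p ^ j) * card \<F> * card T - \<theta> * p ^ j * card T)"
  proof (rule prob_star_le[where w = "\<lambda>_. exp 1"])
    fix F assume F: "F \<in> \<F>"
    show "(exp 1 - 1) * p ^ card F \<le> 2 * p ^ j"
      using mult_right_mono[of "exp 1 - 1" "2 :: real" "p ^ card F"] exp_le p_nonneg \<F>(1)[OF F]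
      by simp
  next
    fix X assume "X \<in> {X. \<theta> * p ^ j * card T \<le> (\<Sum>F\<in>\<F>. real (card (joined X F \<inter> T)))}"
    then have "exp (\<theta> * p ^ j * card T) \<le> exp (\<Sum>F\<in>\<F>. real (card (joined X F \<inter> T)))" by simp
    also have "\<dots> = (\<Prod>F\<in>\<F>. exp 1 ^ card (joined X F \<inter> T))"
    proof -
      have "\<F> \<subseteq> Pow {..<n}" using \<F> by blast
      then have "finite \<F>" using finite_subset by blast
      then show ?thesis by (simp add: exp_sum exp_of_nat_mult[symmetric])
    qed
    finally show "exp (\<theta> * p ^ j * card T) \<le> (\<Prod>F\<in>\<F>. exp 1 ^ card (joined X F \<inter> T))" .
  qed (use \<F> T in auto)
  also have "\<dots> \<le> exp (- (\<theta> * p ^ j / 2 * card T))"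
  proof -
    have "real (card \<F>) \<le> \<theta> / 4" using T \<theta> by linarith
    then have "2 * p ^ j * card \<F> * card T \<le> 2 * p ^ j * (\<theta> / 4) * card T"
      using p_nonneg by (intro mult_right_mono mult_left_mono) auto
    then show ?thesis by simp
  qed
  finally show ?thesis .
qed

end

section \<open>Union bounds\<close>

text \<open>The additional 1 accounts for the empty set, which a disjoint family may
  contain.\<close>

lemma card_disjoint_family:
  assumes "disjoint \<F>" "\<And>F. F \<in> \<F> \<Longrightarrow> F \<subseteq> A" "finite A"
  shows "card \<F> \<le> card A + 1"
proof -
  let ?G = "\<F> - {{}}"
  have fin: "finite \<F>" using assms(2,3) by (meson Pow_iff finite_Pow_iff finite_subset subsetI)
  have "card ?G = (\<Sum>F\<in>?G. 1)" by simp
  also have "\<dots> \<le> (\<Sum>F\<in>?G. card F)"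
    using assms(2,3) by (intro sum_mono) (metis DiffE Suc_leI card_gt_0_iff finite_subset insertI1 One_nat_def)
  also have "\<dots> = card (\<Union>?G)"
  proof (rule card_Union_disjoint[symmetric])
    show "pairwise disjnt ?G" using assms(1) by (auto simp: disjoint_def pairwise_def disjnt_def)
    show "finite F" if "F \<in> ?G" for F using that assms(2,3) finite_subset by blast
  qed
  also have "\<dots> \<le> card A" using assms(2,3) by (intro card_mono) auto
  finally have "card ?G \<le> card A" .
  moreover have "card \<F> \<le> card ?G + 1"
    using fin by (metis One_nat_def Suc_eq_plus1 add_leD1 card.empty card_Diff1_le card_Suc_Diff1 Diff_empty Diff_insert0 le_SucI order_refl)
  ultimately show ?thesis by simp
qed

context random_edges
begin

text \<open>With \<open>n + 1\<close> in place of n, powers of \<open>n + 1\<close> become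
  exponentials of multiples of \<open>L\<close> exactly.\<close>

definition L :: real where "L = ln (real n + 1)"

lemma L_nonneg: "0 \<le> L"
  by (simp add: L_def)

lemma power_eq_exp: "real ((n + 1) ^ N) = exp (N * L)"
  by (simp add: L_def exp_of_nat_mult add.commute)

lemma exp_minus_L: "exp (- L) = 1 / (real n + 1)"
  by (simp add: L_def exp_minus inverse_eq_divide)

lemma n_plus_1_eq: "real n + 1 = exp L"
  by (simp add: L_def)

definition small_sets :: "nat \<Rightarrow> nat set set" where
  "small_sets j = {F. F \<subseteq> {..<n} \<and> card F \<le> j}"

definition families :: "nat \<Rightarrow> nat \<Rightarrow> nat set set set" where
  "families j s = {\<F>. \<F> \<subseteq> small_sets j \<and> card \<F> \<le> s}"

lemma finite_small_sets: "finite (small_sets j)"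
  unfolding small_sets_def by (rule finite_subset[of _ "Pow {..<n}"]) auto

lemma finite_families: "finite (families j s)"
  unfolding families_def by (rule finite_subset[of _ "Pow (small_sets j)"]) (auto simp: finite_small_sets)

lemma card_small_sets: "real (card (small_sets j)) \<le> exp (j * L)"
  using card_small_subsets[of "{..<n}" j] unfolding power_eq_exp[symmetric] small_sets_def
  by (simp only: of_nat_le_iff finite_lessThan card_lessThan)

text \<open>The counting lemma for small subsets one level up: a family is a small subset of
  \<open>small_sets j\<close>.\<close>

lemma card_families:
  assumes "1 \<le> n"
  shows "real (card (families j s)) \<le> exp ((j + 1) * s * L)"
proof -
  have "card (families j s) \<le> (card (small_sets j) + 1) ^ s"
    unfolding families_def by (rule card_small_subsets[OF finite_small_sets])
  also have "\<dots> \<le> ((n + 1) ^ (j + 1)) ^ s"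
  proof (rule power_mono)
    have "card (small_sets j) + 1 \<le> (n + 1) ^ j + 1"
      using card_small_subsets[of "{..<n}" j] by (simp add: small_sets_def)
    also have "\<dots> \<le> (n + 1) ^ j + (n + 1) ^ j * n" using assms by simp
    finally show "card (small_sets j) + 1 \<le> (n + 1) ^ (j + 1)" by (simp add: mult.commute)
  qed simp
  finally have "real (card (families j s)) \<le> real ((n + 1) ^ ((j + 1) * s))"
    by (simp only: of_nat_le_iff power_mult)
  then show ?thesis unfolding power_eq_exp by (simp add: algebra_simps)
qed

text \<open>The common end of all union bounds: \<open>x\<close> is the logarithm of the number of
  cases, \<open>y\<close> the exponent of a single failure, and \<open>L\<close> is what must be
  left over.\<close>

lemma prob_le_inverse:
  assumes "prob A \<le> real N * exp (- y)" "real N \<le> exp x" "x + L \<le> y"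
  shows "prob A \<le> 1 / (real n + 1)"
proof -
  have "real N * exp (- y) \<le> exp x * exp (- y)" using assms(2) by (intro mult_right_mono) auto
  also have "\<dots> = exp (x - y)" by (simp add: exp_diff exp_minus divide_inverse)
  also have "\<dots> \<le> exp (- L)" using assms(3) by simp
  finally show ?thesis using assms(1) exp_minus_L by simp
qed

text \<open>\<open>F\<close> may meet the block but removes at most \<open>k \<le> a / 2\<close> of
  its vertices. With \<open>a / 2\<close> vertices left the tail bound has exponent
  \<open>1 / 8 - 1 / 4 = - 1 / 8\<close> times \<open>p ^ card F * a\<close>.\<close>

lemma prob_not_lower:
  assumes p: "0 < p" and r: "r \<le> n + 1" "r * a \<le> n" and a: "2 * k \<le> a"
    and big: "8 * (k + 2) * L \<le> p ^ k * a"
  shows "prob {X. \<not> common_lower n (edges_of X) p k r a} \<le> 1 / (real n + 1)"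
proof (rule prob_le_inverse)
  let ?I = "small_sets k \<times> {..<r}"
  show "prob {X. \<not> common_lower n (edges_of X) p k r a}
      \<le> card ?I * exp (- (p ^ k * a / 8))"
  proof (rule union_bound[where P = "\<lambda>i X. card (joined X (fst i) \<inter> cls a (snd i)) < p ^ card (fst i) * a / 8"])
    show "finite ?I" using finite_small_sets by simp
    show "\<exists>i\<in>?I. card (joined X (fst i) \<inter> cls a (snd i)) < p ^ card (fst i) * a / 8"
      if "X \<in> {X. \<not> common_lower n (edges_of X) p k r a}" for X
    proof -
      from that obtain F c where "F \<subseteq> {..<n}" "card F \<le> k" "c < r"
        "\<not> p ^ card F * a / 8 \<le> real (card (joined X F \<inter> cls a c))"
        unfolding common_lower_def mem_Collect_eq not_all not_imp by (elim exE conjE) (rule that; assumption)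
      then show ?thesis by (intro bexI[of _ "(F, c)"]) (simp_all add: small_sets_def)
    qed
    fix i assume "i \<in> ?I"
    then obtain F c where i: "i = (F, c)" and F: "F \<subseteq> {..<n}" "card F \<le> k" and c: "c < r"
      by (auto simp: small_sets_def)
    define Y where "Y = cls a c - F"
    have finF: "finite F" using F finite_subset by blast
    have Y: "Y \<subseteq> {..<n}" "F \<inter> Y = {}" using cls_subset[OF c, of a] r(2) by (auto simp: Y_def)
    have "a - k \<le> card Y"
      unfolding Y_def using diff_card_le_card_Diff[OF finF, of "cls a c"] F(2) by simp
    then have cardY: "real a / 2 \<le> card Y" using a by linarith
    have "prob {X. card (joined X F \<inter> cls a c) < p ^ card F * a / 8}
        \<le> prob {X. card (joined X F \<inter> Y) < p ^ card F * a / 8}"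
    proof (intro measure_pmf.finite_measure_mono subsetI CollectI)
      fix X assume "X \<in> {X. card (joined X F \<inter> cls a c) < p ^ card F * a / 8}"
      moreover have "card (joined X F \<inter> Y) \<le> card (joined X F \<inter> cls a c)"
        by (intro card_mono) (auto simp: Y_def)
      ultimately show "card (joined X F \<inter> Y) < p ^ card F * a / 8" by simp
    qed simp
    also have "\<dots> \<le> exp (p ^ card F * a / 8 - p ^ card F * card Y / 2)"
      by (rule prob_few_common[OF F(1) Y])
    also have "\<dots> \<le> exp (- (p ^ k * a / 8))"
    proof -
      have "p ^ card F * (real a / 2) \<le> p ^ card F * card Y"
        using cardY p by (intro mult_left_mono) auto
      moreover have "p ^ k * a \<le> p ^ card F * a"
        using F(2) p p_le_1 by (intro mult_right_mono power_decreasing) auto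
      ultimately show ?thesis by simp
    qed
    finally show "prob {X.
        card (joined X (fst i) \<inter> cls a (snd i)) < p ^ card (fst i) * a / 8} \<le> exp (- (p ^ k * a / 8))"
      by (simp add: i)
  qed
  have "real (card ?I) \<le> exp (k * L) * exp L"
    unfolding card_cartesian_product of_nat_mult n_plus_1_eq[symmetric]
    using card_small_sets[of k] r(1) by (intro mult_mono) auto
  then show "real (card ?I) \<le> exp (k * L + L)" by (simp add: exp_add)
  show "k * L + L + L \<le> p ^ k * a / 8" using big by (simp add: algebra_simps)
qed

lemma prob_not_upper:
  assumes p: "0 < p" and r: "r \<le> n + 1" "r * a \<le> n" and d: "d \<le> k"
    and big: "8 * (k + 2) * L \<le> p ^ k * a"
  shows "prob {X. \<not> common_upper n (edges_of X) p d r a} \<le> 1 / (real n + 1)"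
proof (rule prob_le_inverse)
  let ?I = "small_sets d \<times> {..<r}"
  show "prob {X. \<not> common_upper n (edges_of X) p d r a}
      \<le> card ?I * exp (- (p ^ k * a))"
  proof (rule union_bound[where P = "\<lambda>i X. 4 * p ^ card (fst i) * a < card (joined X (fst i) \<inter> cls a (snd i))"])
    show "finite ?I" using finite_small_sets by simp
    show "\<exists>i\<in>?I. 4 * p ^ card (fst i) * a < card (joined X (fst i) \<inter> cls a (snd i))"
      if "X \<in> {X. \<not> common_upper n (edges_of X) p d r a}" for X
    proof -
      from that obtain F c where "F \<subseteq> {..<n}" "card F \<le> d" "c < r"
        "\<not> real (card (joined X F \<inter> cls a c)) \<le> 4 * p ^ card F * a"
        unfolding common_upper_def mem_Collect_eq not_all not_imp by (elim exE conjE) (rule that; assumption)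
      then show ?thesis by (intro bexI[of _ "(F, c)"]) (simp_all add: small_sets_def)
    qed
    fix i assume "i \<in> ?I"
    then obtain F c where i: "i = (F, c)" and F: "F \<subseteq> {..<n}" "card F \<le> d" and c: "c < r"
      by (auto simp: small_sets_def)
    define Y where "Y = cls a c - F"
    have Y: "Y \<subseteq> {..<n}" "F \<inter> Y = {}" using cls_subset[OF c, of a] r(2) by (auto simp: Y_def)
    have cardY: "card Y \<le> a"
      unfolding Y_def using card_mono[of "cls a c" "cls a c - F"] by simp
    \<comment> \<open>There are no loops, so an element of \<open>F\<close> is never joined to all
      of \<open>F\<close>, and removing \<open>F\<close> from the block loses nothing.\<close>
    have "joined X F \<inter> cls a c = joined X F \<inter> Y" for X
    proof -
      have "x \<notin> joined X F" if "x \<in> F" for x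
        using that by (auto simp: com_def edges_of_def)
      then show ?thesis by (auto simp: Y_def)
    qed
    then have "prob {X. 4 * p ^ card F * a < card (joined X F \<inter> cls a c)}
        \<le> exp (2 * p ^ card F * card Y - 4 * p ^ card F * a)"
      using prob_many_common[OF F(1) Y] by simp
    also have "\<dots> \<le> exp (- (p ^ k * a))"
    proof -
      have "2 * p ^ card F * card Y \<le> 2 * p ^ card F * a"
        using cardY p by (intro mult_left_mono) auto
      moreover have "p ^ k * a \<le> p ^ card F * a"
        using F(2) d p p_le_1 by (intro mult_right_mono power_decreasing) auto
      moreover have "0 \<le> p ^ card F * a" using p by simp
      ultimately show ?thesis by simp
    qed
    finally show "prob {X.
        4 * p ^ card (fst i) * a < card (joined X (fst i) \<inter> cls a (snd i))} \<le> exp (- (p ^ k * a))"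
      by (simp add: i)
  qed
  have "real (card ?I) \<le> exp (d * L) * exp L"
    unfolding card_cartesian_product of_nat_mult n_plus_1_eq[symmetric]
    using card_small_sets[of d] r(1) by (intro mult_mono) auto
  then show "real (card ?I) \<le> exp (d * L + L)" by (simp add: exp_add)
  have "d * L \<le> k * L" using d L_nonneg by (intro mult_right_mono) auto
  moreover have "0 \<le> k * L" using L_nonneg by simp
  moreover have "8 * (real k + 2) * L = 8 * (k * L) + 16 * L" by (simp add: algebra_simps)
  ultimately show "d * L + L + L \<le> p ^ k * a" using big L_nonneg by linarith
qed

text \<open>This union bound dictates the density. \<open>2 ^ n\<close> sets \<open>Y\<close> and
  \<open>exp ((d + 1) * m * L)\<close> families are paid for by
  \<open>p ^ (d + k) * m * a / 4\<close>, in which \<open>p ^ d\<close> comes from the stars and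
  \<open>p ^ k\<close> from the smallest \<open>Y\<close> in question.\<close>

lemma prob_not_spread:
  assumes p: "0 < p" and n: "1 \<le> n" and r: "r \<le> n + 1" "r * a \<le> n"
    and big: "n + ((d + 1) * m + 2) * L \<le> p ^ (d + k) * m * a / 4"
  shows "prob {X. \<not> star_spread n (edges_of X) p d k r a m} \<le> 1 / (real n + 1)"
proof (rule prob_le_inverse)
  define I where "I = {(c, Y, \<F>). c < r \<and> Y \<subseteq> cls a c \<and> p ^ k * a / 8 \<le> real (card Y) \<and>
    (\<forall>F\<in>\<F>. F \<subseteq> {..<n} - cls a c \<and> F \<noteq> {} \<and> card F \<le> d) \<and> disjoint \<F> \<and> card \<F> \<le> m}"
  have sub: "I \<subseteq> {..<r} \<times> Pow {..<n} \<times> families d m"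
  proof
    fix i assume "i \<in> I"
    then obtain c Y \<F> where i: "i = (c, Y, \<F>)" "c < r" "Y \<subseteq> cls a c"
      "\<forall>F\<in>\<F>. F \<subseteq> {..<n} - cls a c \<and> F \<noteq> {} \<and> card F \<le> d" "card \<F> \<le> m"
      by (auto simp: I_def)
    have "Y \<subseteq> {..<n}" using i(3) cls_subset[OF i(2), of a] r(2) by fastforce
    moreover have "\<F> \<in> families d m" using i(4,5) by (auto simp: families_def small_sets_def)
    ultimately show "i \<in> {..<r} \<times> Pow {..<n} \<times> families d m" using i(1,2) by simp
  qed
  have fin: "finite ({..<r} \<times> Pow {..<n} \<times> families d m)" using finite_families by simp
  show "prob {X. \<not> star_spread n (edges_of X) p d k r a m}
      \<le> card I * exp (- (p ^ (d + k) * m * a / 4))"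
  proof (rule union_bound[where P = "\<lambda>i X. 4 * m * card (fst (snd i)) <
      (\<Sum>F\<in>snd (snd i). card (joined X F \<inter> fst (snd i)) / p ^ card F)"])
    show "finite I" by (rule finite_subset[OF sub fin])
    show "\<exists>i\<in>I. 4 * m * card (fst (snd i)) <
      (\<Sum>F\<in>snd (snd i). card (joined X F \<inter> fst (snd i)) / p ^ card F)"
      if "X \<in> {X. \<not> star_spread n (edges_of X) p d k r a m}" for X
    proof -
      from that obtain c Y \<F> where *: "c < r" "Y \<subseteq> cls a c" "p ^ k * a / 8 \<le> real (card Y)"
        "\<forall>F\<in>\<F>. F \<subseteq> {..<n} - cls a c \<and> F \<noteq> {} \<and> card F \<le> d" "disjoint \<F>" "card \<F> \<le> m"
        "\<not> (\<Sum>F\<in>\<F>. card (joined X F \<inter> Y) / p ^ card F) \<le> 4 * m * card Y"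
        unfolding star_spread_def mem_Collect_eq not_all not_imp by (elim exE conjE) (rule that; assumption)
      then have "(c, Y, \<F>) \<in> I" by (simp add: I_def)
      then show ?thesis using *(7) by (intro bexI[of _ "(c, Y, \<F>)"]) simp_all
    qed
    fix i assume "i \<in> I"
    then obtain c Y \<F> where i: "i = (c, Y, \<F>)" "c < r" "Y \<subseteq> cls a c" "p ^ k * a / 8 \<le> real (card Y)"
      "\<forall>F\<in>\<F>. F \<subseteq> {..<n} - cls a c \<and> F \<noteq> {} \<and> card F \<le> d" "disjoint \<F>" "card \<F> \<le> m"
      by (auto simp: I_def)
    have Y: "Y \<subseteq> {..<n}" using i(3) cls_subset[OF i(2), of a] r(2) by fastforce
    have "F \<subseteq> {..<n} \<and> F \<inter> Y = {} \<and> card F \<le> d" if "F \<in> \<F>" for F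
      using i(3,5) that by blast
    from prob_spread[OF this i(6) Y i(7) p]
    have "prob {X. 4 * m * card Y <
        (\<Sum>F\<in>\<F>. card (joined X F \<inter> Y) / p ^ card F)} \<le> exp (- (2 * p ^ d * m * card Y))"
      by simp
    also have "\<dots> \<le> exp (- (p ^ (d + k) * m * a / 4))"
    proof -
      have "2 * p ^ d * m * (p ^ k * a / 8) \<le> 2 * p ^ d * m * card Y"
        using i(4) p by (intro mult_left_mono) auto
      then show ?thesis by (simp add: power_add mult_ac)
    qed
    finally show "prob {X. 4 * m * card (fst (snd i)) <
      (\<Sum>F\<in>snd (snd i). card (joined X F \<inter> fst (snd i)) / p ^ card F)} \<le> exp (- (p ^ (d + k) * m * a / 4))"
      by (simp add: i(1))
  qed
  have "card I \<le> r * (2 ^ n * card (families d m))"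
    using card_mono[OF fin sub] by (simp add: card_cartesian_product card_Pow)
  from of_nat_mono[OF this, where 'a = real]
  have "real (card I) \<le> real r * (2 ^ n * real (card (families d m)))"
    unfolding of_nat_mult of_nat_power of_nat_numeral .
  also have "\<dots> \<le> exp L * (exp n * exp ((d + 1) * m * L))"
  proof (intro mult_mono)
    show "real r \<le> exp L" using r(1) unfolding n_plus_1_eq[symmetric] by simp
    have "(2::real) ^ n \<le> exp 1 ^ n" using exp_ge_add_one_self[of "1::real"] by (intro power_mono) auto
    then show "(2::real) ^ n \<le> exp n" by (simp add: exp_of_nat_mult[symmetric])
  qed (use card_families[OF n, of d m] in \<open>auto simp: algebra_simps\<close>)
  finally show "real (card I) \<le> exp (L + (n + (d + 1) * m * L))" by (simp only: exp_add)
  show "L + (n + (d + 1) * m * L) + L \<le> p ^ (d + k) * m * a / 4"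
    using big by (simp add: algebra_simps)
qed

text \<open>Families are grouped by their size \<open>s\<close>, because the logarithm of the number
  of choices and the exponent of failure both grow linearly in \<open>s\<close>. Each of the
  \<open>n + 1\<close> sizes fails with probability at most \<open>exp (- 2 * L)\<close>.\<close>

lemma prob_not_hall:
  fixes \<Lambda> :: nat
  assumes n: "1 \<le> n" and mu: "0 < \<mu>" and big: "(2 * d + \<Lambda> + 6) * L \<le> p ^ (2 * d) * \<mu>"
  shows "prob {X. \<not> star_hall n (edges_of X) d \<Lambda> \<mu>} \<le> 1 / (real n + 1)"
proof -
  define Q where "Q = (\<lambda>(l, u, Z, \<F>) X. \<forall>F\<in>\<F>. joined X F \<inter> ({l..<u} - Z) = {})"
  define I where "I = (\<lambda>s. {(l, u, Z, \<F>). u \<le> n \<and> Z \<subseteq> {l..<u} \<and> disjoint \<F> \<and>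
    (\<forall>F\<in>\<F>. F \<subseteq> {..<n} \<and> card F \<le> 2 * d \<and> F \<inter> ({l..<u} - Z) = {}) \<and>
    card Z \<le> \<Lambda> * s \<and> card \<F> = s \<and> \<mu> \<le> card ({l..<u} - Z)})"
  have sub: "I s \<subseteq> {..<n + 1} \<times> {..<n + 1} \<times> small_sets (\<Lambda> * s) \<times> families (2 * d) s" for s
  proof
    fix i assume "i \<in> I s"
    then obtain l u Z \<F> where i: "i = (l, u, Z, \<F>)" "u \<le> n" "Z \<subseteq> {l..<u}"
      "\<forall>F\<in>\<F>. F \<subseteq> {..<n} \<and> card F \<le> 2 * d \<and> F \<inter> ({l..<u} - Z) = {}" "card Z \<le> \<Lambda> * s"
      "card \<F> = s" "\<mu> \<le> card ({l..<u} - Z)"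
      by (auto simp: I_def)
    have "{l..<u} - Z \<noteq> {}" using i(7) mu by (metis card.empty not_le of_nat_0)
    then have "l < u" by auto
    moreover have "Z \<in> small_sets (\<Lambda> * s)" using i(2,3,5) by (auto simp: small_sets_def)
    moreover have "\<F> \<in> families (2 * d) s" using i(4,6) by (auto simp: families_def small_sets_def)
    ultimately show "i \<in> {..<n + 1} \<times> {..<n + 1} \<times> small_sets (\<Lambda> * s) \<times> families (2 * d) s"
      using i(1,2) by simp
  qed
  have fin: "finite ({..<n + 1} \<times> {..<n + 1} \<times> small_sets (\<Lambda> * s) \<times> families (2 * d) s)" for s
    using finite_families finite_small_sets by simp
  have inner: "prob {X. \<exists>i\<in>I s. Q i X} \<le> exp (- 2 * L)" if s: "1 \<le> s" for s
  proof -
    have "prob {X. \<exists>i\<in>I s. Q i X} \<le> card (I s) * exp (- (p ^ (2 * d) * \<mu> * s))"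
    proof (rule union_bound[where P = Q])
      show "finite (I s)" by (rule finite_subset[OF sub fin])
      fix i assume "i \<in> I s"
      then obtain l u Z \<F> where i: "i = (l, u, Z, \<F>)" "u \<le> n" "disjoint \<F>"
        "\<forall>F\<in>\<F>. F \<subseteq> {..<n} \<and> card F \<le> 2 * d \<and> F \<inter> ({l..<u} - Z) = {}" 
        "card \<F> = s" "\<mu> \<le> card ({l..<u} - Z)"
        by (auto simp: I_def)
      have "prob {X. Q i X}
          \<le> exp (- (p ^ (2 * d) * card \<F> * card ({l..<u} - Z)))"
        unfolding Q_def i(1) prod.case
        by (rule prob_no_star) (use i in auto)
      also have "p ^ (2 * d) * card \<F> * \<mu> \<le> p ^ (2 * d) * card \<F> * card ({l..<u} - Z)"
        using i(6) p_nonneg by (intro mult_left_mono) auto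
      then have "exp (- (p ^ (2 * d) * card \<F> * card ({l..<u} - Z))) \<le> exp (- (p ^ (2 * d) * \<mu> * s))"
        using i(5) by (simp add: mult_ac)
      finally show "prob {X. Q i X} \<le> exp (- (p ^ (2 * d) * \<mu> * s))" .
    qed auto
    also have "\<dots> \<le> exp (L + (L + ((\<Lambda> * s) * L + (2 * d + 1) * s * L))) * exp (- (p ^ (2 * d) * \<mu> * s))"
    proof (rule mult_right_mono)
      have "card (I s) \<le> (n + 1) * ((n + 1) * (card (small_sets (\<Lambda> * s)) * card (families (2 * d) s)))"
        using card_mono[OF fin sub] by (simp add: card_cartesian_product)
      from of_nat_mono[OF this, where 'a = real]
      have "real (card (I s)) \<le> (real n + 1) * ((real n + 1) *
          (real (card (small_sets (\<Lambda> * s))) * real (card (families (2 * d) s))))"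
        unfolding of_nat_mult of_nat_add of_nat_1 .
      also have "\<dots> \<le> exp L * (exp L * (exp ((\<Lambda> * s) * L) * exp ((2 * d + 1) * s * L)))"
        unfolding n_plus_1_eq
        using card_families[OF n, of "2 * d" s] card_small_sets[of "\<Lambda> * s"]
        by (intro mult_mono) (auto simp: algebra_simps)
      finally show "real (card (I s)) \<le> exp (L + (L + ((\<Lambda> * s) * L + (2 * d + 1) * s * L)))"
        by (simp only: exp_add)
    qed simp
    also have "\<dots> \<le> exp (- 2 * L)"
    proof -
      have "(2 * d + \<Lambda> + 6) * L * s \<le> p ^ (2 * d) * \<mu> * s" using big by (intro mult_right_mono) auto
      moreover have "L * 1 \<le> L * s" using s L_nonneg by (intro mult_left_mono) auto
      moreover note L_nonneg
      ultimately have "L + (L + ((\<Lambda> * s) * L + (2 * d + 1) * s * L)) - p ^ (2 * d) * \<mu> * s \<le> - 2 * L"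
        by (simp add: algebra_simps)
      then show ?thesis by (simp flip: exp_add)
    qed
    finally show ?thesis .
  qed
  have "prob {X. \<not> star_hall n (edges_of X) d \<Lambda> \<mu>} \<le> card {1..n + 1} * exp (- 2 * L)"
  proof (rule union_bound[where P = "\<lambda>s X. \<exists>i\<in>I s. Q i X"])
    show "prob {X. \<exists>i\<in>I s. Q i X} \<le> exp (- 2 * L)" if "s \<in> {1..n + 1}" for s
      using inner that by simp
    fix X assume "X \<in> {X. \<not> star_hall n (edges_of X) d \<Lambda> \<mu>}"
    then obtain l u Z \<F> where *: "u \<le> n" "Z \<subseteq> {l..<u}" "\<F> \<noteq> {}" "disjoint \<F>"
      "\<forall>F\<in>\<F>. F \<subseteq> {..<n} \<and> card F \<le> 2 * d \<and> F \<inter> ({l..<u} - Z) = {}"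
      "real (card Z) \<le> real \<Lambda> * card \<F>" "\<mu> \<le> card ({l..<u} - Z)"
      "\<not> (\<exists>F\<in>\<F>. joined X F \<inter> ({l..<u} - Z) \<noteq> {})"
      unfolding star_hall_def mem_Collect_eq not_all not_imp by (elim exE conjE) (rule that; assumption)
    have "\<F> \<subseteq> Pow {..<n}" using *(5) by blast
    then have "finite \<F>" using finite_subset by blast
    then have "1 \<le> card \<F>" using *(3) by (simp add: Suc_leI card_gt_0_iff)
    moreover have "card \<F> \<le> n + 1" using card_disjoint_family[OF *(4), of "{..<n}"] *(5) by simp
    moreover have "(l, u, Z, \<F>) \<in> I (card \<F>)"
    proof -
      have "card Z \<le> \<Lambda> * card \<F>" using *(6) by (metis of_nat_le_iff of_nat_mult)
      then show ?thesis using * by (simp add: I_def)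
    qed
    moreover have "Q (l, u, Z, \<F>) X" using *(8) by (simp add: Q_def)
    ultimately show "\<exists>s\<in>{1..n + 1}. \<exists>i\<in>I s. Q i X" by (intro bexI[of _ "card \<F>"] bexI) auto
  qed simp
  then have "prob {X. \<not> star_hall n (edges_of X) d \<Lambda> \<mu>} \<le> card {1..n + 1} * exp (- (2 * L))"
    by simp
  then show ?thesis
    by (rule prob_le_inverse[where x = L]) (simp_all add: n_plus_1_eq[symmetric])
qed

text \<open>Grouped by \<open>j\<close> and by \<open>t = card T\<close>, with everything linear in
  \<open>t\<close>. The assumption \<open>2 * d + 1 \<le> n + 1\<close> keeps the number of groups
  below \<open>exp (L + L)\<close>.\<close>

lemma prob_not_sparse:
  assumes n: "1 \<le> n" "2 * d + 1 \<le> n + 1" and p: "0 < p" and theta: "4 * \<mu> \<le> \<theta>" "0 \<le> \<theta>"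
    and big: "(2 * d + 6) * L \<le> p ^ (2 * d) * \<theta> / 2"
  shows "prob {X. \<not> star_sparse n (edges_of X) p d \<theta> \<mu>} \<le> 1 / (real n + 1)"
proof -
  define Q where "Q = (\<lambda>j (T, \<F>) X. \<theta> * p ^ j * card T \<le> (\<Sum>F\<in>\<F>. real (card (joined X F \<inter> T))))"
  define I where "I = (\<lambda>(j, t). {(T, \<F>). T \<subseteq> {..<n} \<and> card T = t \<and> real (card T) \<le> \<mu> \<and> disjoint \<F> \<and>
    (\<forall>F\<in>\<F>. F \<subseteq> {..<n} \<and> card F = j \<and> F \<inter> T = {}) \<and> card \<F> \<le> t})"
  have sub: "I (j, t) \<subseteq> small_sets t \<times> families (2 * d) t" if "j \<le> 2 * d" for j t
    using that by (auto simp: I_def small_sets_def families_def)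
  have fin: "finite (small_sets t \<times> families (2 * d) t)" for t
    using finite_families finite_small_sets by simp
  have inner: "prob {X. \<exists>i\<in>I (j, t). Q j i X} \<le> exp (- 4 * L)"
    if j: "j \<le> 2 * d" and t: "1 \<le> t" for j t
  proof -
    have "prob {X. \<exists>i\<in>I (j, t). Q j i X} \<le> card (I (j, t)) * exp (- (\<theta> * p ^ (2 * d) / 2 * t))"
    proof (rule union_bound[where P = "Q j"])
      show "finite (I (j, t))" by (rule finite_subset[OF sub[OF j] fin])
      fix i assume "i \<in> I (j, t)"
      then obtain T \<F> where i: "i = (T, \<F>)" "T \<subseteq> {..<n}" "card T = t" "card T \<le> \<mu>" "disjoint \<F>"
        "\<And>F. F \<in> \<F> \<Longrightarrow> F \<subseteq> {..<n} \<and> F \<inter> T = {} \<and> card F = j" "card \<F> \<le> card T"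
        by (auto simp: I_def)
      have "prob {X. Q j i X} \<le> exp (- (\<theta> * p ^ j / 2 * card T))"
        unfolding Q_def i(1) prod.case by (rule prob_dense[OF i(6,5,2,4,7) theta(1)])
      also have "\<theta> * p ^ (2 * d) / 2 * t \<le> \<theta> * p ^ j / 2 * t"
        using theta(2) p p_le_1 j by (intro mult_right_mono divide_right_mono mult_left_mono power_decreasing) auto
      then have "exp (- (\<theta> * p ^ j / 2 * card T)) \<le> exp (- (\<theta> * p ^ (2 * d) / 2 * t))"
        using i(3) by simp
      finally show "prob {X. Q j i X} \<le> exp (- (\<theta> * p ^ (2 * d) / 2 * t))" .
    qed auto
    also have "\<dots> \<le> exp (t * L + (2 * d + 1) * t * L) * exp (- (\<theta> * p ^ (2 * d) / 2 * t))"
    proof (rule mult_right_mono)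
      have "card (I (j, t)) \<le> card (small_sets t) * card (families (2 * d) t)"
        using card_mono[OF fin sub[OF j]] by (simp add: card_cartesian_product)
      then have "real (card (I (j, t))) \<le> real (card (small_sets t)) * real (card (families (2 * d) t))"
        by (metis of_nat_le_iff of_nat_mult)
      also have "\<dots> \<le> exp (t * L) * exp ((2 * d + 1) * t * L)"
        using card_families[OF n(1), of "2 * d" t] card_small_sets[of t]
        by (intro mult_mono) (auto simp: algebra_simps)
      finally show "real (card (I (j, t))) \<le> exp (t * L + (2 * d + 1) * t * L)"
        by (simp only: exp_add)
    qed simp
    also have "\<dots> \<le> exp (- 4 * L)"
    proof -
      have "(2 * d + 6) * L * t \<le> p ^ (2 * d) * \<theta> / 2 * t" using big by (intro mult_right_mono) auto
      moreover have "L * 1 \<le> L * t" using t L_nonneg by (intro mult_left_mono) auto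
      ultimately have "t * L + (2 * d + 1) * t * L - \<theta> * p ^ (2 * d) / 2 * t \<le> - 4 * L"
        by (simp add: algebra_simps)
      then show ?thesis by (simp flip: exp_add)
    qed
    finally show ?thesis .
  qed
  have "prob {X. \<not> star_sparse n (edges_of X) p d \<theta> \<mu>}
      \<le> card ({..2 * d} \<times> {1..n}) * exp (- 4 * L)"
  proof (rule union_bound[where P = "\<lambda>jt X. \<exists>i\<in>I jt. Q (fst jt) i X"])
    show "prob {X. \<exists>i\<in>I jt. Q (fst jt) i X} \<le> exp (- 4 * L)"
      if "jt \<in> {..2 * d} \<times> {1..n}" for jt
      using inner[of "fst jt" "snd jt"] that by auto
    fix X assume "X \<in> {X. \<not> star_sparse n (edges_of X) p d \<theta> \<mu>}"
    then obtain j T \<F> where *: "j \<le> 2 * d" "T \<subseteq> {..<n}" "T \<noteq> {}" "real (card T) \<le> \<mu>" "disjoint \<F>"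
      "card \<F> \<le> card T" "\<forall>F\<in>\<F>. F \<subseteq> {..<n} \<and> card F = j \<and> F \<inter> T = {}"
      "\<not> (\<Sum>F\<in>\<F>. real (card (joined X F \<inter> T))) < \<theta> * p ^ j * card T"
      unfolding star_sparse_def mem_Collect_eq not_all not_imp by (elim exE conjE) (rule that; assumption)
    have finT: "finite T" using *(2) finite_subset by blast
    then have "1 \<le> card T" using *(3) by (simp add: Suc_leI card_gt_0_iff)
    moreover have "card T \<le> n" using card_mono[OF _ *(2)] by simp
    moreover have "(T, \<F>) \<in> I (j, card T)" using * by (simp add: I_def)
    moreover have "Q j (T, \<F>) X" using *(8) by (simp add: Q_def)
    ultimately show "\<exists>jt\<in>{..2 * d} \<times> {1..n}. \<exists>i\<in>I jt. Q (fst jt) i X"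
      using *(1) by (intro bexI[of _ "(j, card T)"] bexI[of _ "(T, \<F>)"]) auto
  qed simp
  then have "prob {X. \<not> star_sparse n (edges_of X) p d \<theta> \<mu>}
      \<le> card ({..2 * d} \<times> {1..n}) * exp (- (4 * L))" by simp
  then show ?thesis
  proof (rule prob_le_inverse[where x = "L + L"])
    have "real (card ({..2 * d} \<times> {1..n})) = real (2 * d + 1) * real n"
      by (simp add: card_cartesian_product algebra_simps)
    also have "\<dots> \<le> real (n + 1) * real (n + 1)" using n(2) by (intro mult_mono) auto
    also have "\<dots> = exp L * exp L" unfolding n_plus_1_eq[symmetric] by (simp add: add.commute)
    finally show "real (card ({..2 * d} \<times> {1..n})) \<le> exp (L + L)" by (simp only: exp_add)
  qed (use L_nonneg in simp)
qed

end

section \<open>Choice of the parameters\<close>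

text \<open>\<open>c * n\<close> is the room that may be wasted: blocks, interval surpluses and
  \<open>\<mu>\<close> get at most a quarter each. \<open>w\<close> is the size of
  \<open>W0\<close>. The conditions on \<open>j\<close> cover all degrees up to
  \<open>2 * d\<close>, since the common degree of the last batch depends on the guest
  graph.\<close>

definition admissible ::
    "nat \<Rightarrow> nat \<Rightarrow> nat \<Rightarrow> real \<Rightarrow> nat \<Rightarrow> nat \<Rightarrow> real \<Rightarrow> nat \<Rightarrow> nat \<Rightarrow> nat \<Rightarrow> nat \<Rightarrow> nat \<Rightarrow> real \<Rightarrow> real \<Rightarrow> bool" where
  "admissible d k \<Delta> c \<Lambda> n p a m h K w \<mu> \<theta> \<longleftrightarrow>
     1 \<le> n \<and> 2 * d \<le> n \<and> colours \<Delta> \<le> n \<and> 0 < a \<and> 2 * k \<le> a \<and> 640 * m \<le> a \<and>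
     real (colours \<Delta> * a) \<le> c * n / 4 \<and> real (K * h) \<le> c * n / 4 \<and>
     0 < \<mu> \<and> \<mu> \<le> h \<and> \<mu> \<le> c * n / 4 \<and>
     (1 - 1 / real (2 * (2 * d + 1) * colours \<Delta>)) ^ K * n \<le> m \<and>
     (\<forall>j\<le>2 * d. 2 * (2 * d + 1) * (j * w) \<le> m) \<and> w \<le> c * n \<and>
     32 * ln (real (colours \<Delta> * (n + 1) ^ k + n)) \<le> p ^ k * a \<and>
     8 * (real k + 2) * ln (real n + 1) \<le> p ^ k * a \<and>
     real n + ((real d + 1) * real m + 2) * ln (real n + 1) \<le> p ^ (d + k) * m * a / 4 \<and>
     (2 * real d + real \<Lambda> + 6) * ln (real n + 1) \<le> p ^ (2 * d) * \<mu> \<and>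
     4 * \<mu> \<le> \<theta> \<and> (2 * real d + 6) * ln (real n + 1) \<le> p ^ (2 * d) * \<theta> / 2 \<and>
     (\<forall>j\<le>2 * d. \<theta> * p ^ j \<le> w * (p / 64) ^ j / 2 - ln (real (colours \<Delta> * (n + 1) ^ k + n))) \<and>
     1 \<le> \<Lambda> \<and> n \<le> \<Lambda> * (c * n / 4)"

lemma nat_floor_half:
  fixes x :: real
  assumes "2 \<le> x"
  shows "x / 2 \<le> nat \<lfloor>x\<rfloor>" "nat \<lfloor>x\<rfloor> \<le> x"
  using assms by linarith+

text \<open>The ratios to n are fixed one after the other: \<open>\<alpha>\<close> for a block,
  \<open>\<delta>\<close> for the core, \<open>\<epsilon>\<close> for \<open>W0\<close>,
  \<open>b\<close> for \<open>\<theta>\<close>, \<open>\<eta>\<close> for \<open>\<mu>\<close>. The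
  number \<open>K\<close> of rounds precedes \<open>\<eta>\<close>, as every round wastes an
  interval of length about \<open>\<mu>\<close>.\<close>

lemma admissible_exists:
  fixes c :: real
  assumes c: "0 < c" "c \<le> 1" and dk: "d \<le> k"
  shows "\<exists>C n0 \<Lambda>. 0 < (C::real) \<and> (\<forall>n\<ge>n0. \<forall>p::real. 0 < p \<longrightarrow> p \<le> 1 \<longrightarrow>
    C * ln (real n + 1) \<le> p ^ (d + k) * n \<longrightarrow>
    (\<exists>a m h K w \<mu> \<theta>. admissible d k \<Delta> c \<Lambda> n p a m h K w \<mu> \<theta>))"
proof -
  define r where "r = colours \<Delta>"
  \<comment> \<open>Together the \<open>r\<close> blocks occupy at most \<open>c * n / 4\<close>
    vertices.\<close>
  define \<alpha> where "\<alpha> = c / (4 * r)"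
  \<comment> \<open>\<open>1280 = 2 * 640\<close>, because rounding down guarantees only
    \<open>\<alpha> * n / 2 \<le> a\<close>.\<close>
  define \<delta> where "\<delta> = \<alpha> / 1280"
  define \<rho> where "\<rho> = 1 / real (2 * (2 * d + 1) * r)"
  \<comment> \<open>\<open>W0\<close> has at most \<open>2 * d * w\<close> neighbours, and
    \<open>4 * d * (2 * d + 1) \<le> 8 * (d + 1)\<^sup>2\<close>; the other factor 2 is for rounding
    in \<open>m\<close>.\<close>
  define \<epsilon> where "\<epsilon> = \<delta> / (16 * (d + 1)\<^sup>2)"
  \<comment> \<open>Makes \<open>w * (p / 64) ^ j / 2\<close> at least
    \<open>2 * \<theta> * p ^ j\<close>; one of the two copies pays for the logarithm.\<close>
  define b where "b = \<epsilon> / (8 * 64 ^ (2 * d))"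
  define \<Lambda> where "\<Lambda> = nat \<lceil>4 / c\<rceil>"
  have r: "1 \<le> r" by (simp add: r_def)
  have pos: "0 < \<alpha>" "0 < \<delta>" "0 < \<epsilon>" "0 < b"
    using c r by (simp_all add: \<alpha>_def \<delta>_def \<epsilon>_def b_def)
  have "1 * c \<le> (4 * r) * c" using c r by (intro mult_right_mono) auto
  then have alpha_le: "\<alpha> \<le> c" using r by (simp add: \<alpha>_def field_simps)
  have eps_le: "\<epsilon> \<le> c"
  proof -
    have "1 \<le> 16 * (1 + real d)\<^sup>2" by (simp add: power2_eq_square algebra_simps)
    then have "\<epsilon> \<le> \<delta> / 1" unfolding \<epsilon>_def using pos(2) by (intro divide_left_mono) (auto simp: add.commute)
    then show ?thesis using alpha_le pos(1) by (simp add: \<delta>_def)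
  qed
  have rho: "0 < \<rho>" "\<rho> \<le> 1"
  proof -
    have "1 \<le> 2 * (2 * d + 1) * r" using r by simp
    then have "1 \<le> real (2 * (2 * d + 1) * r)" by (rule real_of_nat_ge_one_iff[THEN iffD2])
    then show "0 < \<rho>" "\<rho> \<le> 1" unfolding \<rho>_def by (simp_all only: divide_le_eq_1 zero_less_divide_iff) auto
  qed
  obtain K where K: "(1 - \<rho>) ^ K < \<delta> / 2"
    using real_arch_pow_inv[of "\<delta> / 2" "1 - \<rho>"] pos rho by auto
  \<comment> \<open>The first bound lets the surplus of \<open>K\<close> intervals fit into
    \<open>c * n / 4\<close>, the second gives \<open>4 * \<mu> \<le> \<theta>\<close>.\<close>
  define \<eta> where "\<eta> = min (c / (8 * (real K + 1))) (b / 4)"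
  have eta: "0 < \<eta>" "\<eta> \<le> b / 4" "\<eta> \<le> c / (8 * (real K + 1))"
    unfolding \<eta>_def using pos c by (simp, intro min.cobounded2, intro min.cobounded1)
  have K_eta: "K * \<eta> \<le> c / 8"
  proof -
    have "K * \<eta> \<le> (real K + 1) * (c / (8 * (real K + 1)))"
      using eta by (intro mult_mono) auto
    also have "\<dots> = c / 8" by (simp add: field_simps)
    finally show ?thesis .
  qed
  have eta_c: "\<eta> \<le> c / 4"
  proof -
    have "c / (8 * (real K + 1)) \<le> c / 4" using c by (intro divide_left_mono) auto
    then show ?thesis using eta by linarith
  qed
  \<comment> \<open>One summand for each inequality that involves the density.\<close>
  define C where "C = 64 * (k + 2) / \<alpha> + 16 * (d + 4) / (\<delta> * \<alpha>) + (2 * d + \<Lambda> + 6) / \<eta> +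
    2 * (2 * d + 6) / b + (k + 2) / b + 1"
  have Cparts: "64 * (k + 2) / \<alpha> \<le> C" "16 * (d + 4) / (\<delta> * \<alpha>) \<le> C" "(2 * d + \<Lambda> + 6) / \<eta> \<le> C"
    "2 * (2 * d + 6) / b \<le> C" "(k + 2) / b \<le> C" "0 < C"
  proof -
    have "0 \<le> 64 * (k + 2) / \<alpha>" "0 \<le> 16 * (d + 4) / (\<delta> * \<alpha>)" "0 \<le> (2 * d + \<Lambda> + 6) / \<eta>"
      "0 \<le> 2 * (2 * d + 6) / b" "0 \<le> (k + 2) / b"
      using pos eta(1) by auto
    then show "64 * (k + 2) / \<alpha> \<le> C" "16 * (d + 4) / (\<delta> * \<alpha>) \<le> C" "(2 * d + \<Lambda> + 6) / \<eta> \<le> C"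
      "2 * (2 * d + 6) / b \<le> C" "(k + 2) / b \<le> C" "0 < C"
      unfolding C_def by linarith+
  qed
  have C: "64 * (k + 2) \<le> \<alpha> * C" "16 * (d + 4) \<le> \<delta> * \<alpha> * C" "2 * d + \<Lambda> + 6 \<le> \<eta> * C"
    "2 * (2 * d + 6) \<le> b * C" "k + 2 \<le> b * C"
    using Cparts(1-5) pos eta(1) by (simp_all add: pos_divide_le_eq mult.commute)
  define n0 where "n0 = nat \<lceil>4 * (k + 1) / \<alpha> + 4 / \<delta> + 2 / \<epsilon> + r + 2 * d + 8 * K / c + 3\<rceil>"
  have main: "\<exists>a m h K w \<mu> \<theta>. admissible d k \<Delta> c \<Lambda> n p a m h K w \<mu> \<theta>"
    if n: "n0 \<le> n" and p: "0 < p" "p \<le> 1" and big: "C * ln (real n + 1) \<le> p ^ (d + k) * n"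
    for n :: nat and p :: real
  proof -
    define l where "l = ln (real n + 1)"
    have "4 * (k + 1) / \<alpha> + 4 / \<delta> + 2 / \<epsilon> + r + 2 * d + 8 * K / c + 3 \<le> n"
      using n unfolding n0_def by linarith
    moreover have "0 \<le> 4 * (k + 1) / \<alpha>" "0 \<le> 4 / \<delta>" "0 \<le> 2 / \<epsilon>" "0 \<le> 8 * K / c"
      using pos c by auto
    ultimately have parts: "4 * (k + 1) / \<alpha> \<le> n" "4 / \<delta> \<le> n" "2 / \<epsilon> \<le> n" "8 * K / c \<le> n"
      "real r \<le> n" "2 * real d \<le> n" "3 \<le> real n"
      by linarith+
    then have nn: "4 * (k + 1) \<le> \<alpha> * n" "4 \<le> \<delta> * n" "2 \<le> \<epsilon> * n" "8 * K \<le> c * n"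
      using pos c by (simp_all add: pos_divide_le_eq mult.commute)
    have rn: "r \<le> n" "2 * d \<le> n" "3 \<le> n" using parts by linarith+
    have l1: "1 \<le> l"
    proof -
      have "exp 1 \<le> real n + 1" using exp_le parts(7) by linarith
      then show ?thesis unfolding l_def by (simp add: ln_ge_iff)
    qed
    define a where "a = nat \<lfloor>\<alpha> * n\<rfloor>"
    define m where "m = nat \<lfloor>\<delta> * n\<rfloor>"
    define w where "w = nat \<lfloor>\<epsilon> * n\<rfloor>"
    define \<mu> where "\<mu> = \<eta> * n"
    define \<theta> where "\<theta> = b * n"
    define h where "h = nat \<lceil>\<mu>\<rceil>"
    have two: "2 \<le> \<alpha> * n" "2 \<le> \<delta> * n" using nn(1,2) by auto
    have a: "\<alpha> * n / 2 \<le> a" "a \<le> \<alpha> * n" unfolding a_def by (rule nat_floor_half[OF two(1)])+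
    have m: "\<delta> * n / 2 \<le> m" "m \<le> \<delta> * n" unfolding m_def by (rule nat_floor_half[OF two(2)])+
    have w: "\<epsilon> * n / 2 \<le> w" "w \<le> \<epsilon> * n" unfolding w_def by (rule nat_floor_half[OF nn(3)])+
    have mu: "0 < \<mu>" using eta(1) rn by (simp add: \<mu>_def)
    have h: "\<mu> \<le> h" "h \<le> \<mu> + 1" unfolding h_def using mu by linarith+
    have pk: "C * l \<le> p ^ j * n" if "j \<le> d + k" for j
    proof -
      have "p ^ (d + k) * n \<le> p ^ j * n"
        using that p by (intro mult_right_mono power_decreasing) auto
      then show ?thesis using big by (simp add: l_def)
    qed
    have ln_le: "ln (real (r * (n + 1) ^ k + n)) \<le> (k + 2) * l"
    proof -
      have "r * (n + 1) ^ k + n \<le> n * (n + 1) ^ k + n * (n + 1) ^ k"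
        using rn(1) by (intro add_mono mult_right_mono) auto
      also have "\<dots> = (2 * n) * (n + 1) ^ k" by simp
      also have "\<dots> \<le> (n + 1)\<^sup>2 * (n + 1) ^ k"
        by (intro mult_right_mono) (auto simp: power2_eq_square)
      also have "\<dots> = (n + 1) ^ (k + 2)" by (simp only: power_add mult.commute)
      finally have "real (r * (n + 1) ^ k + n) \<le> real ((n + 1) ^ (k + 2))" by (rule of_nat_mono)
      then have "ln (real (r * (n + 1) ^ k + n)) \<le> ln (real ((n + 1) ^ (k + 2)))"
        using r rn by (subst ln_le_cancel_iff) (auto simp: add_pos_nonneg simp del: of_nat_power of_nat_add)
      also have "\<dots> = (k + 2) * l" unfolding l_def of_nat_power by (subst ln_realpow) (auto simp: add.commute)
      finally show ?thesis .
    qed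
    have pka: "32 * ((k + 2) * l) \<le> p ^ k * a"
    proof -
      have "64 * (k + 2) * l \<le> \<alpha> * C * l" using C(1) l1 by (intro mult_right_mono) auto
      also have "\<dots> \<le> \<alpha> * (p ^ k * n)" using pk[of k] pos by (simp add: mult.assoc)
      also have "\<dots> = 2 * (p ^ k * (\<alpha> * n / 2))" by simp
      also have "\<dots> \<le> 2 * (p ^ k * a)" using a(1) p by (intro mult_left_mono) auto
      finally show ?thesis by (simp add: algebra_simps)
    qed
    have spread: "n + ((d + 1) * m + 2) * l \<le> p ^ (d + k) * m * a / 4"
    proof -
      have "m \<le> n"
      proof -
        have "\<delta> * n \<le> 1 * real n" using alpha_le c pos by (intro mult_right_mono) (auto simp: \<delta>_def)
        then show ?thesis using m(2) by linarith
      qed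
      then have "real d * real m \<le> real d * real n" "m \<le> n" by (auto intro: mult_left_mono)
      then have "n + ((d + 1) * m + 2) * l \<le> n * l + ((d + 1) * n + 2 * n) * l"
        using l1 rn by (intro add_mono mult_right_mono) (auto simp: mult_le_cancel_left1 algebra_simps)
      also have "\<dots> = (d + 4) * l * n" by (simp add: algebra_simps)
      also have "\<dots> \<le> (\<delta> * \<alpha> * C / 16) * l * n" using C(2) l1 by (intro mult_right_mono) auto
      also have "\<dots> = (\<delta> * n / 2) * ((\<alpha> / 2) * (C * l)) / 4" by simp
      also have "\<dots> \<le> (\<delta> * n / 2) * ((\<alpha> / 2) * (p ^ (d + k) * n)) / 4"
        using pk[of "d + k"] pos by (intro divide_right_mono mult_left_mono) auto
      also have "\<dots> = p ^ (d + k) * ((\<delta> * n / 2) * (\<alpha> * n / 2)) / 4" by simp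
      also have "\<dots> \<le> p ^ (d + k) * (real m * real a) / 4"
        using m(1) a(1) p pos by (intro divide_right_mono mult_left_mono mult_mono) auto
      finally show ?thesis by (simp add: mult.assoc)
    qed
    have p2d: "C * l \<le> p ^ j * n" if "j \<le> 2 * d" for j
      using pk[of j] that dk by simp
    have hall: "(2 * d + \<Lambda> + 6) * l \<le> p ^ (2 * d) * \<mu>"
    proof -
      have "(2 * d + \<Lambda> + 6) * l \<le> \<eta> * C * l" using C(3) l1 by (intro mult_right_mono) auto
      also have "\<dots> \<le> \<eta> * (p ^ (2 * d) * n)" using p2d[of "2 * d"] eta by (simp add: mult.assoc)
      finally show ?thesis by (simp add: \<mu>_def mult_ac)
    qed
    have sparse: "(2 * d + 6) * l \<le> p ^ (2 * d) * \<theta> / 2"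
    proof -
      have "2 * (2 * d + 6) * l \<le> b * C * l" using C(4) l1 by (intro mult_right_mono) auto
      also have "\<dots> \<le> b * (p ^ (2 * d) * n)" using p2d[of "2 * d"] pos by (simp add: mult.assoc)
      finally show ?thesis by (simp add: \<theta>_def mult_ac)
    qed
    have near: "\<theta> * p ^ j \<le> w * (p / 64) ^ j / 2 - ln (real (r * (n + 1) ^ k + n))" if j: "j \<le> 2 * d" for j
    proof -
      have "(64::real) ^ j \<le> 64 ^ (2 * d)" using j by (intro power_increasing) auto
      then have "p ^ j / 64 ^ (2 * d) \<le> (p / 64) ^ j"
        using p unfolding power_divide by (intro divide_left_mono) auto
      then have "(\<epsilon> * n / 2) * (p ^ j / 64 ^ (2 * d)) / 2 \<le> w * (p / 64) ^ j / 2"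
        using w(1) p by (intro divide_right_mono mult_mono) auto
      moreover have "(\<epsilon> * n / 2) * (p ^ j / 64 ^ (2 * d)) / 2 = 2 * (\<theta> * p ^ j)"
        by (simp add: \<theta>_def b_def)
      moreover have "(k + 2) * l \<le> \<theta> * p ^ j"
      proof -
        have "(k + 2) * l \<le> b * C * l" using C(5) l1 by (intro mult_right_mono) auto
        also have "\<dots> \<le> b * (p ^ j * n)" using p2d[OF j] pos by (simp add: mult.assoc)
        finally show ?thesis by (simp add: \<theta>_def mult_ac)
      qed
      ultimately show ?thesis using ln_le by linarith
    qed
    have "admissible d k \<Delta> c \<Lambda> n p a m h K w \<mu> \<theta>"
      unfolding admissible_def r_def[symmetric] l_def[symmetric] \<rho>_def[symmetric]
    proof (intro conjI allI impI)
      show "1 \<le> n" "2 * d \<le> n" "r \<le> n" using rn by auto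
      have "2 * real k + 2 \<le> a" using a(1) nn(1) by simp
      then show "0 < a" "2 * k \<le> a" by linarith+
      have "640 * real m \<le> 640 * (\<delta> * n)" using m(2) by simp
      also have "\<dots> \<le> a" using a(1) by (simp add: \<delta>_def)
      finally show "640 * m \<le> a" by linarith
      have "real (r * a) \<le> r * (\<alpha> * n)" using a(2) by (simp add: mult_left_mono)
      also have "\<dots> = c * n / 4" using r by (simp add: \<alpha>_def)
      finally show "real (r * a) \<le> c * n / 4" .
      have "real (K * h) \<le> K * (\<mu> + 1)" using h(2) by (simp add: mult_left_mono)
      also have "\<dots> = K * \<eta> * n + K" by (simp add: \<mu>_def algebra_simps)
      also have "\<dots> \<le> c / 8 * n + c * n / 8" using K_eta nn(4) by (intro add_mono mult_right_mono) auto
      finally show "real (K * h) \<le> c * n / 4" by simp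
      show "0 < \<mu>" "\<mu> \<le> h" using mu h by auto
      show "\<mu> \<le> c * n / 4" using mult_right_mono[OF eta_c, of "real n"] by (simp add: \<mu>_def)
      have "(1 - \<rho>) ^ K * n \<le> \<delta> / 2 * n" using K by (intro mult_right_mono) auto
      then show "(1 - \<rho>) ^ K * n \<le> m" using m(1) by simp
      show "2 * (2 * d + 1) * (j * w) \<le> m" if j: "j \<le> 2 * d" for j
      proof -
        have "2 * (2 * d + 1) * (j * w) \<le> 2 * (2 * d + 1) * (2 * d * w)"
          using j by (intro mult_le_mono2 mult_le_mono1)
        also have "\<dots> \<le> 8 * (d + 1)\<^sup>2 * w" by (simp add: power2_eq_square algebra_simps)
        finally have "real (2 * (2 * d + 1) * (j * w)) \<le> real (8 * (d + 1)\<^sup>2 * w)" by (rule of_nat_mono)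
        also have "\<dots> = 8 * (real d + 1)\<^sup>2 * w" by (simp add: add.commute)
        also have "\<dots> \<le> 8 * (real d + 1)\<^sup>2 * (\<epsilon> * n)" using w(2) by (intro mult_left_mono) auto
        also have "\<dots> = \<delta> * n / 2"
        proof -
          have "(real d + 1)\<^sup>2 \<noteq> 0" by simp
          then show ?thesis by (simp add: \<epsilon>_def add.commute)
        qed
        also have "\<dots> \<le> m" by (rule m(1))
        finally show ?thesis by (simp only: of_nat_le_iff)
      qed
      show "w \<le> c * n" using w(2) mult_right_mono[OF eps_le, of "real n"] by simp
      show "32 * ln (real (r * (n + 1) ^ k + n)) \<le> p ^ k * a" using ln_le pka by linarith
      show "8 * (real k + 2) * l \<le> p ^ k * a"
      proof -
        have "0 \<le> (real k + 2) * l" using l1 by simp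
        then show ?thesis using pka by (simp add: algebra_simps)
      qed
      show "real n + ((real d + 1) * real m + 2) * l \<le> p ^ (d + k) * m * a / 4" using spread by (simp add: algebra_simps)
      show "(2 * real d + real \<Lambda> + 6) * l \<le> p ^ (2 * d) * \<mu>" using hall by simp
      show "4 * \<mu> \<le> \<theta>" using mult_right_mono[OF eta(2), of "real n"] by (simp add: \<mu>_def \<theta>_def)
      show "(2 * real d + 6) * l \<le> p ^ (2 * d) * \<theta> / 2" using sparse by simp
      show "\<theta> * p ^ j \<le> w * (p / 64) ^ j / 2 - ln (real (r * (n + 1) ^ k + n))" if "j \<le> 2 * d" for j
        using near[OF that] .
      have "4 \<le> 4 / c" using c by (simp add: field_simps)
      moreover have "4 / c \<le> \<Lambda>" unfolding \<Lambda>_def by linarith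
      ultimately show "1 \<le> \<Lambda>" by linarith
      have "real n = 4 / c * (c * n / 4)" using c by simp
      also have "\<dots> \<le> \<Lambda> * (c * n / 4)" using \<open>4 / c \<le> \<Lambda>\<close> c by (intro mult_right_mono) auto
      finally show "n \<le> \<Lambda> * (c * n / 4)" .
    qed
    then show ?thesis by blast
  qed
  show ?thesis using main Cparts(6) by (intro exI[of _ C] exI[of _ n0] exI[of _ \<Lambda>]) blast
qed

section \<open>Universality\<close>

text \<open>\<open>1 / real q\<close> is the proportion of vertices that
  \<open>large_regular_indep2\<close> provides for the last batch; it serves as \<open>c\<close> in
  the spanning case.\<close>

lemma spanning_constant_bounds:
  fixes d \<Delta> q :: nat
  defines "q \<equiv> (2 * d + 1)\<^sup>2 * colours \<Delta>"
  shows "0 < 1 / real q" "1 / real q \<le> 1" "1 / real q * real q = 1"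
proof -
  have "0 < (2 * d + 1)\<^sup>2" "0 < colours \<Delta>" by simp_all
  then have "0 < q" unfolding q_def by (rule mult_pos_pos)
  then show "0 < 1 / real q" "1 / real q \<le> 1" "1 / real q * real q = 1" by simp_all
qed

definition pseudorandom ::
    "nat \<Rightarrow> nat set set \<Rightarrow> real \<Rightarrow> nat \<Rightarrow> nat \<Rightarrow> nat \<Rightarrow> nat \<Rightarrow> nat \<Rightarrow> real \<Rightarrow> real \<Rightarrow> real \<Rightarrow> bool" where
  "pseudorandom n E p d k r a m \<Lambda> \<mu> \<theta> \<longleftrightarrow> common_lower n E p k r a \<and> common_upper n E p d r a \<and>
     star_spread n E p d k r a m \<and> star_hall n E d \<Lambda> \<mu> \<and> star_sparse n E p d \<theta> \<mu>"

context degenerate_graph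
begin

text \<open>\<open>almost_embedding\<close> with nothing left out. Blocks and surpluses waste at
  most \<open>c * n / 2\<close> host vertices, fewer than the \<open>c * n\<close> that are
  spare.\<close>

lemma embeds_almost_all:
  assumes adm: "admissible d k \<Delta> c \<Lambda> n p a m h K w \<mu> \<theta>" and p: "0 < p" "p \<le> 1" and dk: "d \<le> k"
    and random: "pseudorandom n E p d k (colours \<Delta>) a m \<Lambda> \<mu> \<theta>"
    and V: "real (card V) \<le> (1 - c) * n" and c: "0 < c"
  shows "\<exists>f. embeds E f V \<and> f ` V \<subseteq> {..<n}"
proof -
  let ?r = "colours \<Delta>"
  have V_le: "real (card V) \<le> n"
  proof -
    have "(1 - c) * n \<le> 1 * real n" using c by (intro mult_right_mono) auto
    then show ?thesis using V by simp
  qed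
  have le: "real (?r * a + card V + K * h) \<le> n"
  proof -
    have "real (?r * a) \<le> c * n / 4" "real (K * h) \<le> c * n / 4" using adm by (simp_all only: admissible_def)
    moreover have "(1 - c) * n = n - c * n" by (simp add: algebra_simps)
    moreover have "0 \<le> c * n" using c by simp
    ultimately show ?thesis using V unfolding of_nat_add by linarith
  qed
  have K: "(1 - peel_rate) ^ K * card V \<le> m"
  proof -
    have "(1 - peel_rate) ^ K * card V \<le> (1 - peel_rate) ^ K * n"
      using V_le peel_rate_bounds by (intro mult_left_mono) auto
    also have "\<dots> \<le> m" using adm by (simp only: admissible_def peel_rate_def peel_factor_def)
    finally show ?thesis .
  qed
  have "\<exists>g. embeds E g (V - {}) \<and> g ` (V - {}) \<subseteq> {..<?r * a + card (V - {}) + K * h} \<and>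
    (\<forall>y<n. card ({} :: 'a set) * (p / 64) ^ 0 / 2 - ln (real (?r * (n + 1) ^ k + n)) \<le> card {w\<in>({} :: 'a set). g ` adj w \<subseteq> com n E {y}})"
  proof (rule almost_embedding[OF p])
    show "1 \<le> real \<Lambda>" using adm by (simp add: admissible_def)
    show "640 * m \<le> a" "0 < a" "0 < \<mu>" "\<mu> \<le> real h"
      "32 * ln (real (?r * (n + 1) ^ k + n)) \<le> p ^ k * a"
      using adm by (simp_all only: admissible_def)
    show "?r * a + card (V - {}) + K * h \<le> n" using le by (simp only: of_nat_le_iff Diff_empty)
  qed (use dk random K in \<open>auto simp: indep2_def pseudorandom_def\<close>)
  then obtain g where g: "embeds E g V" "g ` V \<subseteq> {..<?r * a + card V + K * h}" by auto
  have "?r * a + card V + K * h \<le> n" using le by (simp only: of_nat_le_iff)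
  then have "g ` V \<subseteq> {..<n}" using g(2) by fastforce
  then show ?thesis using g(1) by blast
qed

text \<open>One factor \<open>2 * d + 1\<close> is for low degree, one for the most frequent degree
  among \<open>0, ..., 2 * d\<close>, and \<open>colours \<Delta>\<close> for the colour class.
  Equal degrees let a single power of \<open>p\<close> govern all stars of the last
  matching.\<close>

lemma large_regular_indep2:
  "\<exists>W k0. W \<subseteq> V \<and> indep2 W \<and> k0 \<le> 2 * d \<and> (\<forall>v\<in>W. card (adj v) = k0) \<and>
    card V \<le> (2 * d + 1)\<^sup>2 * colours \<Delta> * card W"
proof -
  define A where "A = {v\<in>V. card (adj v \<inter> V) \<le> 2 * d}"
  define D where "D j = {v\<in>V. card (adj v) = j}" for j
  have finA: "finite A" using finite_V by (simp add: A_def)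
  have "adj v \<inter> V = adj v" if "v \<in> V" for v using adj_subset[OF that] by blast
  then have A_eq: "A = (\<Union>j\<in>{..2 * d}. D j)" by (auto simp: A_def D_def)
  have "\<exists>j\<le>2 * d. card A \<le> (2 * d + 1) * card (D j)"
  proof (rule ccontr)
    assume "\<not> ?thesis"
    then have "(\<Sum>j\<in>{..2 * d}. (2 * d + 1) * card (D j)) < (\<Sum>j\<in>{..2 * d}. card A)"
      by (intro sum_strict_mono) auto
    moreover have "card A \<le> (\<Sum>j\<in>{..2 * d}. card (D j))"
      unfolding A_eq by (rule card_UN_le) simp
    then have "(2 * d + 1) * card A \<le> (2 * d + 1) * (\<Sum>j\<in>{..2 * d}. card (D j))" by (rule mult_le_mono2)
    ultimately show False by (simp add: sum_distrib_left)
  qed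
  then obtain j where j: "j \<le> 2 * d" "card A \<le> (2 * d + 1) * card (D j)" by blast
  have "D j \<subseteq> V" by (auto simp: D_def)
  then obtain W where W: "W \<subseteq> D j" "indep2 W" "card (D j) \<le> colours \<Delta> * card W"
    using large_indep2 by blast
  have "card V \<le> (2 * d + 1) * card A" unfolding A_def by (rule many_low_degree) simp
  also have "\<dots> \<le> (2 * d + 1) * ((2 * d + 1) * card (D j))" using j(2) by (rule mult_le_mono2)
  also have "\<dots> \<le> (2 * d + 1) * ((2 * d + 1) * (colours \<Delta> * card W))"
    using W(3) by (intro mult_le_mono2)
  finally have "card V \<le> (2 * d + 1)\<^sup>2 * colours \<Delta> * card W"
    by (simp only: power2_eq_square mult.assoc)
  then show ?thesis using W(1,2) j(1) by (intro exI[of _ W] exI[of _ j]) (auto simp: D_def)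
qed

text \<open>Leaving out \<open>W\<close> creates the spare room of at least \<open>c * n\<close>
  vertices. At most half of it is wasted before the last matching, and after subtracting
  \<open>\<mu>\<close> a quarter remains, which explains the condition on
  \<open>\<Lambda>\<close>.\<close>

lemma embeds_spanning:
  assumes adm: "admissible d (Suc d) \<Delta> c \<Lambda> n p a m h K w \<mu> \<theta>" and p: "0 < p" "p \<le> 1"
    and random: "pseudorandom n E p d (Suc d) (colours \<Delta>) a m \<Lambda> \<mu> \<theta>"
    and V: "card V = n" and c: "c = 1 / real ((2 * d + 1)\<^sup>2 * colours \<Delta>)"
  shows "\<exists>f. embeds E f V \<and> f ` V \<subseteq> {..<n}"
proof -
  let ?r = "colours \<Delta>"
  have lower: "common_lower n E p (Suc d) ?r a" and upper: "common_upper n E p d ?r a"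
    and spread: "star_spread n E p d (Suc d) ?r a m" and hall: "star_hall n E d \<Lambda> \<mu>"
    and sparse: "star_sparse n E p d \<theta> \<mu>"
    using random by (simp_all only: pseudorandom_def)
  obtain W k0 where W: "W \<subseteq> V" "indep2 W" "k0 \<le> 2 * d" "\<forall>v\<in>W. card (adj v) = k0"
    "card V \<le> (2 * d + 1)\<^sup>2 * ?r * card W"
    using large_regular_indep2 by (elim exE conjE) (rule that; assumption)
  have finW: "finite W" using W(1) finite_V finite_subset by blast
  have c_pos: "0 < c" unfolding c by (rule spanning_constant_bounds)
  have cW: "c * n \<le> card W"
  proof -
    have "real n \<le> real ((2 * d + 1)\<^sup>2 * ?r * card W)" using W(5) V by (simp only: of_nat_le_iff)
    also have "\<dots> = real ((2 * d + 1)\<^sup>2 * ?r) * card W" by (simp only: of_nat_mult)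
    finally have "c * n \<le> c * (real ((2 * d + 1)\<^sup>2 * ?r) * card W)"
      using c_pos by (intro mult_left_mono) auto
    also have "\<dots> = (c * real ((2 * d + 1)\<^sup>2 * ?r)) * card W" by (simp only: mult.assoc)
    also have "c * real ((2 * d + 1)\<^sup>2 * ?r) = 1" unfolding c by (rule spanning_constant_bounds)
    finally show ?thesis by simp
  qed
  have "real w \<le> c * n" using adm by (simp only: admissible_def)
  then have "w \<le> card W" using cW by linarith
  then obtain W0 where W0: "W0 \<subseteq> W" "card W0 = w" using finW by (meson obtain_subset_with_card_n)
  have cardVW: "card (V - W) + card W = n"
    using V W(1) finW finite_V card_mono[OF finite_V W(1)] by (simp add: card_Diff_subset)
  have bounds: "real (?r * a) \<le> c * n / 4" "real (K * h) \<le> c * n / 4" "\<mu> \<le> c * n / 4"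
    using adm by (simp_all only: admissible_def)
  define b where "b = ?r * a + card (V - W) + K * h"
  have "real b + c * n / 2 \<le> n"
  proof -
    have "real b = real (?r * a) + real (card (V - W)) + real (K * h)" by (simp only: b_def of_nat_add)
    moreover have "real (card (V - W)) + real (card W) = n" using cardVW by (simp flip: of_nat_add)
    ultimately show ?thesis using bounds cW by linarith
  qed
  moreover have "0 \<le> c * n" using c_pos by simp
  ultimately have b: "b \<le> n" "c * n / 2 \<le> real (n - b)" by linarith+
  have K: "(1 - peel_rate) ^ K * card V \<le> m"
    unfolding V using adm by (simp only: admissible_def peel_rate_def peel_factor_def)
  have "\<exists>g. embeds E g (V - W) \<and> g ` (V - W) \<subseteq> {..<b} \<and>
    (\<forall>y<n. card W0 * (p / 64) ^ k0 / 2 - ln (real (?r * (n + 1) ^ Suc d + n)) \<le> card {w\<in>W0. g ` adj w \<subseteq> com n E {y}})"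
    unfolding b_def
  proof (rule almost_embedding[OF p])
    show "1 \<le> real \<Lambda>" using adm by (simp add: admissible_def)
    show "640 * m \<le> a" "0 < a" "0 < \<mu>" "\<mu> \<le> real h"
      "32 * ln (real (?r * (n + 1) ^ Suc d + n)) \<le> p ^ Suc d * a"
      using adm by (simp_all only: admissible_def)
    show "?r * a + card (V - W) + K * h \<le> n" using b(1) by (simp only: b_def)
    show "2 * (2 * d + 1) * (k0 * card W0) \<le> m" using adm W(3) W0(2) by (simp only: admissible_def)
    show "card (adj v) = k0" if "v \<in> W0" for v using that W0(1) W(4) by blast
  qed (fact lower upper spread hall K W(1,2) W0(1) refl le_SucI order_refl | simp)+
  then obtain g where g: "embeds E g (V - W)" "g ` (V - W) \<subseteq> {..<b}"
    "\<forall>y<n. card W0 * (p / 64) ^ k0 / 2 - ln (real (?r * (n + 1) ^ Suc d + n)) \<le> card {w\<in>W0. g ` adj w \<subseteq> com n E {y}}"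
    by (elim exE conjE) (rule that; assumption)
  show ?thesis
  proof (rule spanning_step[OF hall _ sparse W(1,2) _ W(3) W0(1) V b(1) g(1,2)])
    show "0 < \<mu>" "1 \<le> real \<Lambda>" using adm by (simp_all add: admissible_def)
    show "card (adj v) = k0" if "v \<in> W" for v using W(4) that by blast
    show "\<theta> * p ^ k0 \<le> card {w\<in>W0. g ` adj w \<subseteq> com n E {y}}" if "y < n" for y
    proof -
      have "\<theta> * p ^ k0 \<le> w * (p / 64) ^ k0 / 2 - ln (real (?r * (n + 1) ^ Suc d + n))"
        using adm W(3) unfolding admissible_def by blast
      then show ?thesis using g(3)[rule_format, OF that] unfolding W0(2) by linarith
    qed
    have "real n \<le> \<Lambda> * (c * n / 4)" using adm by (simp only: admissible_def)
    also have "\<dots> \<le> \<Lambda> * (real (n - b) - \<mu>)" using b(2) bounds(3) by (intro mult_left_mono) auto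
    finally show "real n \<le> \<Lambda> * (real (n - b) - \<mu>)" .
  qed
qed

end

context random_edges
begin

lemma prob_good:
  fixes \<Lambda> :: nat
  assumes adm: "admissible d k \<Delta> c \<Lambda> n p a m h K w \<mu> \<theta>" and p: "0 < p" and dk: "d \<le> k" and c: "c \<le> 1"
  shows "1 - 5 / (real n + 1) \<le> prob {X.
    pseudorandom n (edges_of X) p d k (colours \<Delta>) a m \<Lambda> \<mu> \<theta>}"
proof -
  define r where "r = colours \<Delta>"
  note adm' = adm[unfolded admissible_def r_def[symmetric] L_def[symmetric]]
  have r: "r \<le> n + 1" using adm' by simp
  have n: "1 \<le> n" "2 * d + 1 \<le> n + 1" using adm' by simp_all
  have "real (r * a) \<le> c * n / 4" using adm' by (simp only:)
  also have "\<dots> \<le> 1 * real n" using mult_right_mono[OF c, of "real n"] by simp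
  finally have ra: "r * a \<le> n" by (simp only: of_nat_le_iff mult_1)
  have theta: "4 * \<mu> \<le> \<theta>" "0 < \<mu>" using adm' by simp_all
  let ?B1 = "{X. \<not> common_lower n (edges_of X) p k r a}"
  let ?B2 = "{X. \<not> common_upper n (edges_of X) p d r a}"
  let ?B3 = "{X. \<not> star_spread n (edges_of X) p d k r a m}"
  let ?B4 = "{X. \<not> star_hall n (edges_of X) d \<Lambda> \<mu>}"
  let ?B5 = "{X. \<not> star_sparse n (edges_of X) p d \<theta> \<mu>}"
  let ?G = "{X. common_lower n (edges_of X) p k r a \<and> common_upper n (edges_of X) p d r a \<and>
    star_spread n (edges_of X) p d k r a m \<and> star_hall n (edges_of X) d \<Lambda> \<mu> \<and>
    star_sparse n (edges_of X) p d \<theta> \<mu>}"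
  let ?P = "prob"
  have 1: "?P ?B1 \<le> 1 / (real n + 1)"
    by (rule prob_not_lower[OF p r ra]) (use adm' in simp_all)
  have 2: "?P ?B2 \<le> 1 / (real n + 1)"
    by (rule prob_not_upper[OF p r ra dk]) (use adm' in simp)
  have 3: "?P ?B3 \<le> 1 / (real n + 1)"
    by (rule prob_not_spread[OF p n(1) r ra]) (use adm' in simp)
  have 4: "?P ?B4 \<le> 1 / (real n + 1)"
    by (rule prob_not_hall[OF n(1) theta(2)]) (use adm' in simp)
  have 5: "?P ?B5 \<le> 1 / (real n + 1)"
    by (rule prob_not_sparse[OF n p theta(1)]) (use adm' theta in simp_all)
  have "1 - ?P ?G = ?P (- ?G)"
    by (simp add: measure_pmf.prob_compl[of ?G edge_pmf, simplified] Compl_eq_Diff_UNIV)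
  also have "- ?G = ?B1 \<union> (?B2 \<union> (?B3 \<union> (?B4 \<union> ?B5)))" by auto
  also have "?P \<dots> \<le> ?P ?B1 + (?P ?B2 + (?P ?B3 + (?P ?B4 + ?P ?B5)))"
    by (intro order_trans[OF measure_Un_le] add_mono order_refl) simp_all
  also have "\<dots> \<le> 5 / (real n + 1)" using 1 2 3 4 5 by simp
  finally show ?thesis by (simp add: r_def pseudorandom_def)
qed

lemma prob_gnp: "measure_pmf.prob (gnp n p) {G. Q G} = prob {X. Q \<lparr>verts = {..<n}, edges = edges_of X\<rparr>}"
  unfolding gnp_def edge_pmf_def edges_of_def by (simp add: vimage_def)

end

section \<open>From the graph class to neighbourhood functions\<close>

lemma card_incident_edges:
  assumes "\<And>e. e \<in> F \<Longrightarrow> card e = 2"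
  shows "card {e \<in> F. v \<in> e} = card {u. {v, u} \<in> F}"
proof -
  have "bij_betw (\<lambda>u. {v, u}) {u. {v, u} \<in> F} {e \<in> F. v \<in> e}"
  proof (rule bij_betwI')
    show "{v, x} = {v, y} \<longleftrightarrow> x = y" for x y by (auto simp: doubleton_eq_iff)
    show "{v, x} \<in> {e \<in> F. v \<in> e}" if "x \<in> {u. {v, u} \<in> F}" for x using that by simp
    fix e assume e: "e \<in> {e \<in> F. v \<in> e}"
    then obtain x y where "e = {x, y}" using assms[of e] by (auto simp: card_2_iff)
    then have "e = {v, if x = v then y else x}" using e by auto
    then show "\<exists>x\<in>{u. {v, u} \<in> F}. e = {v, x}" using e by (intro bexI[of _ "if x = v then y else x"]) auto
  qed
  then show ?thesis by (simp add: bij_betw_same_card)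
qed

text \<open>The least value is attained once some value works, and the number of edges bounds every
  degree.\<close>

lemma degenerate_degeneracy:
  assumes "finite_simple_graph H"
  shows "degenerate (degeneracy H) H"
  unfolding degeneracy_def
proof (rule LeastI)
  have fin: "finite (verts H)" "edges H \<subseteq> [verts H]\<^bsup>2\<^esup>" using assms by (auto simp: finite_simple_graph_def)
  then have finE: "finite (edges H)" by (meson finite_imp_finite_nsets finite_subset)
  show "degenerate (card (edges H)) H"
    unfolding degenerate_def
  proof (intro allI impI)
    fix S assume S: "S \<subseteq> verts H" "S \<noteq> {}"
    then obtain v where v: "v \<in> S" by blast
    have "min_degree (induced H S) \<le> degree (induced H S) v"
      unfolding min_degree_def using v finite_subset[OF S(1) fin(1)] by (intro Min_le) (auto simp: induced_def)
    also have "\<dots> \<le> card (edges H)"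
      unfolding degree_def using finE by (intro card_mono) (auto simp: induced_def)
    finally show "min_degree (induced H S) \<le> card (edges H)" .
  qed
qed

lemma graph_class_degenerate_graph:
  assumes "H \<in> graph_class N d \<Delta>"
  shows "degenerate_graph (verts H) (\<lambda>v. {u. {v, u} \<in> edges H}) d \<Delta>"
proof -
  have H: "finite_simple_graph H" "max_degree H \<le> \<Delta>" "degeneracy H \<le> d"
    using assms by (auto simp: graph_class_def)
  have fin: "finite (verts H)" and sub: "edges H \<subseteq> [verts H]\<^bsup>2\<^esup>"
    using H(1) by (auto simp: finite_simple_graph_def)
  have card2: "card e = 2" if "e \<in> edges H" for e using sub that by (auto simp: nsets_def)
  show ?thesis
  proof
    show "finite (verts H)" by (rule fin)
    show "{u. {v, u} \<in> edges H} \<subseteq> verts H" for v using sub by auto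
    show "v \<in> {w. {u, w} \<in> edges H}" if "u \<in> {w. {v, w} \<in> edges H}" for u v
      using that by (simp add: insert_commute)
    show "v \<notin> {u. {v, u} \<in> edges H}" for v using card2[of "{v, v}"] by auto
    show "card {u. {v, u} \<in> edges H} \<le> \<Delta>" if v: "v \<in> verts H" for v
    proof -
      have "card {u. {v, u} \<in> edges H} = degree H v"
        unfolding degree_def using card_incident_edges[of "edges H" v] card2 by simp
      also have "\<dots> \<le> max_degree H" unfolding max_degree_def using v fin by (intro Max_ge) auto
      finally show ?thesis using H(2) by simp
    qed
    show "\<exists>v\<in>S. card ({u. {v, u} \<in> edges H} \<inter> S) \<le> d" if S: "S \<subseteq> verts H" "S \<noteq> {}" for S
    proof -
      have finS: "finite S" using S(1) fin finite_subset by blast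
      have "min_degree (induced H S) \<in> degree (induced H S) ` S"
        unfolding min_degree_def using finS S(2) Min_in[of "degree (induced H S) ` S"] by (simp add: induced_def)
      then obtain v where v: "v \<in> S" "min_degree (induced H S) = degree (induced H S) v" by blast
      have "degree (induced H S) v = card {u. {v, u} \<in> {e \<in> edges H. e \<subseteq> S}}"
        unfolding degree_def induced_def using card_incident_edges[of "{e \<in> edges H. e \<subseteq> S}" v] card2 by simp
      also have "{u. {v, u} \<in> {e \<in> edges H. e \<subseteq> S}} = {u. {v, u} \<in> edges H} \<inter> S" using v(1) by auto
      finally have "card ({u. {v, u} \<in> edges H} \<inter> S) = min_degree (induced H S)" using v(2) by simp
      also have "\<dots> \<le> degeneracy H"
        using degenerate_degeneracy[OF H(1)] S unfolding degenerate_def by blast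
      finally show ?thesis using H(3) v(1) by (intro bexI[of _ v]) auto
    qed
  qed
qed

lemma contains_copyI:
  assumes H: "H \<in> graph_class N d \<Delta>"
    and f: "degenerate_graph.embeds (\<lambda>v. {u. {v, u} \<in> edges H}) E f (verts H)" "f ` verts H \<subseteq> {..<n}"
  shows "contains_copy \<lparr>verts = {..<n}, edges = E\<rparr> H"
proof -
  interpret degenerate_graph "verts H" "\<lambda>v. {u. {v, u} \<in> edges H}" d \<Delta>
    by (rule graph_class_degenerate_graph[OF H])
  have "f ` e \<in> E" if e: "e \<in> edges H" for e
  proof -
    have "e \<in> [verts H]\<^bsup>2\<^esup>" using H e by (auto simp: graph_class_def finite_simple_graph_def)
    then obtain x y where xy: "e = {x, y}" "x \<in> verts H" "y \<in> verts H"
      by (rule nsets2_E)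
    then have "{f x, f y} \<in> E" using f(1) e unfolding embeds_def by auto
    then show ?thesis using xy(1) by simp
  qed
  then show ?thesis using f unfolding contains_copy_def embeds_def by auto
qed

section \<open>The density condition and the limit\<close>

lemma power_ge_of_powr:
  fixes C x p :: real
  assumes "1 \<le> C" "0 < x" "0 < e" "C * x powr (1 / real e) \<le> p"
  shows "0 < p" "C * x \<le> p ^ e"
proof -
  have pos: "0 < C * x powr (1 / real e)" using assms by simp
  then show "0 < p" using assms(4) by linarith
  \<comment> \<open>\<open>1 \<le> C\<close> allows \<open>C ^ e\<close> to be weakened to
    \<open>C\<close>, so the constant does not depend on a root.\<close>
  have "C ^ 1 \<le> C ^ e" using assms by (intro power_increasing) auto
  then have "C * x \<le> C ^ e * x" using assms(2) by (intro mult_right_mono) auto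
  also have "x = (x powr (1 / real e)) ^ e"
    using assms(2,3) by (simp add: powr_powr flip: powr_realpow)
  then have "C ^ e * x = (C * x powr (1 / real e)) ^ e" by (simp add: power_mult_distrib)
  also have "\<dots> \<le> p ^ e" using assms(4) pos by (intro power_mono) auto
  finally show "C * x \<le> p ^ e" .
qed

text \<open>\<open>n + 1 \<le> n * n\<close> absorbs the shift, and \<open>ln 2 < 1\<close> the
  change of base.\<close>

lemma ln_Suc_le_log2:
  assumes "2 \<le> n"
  shows "ln (real n + 1) \<le> 2 * log 2 (real n)"
proof -
  have "n + 1 \<le> n * n" using assms by (metis Suc_eq_plus1 Suc_leI le_trans less_le_trans mult_le_mono2 mult_2_right n_less_m_mult_n numeral_2_eq_2 zero_less_Suc lessI)
  then have "real n + 1 \<le> real n * real n" by (metis of_nat_1 of_nat_add of_nat_le_iff of_nat_mult)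
  then have "ln (real n + 1) \<le> ln (real n * real n)" using assms by (subst ln_le_cancel_iff) auto
  also have "\<dots> = 2 * ln (real n)" using assms by (simp add: ln_mult)
  also have "ln (real n) \<le> log 2 (real n)"
  proof -
    have "ln (real n) * ln 2 \<le> ln (real n) * 1"
      using assms ln_2_less_1 by (intro mult_left_mono) auto
    then show ?thesis by (simp add: log_def pos_le_divide_eq)
  qed
  finally show ?thesis by simp
qed

lemma aasI:
  assumes "\<forall>\<^sub>F n in sequentially. 1 - 5 / (real n + 1) \<le> measure_pmf.prob (M n) {x. P n x}"
  shows "aas M P"
  unfolding aas_def
proof (rule tendsto_sandwich[OF assms])
  show "(\<lambda>n. 1 - 5 / (real n + 1)) \<longlonglongrightarrow> 1" by real_asymp
qed (auto intro: tendsto_const)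

lemma density_bound:
  fixes C C' p :: real
  assumes "1 \<le> C" "2 * C' \<le> C" "2 \<le> n" "0 < e" "0 < C'"
    and "C * (log 2 (real n) / real n) powr (1 / real e) \<le> p"
  shows "0 < p" "C' * ln (real n + 1) \<le> p ^ e * n"
proof -
  have log_pos: "0 < log 2 (real n)" using assms(3) by simp
  then have x: "0 < log 2 (real n) / real n" using assms(3) by simp
  show "0 < p" by (rule power_ge_of_powr(1)[OF assms(1) x assms(4,6)])
  have "C' * ln (real n + 1) \<le> C' * (2 * log 2 (real n))"
    using ln_Suc_le_log2[OF assms(3)] assms(5) by (intro mult_left_mono) auto
  also have "\<dots> \<le> C * log 2 (real n)" using mult_right_mono[OF assms(2), of "log 2 (real n)"] log_pos by (simp add: mult_ac)
  also have "\<dots> = C * (log 2 (real n) / real n) * n" using assms(3) by simp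
  also have "\<dots> \<le> p ^ e * n"
    using power_ge_of_powr(2)[OF assms(1) x assms(4,6)] by (intro mult_right_mono) auto
  finally show "C' * ln (real n + 1) \<le> p ^ e * n" .
qed

text \<open>Stated for all \<open>C\<close> above a threshold, so that both parts of the theorem can
  share one constant.\<close>

lemma aas_universal:
  fixes c :: real and \<H> :: "nat \<Rightarrow> nat ugraph set"
  assumes c: "0 < c" "c \<le> 1" and d: "0 < d" "d \<le> k"
    and copy: "\<And>\<Lambda> n E p a m h K w \<mu> \<theta> H. admissible d k \<Delta> c \<Lambda> n p a m h K w \<mu> \<theta> \<Longrightarrow>
      0 < p \<Longrightarrow> p \<le> 1 \<Longrightarrow> pseudorandom n E p d k (colours \<Delta>) a m \<Lambda> \<mu> \<theta> \<Longrightarrow> H \<in> \<H> n \<Longrightarrow>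
      contains_copy \<lparr>verts = {..<n}, edges = E\<rparr> H"
  shows "\<exists>C0>0. \<forall>C\<ge>C0. \<forall>p. (\<forall>n. 0 \<le> p n \<and> p n \<le> 1) \<longrightarrow>
    (\<forall>\<^sub>F n in sequentially. C * (log 2 (real n) / real n) powr (1 / real (d + k)) \<le> p n) \<longrightarrow>
    aas (\<lambda>n. gnp n (p n)) (\<lambda>n. universal (\<H> n))"
proof -
  obtain C' n0 \<Lambda> where C': "0 < (C'::real)" and adm: "\<And>n (p::real). n0 \<le> n \<Longrightarrow> 0 < p \<Longrightarrow> p \<le> 1 \<Longrightarrow>
    C' * ln (real n + 1) \<le> p ^ (d + k) * n \<Longrightarrow> \<exists>a m h K w \<mu> \<theta>. admissible d k \<Delta> c \<Lambda> n p a m h K w \<mu> \<theta>"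
    using admissible_exists[OF c d(2), of \<Delta>] by meson
  have main: "1 - 5 / (real n + 1) \<le> measure_pmf.prob (gnp n p) {G. universal (\<H> n) G}"
    if n: "n0 \<le> n" and p: "0 < p" "p \<le> 1" "C' * ln (real n + 1) \<le> p ^ (d + k) * n" for n :: nat and p :: real
  proof -
    obtain a m h K w \<mu> \<theta> where A: "admissible d k \<Delta> c \<Lambda> n p a m h K w \<mu> \<theta>"
      using adm[OF n p] by blast
    interpret random_edges n p by unfold_locales (use p in auto)
    show ?thesis
      unfolding prob_gnp universal_def
      by (rule order_trans[OF prob_good[OF A p(1) d(2) c(2)]], rule measure_pmf.finite_measure_mono)
        (use copy[OF A p(1,2)] in auto)
  qed
  \<comment> \<open>In \<open>2 * C' + 1\<close> the factor 2 is lost in passing to base 2, and the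
    1 ensures \<open>1 \<le> C\<close>.\<close>
  have "aas (\<lambda>n. gnp n (p n)) (\<lambda>n. universal (\<H> n))"
    if C: "2 * C' + 1 \<le> C" and p: "\<forall>n. 0 \<le> p n \<and> p n \<le> 1"
      and ev: "\<forall>\<^sub>F n in sequentially. C * (log 2 (real n) / real n) powr (1 / real (d + k)) \<le> p n" for C p
  proof (rule aasI)
    show "\<forall>\<^sub>F n in sequentially. 1 - 5 / (real n + 1) \<le>
        measure_pmf.prob (gnp n (p n)) {G. universal (\<H> n) G}"
      using ev eventually_ge_at_top[of "max 2 n0"]
    proof eventually_elim
      case (elim n)
      have n: "n0 \<le> n" "2 \<le> n" "0 < d + k" using elim(2) d(1) by auto
      have C1: "1 \<le> C" "2 * C' \<le> C" using C C' by auto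
      have "0 < p n" "C' * ln (real n + 1) \<le> p n ^ (d + k) * n"
        using density_bound[OF C1 n(2,3) C' elim(1)] by blast+
      then show ?case using n(1) p by (intro main) auto
    qed
  qed
  then show ?thesis using C' by (intro exI[of _ "2 * C' + 1"] conjI) auto
qed

theorem theorem1p1:
  fixes d \<Delta> :: nat and \<gamma> :: real
  assumes "d \<ge> 2" and "\<gamma> > 0"
  shows "\<exists>C::real. C > 0 \<and> (\<forall>p :: nat \<Rightarrow> real. (\<forall>n. 0 \<le> p n \<and> p n \<le> 1) \<longrightarrow>
    ((\<forall>\<^sub>F n in sequentially. p n \<ge> C * (log 2 (real n) / real n) powr (1 / (2 * real d + 1))) \<longrightarrow>
       aas (\<lambda>n. gnp n (p n)) (\<lambda>n. universal (graph_class n d \<Delta>)))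
    \<and>
    ((\<forall>\<^sub>F n in sequentially. p n \<ge> C * (log 2 (real n) / real n) powr (1 / (2 * real d))) \<longrightarrow>
       aas (\<lambda>n. gnp n (p n)) (\<lambda>n. universal (graph_class (nat \<lfloor>(1 - \<gamma>) * real n\<rfloor>) d \<Delta>))))"
proof -
  \<comment> \<open>For \<open>\<gamma>\<close> above 1 the size is cut off at 0 by
    \<open>nat\<close>, so the guest graphs have no vertices and \<open>c = 1\<close> fits.\<close>
  define c where "c = min \<gamma> 1"
  define c' where "c' = 1 / real ((2 * d + 1)\<^sup>2 * colours \<Delta>)"
  have d: "0 < d" "d \<le> Suc d" using assms(1) by simp_all
  have c: "0 < c" "c \<le> 1" using assms(2) by (auto simp: c_def)
  have c': "0 < c'" "c' \<le> 1" unfolding c'_def by (rule spanning_constant_bounds)+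
  have eq: "real (d + Suc d) = 2 * real d + 1" "real (d + d) = 2 * real d" by simp_all
  have copy_a: "contains_copy \<lparr>verts = {..<n}, edges = E\<rparr> H"
    if A: "admissible d (Suc d) \<Delta> c' \<Lambda> n p a m h K w \<mu> \<theta>" and p: "0 < p" "p \<le> 1"
      and E: "pseudorandom n E p d (Suc d) (colours \<Delta>) a m \<Lambda> \<mu> \<theta>" and H: "H \<in> graph_class n d \<Delta>"
    for \<Lambda> n E p a m h K w \<mu> \<theta> H
  proof -
    interpret H: degenerate_graph "verts H" "\<lambda>v. {u. {v, u} \<in> edges H}" d \<Delta>
      by (rule graph_class_degenerate_graph[OF H])
    have "card (verts H) = n" using H by (simp add: graph_class_def)
    then show ?thesis using H.embeds_spanning[OF A p E _ c'_def] contains_copyI[OF H] by blast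
  qed
  have copy_b: "contains_copy \<lparr>verts = {..<n}, edges = E\<rparr> H"
    if A: "admissible d d \<Delta> c \<Lambda> n p a m h K w \<mu> \<theta>" and p: "0 < p" "p \<le> 1"
      and E: "pseudorandom n E p d d (colours \<Delta>) a m \<Lambda> \<mu> \<theta>"
      and H: "H \<in> graph_class (nat \<lfloor>(1 - \<gamma>) * real n\<rfloor>) d \<Delta>"
    for \<Lambda> n E p a m h K w \<mu> \<theta> H
  proof -
    interpret H: degenerate_graph "verts H" "\<lambda>v. {u. {v, u} \<in> edges H}" d \<Delta>
      by (rule graph_class_degenerate_graph[OF H])
    have "(1 - \<gamma>) * real n \<le> (1 - c) * n" by (intro mult_right_mono) (auto simp: c_def)
    moreover have "0 \<le> (1 - c) * n" using c(2) by simp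
    moreover have "card (verts H) = nat \<lfloor>(1 - \<gamma>) * real n\<rfloor>" using H by (simp add: graph_class_def)
    ultimately have "real (card (verts H)) \<le> (1 - c) * n" by linarith
    then show ?thesis using H.embeds_almost_all[OF A p order_refl E _ c(1)] contains_copyI[OF H] by blast
  qed
  have "\<exists>Ca>0. \<forall>C\<ge>Ca. \<forall>p. (\<forall>n. 0 \<le> p n \<and> p n \<le> 1) \<longrightarrow>
      (\<forall>\<^sub>F n in sequentially. C * (log 2 (real n) / real n) powr (1 / real (d + Suc d)) \<le> p n) \<longrightarrow>
      aas (\<lambda>n. gnp n (p n)) (\<lambda>n. universal (graph_class n d \<Delta>))"
    by (rule aas_universal[OF c' d]) (rule copy_a)
  then obtain Ca where Ca: "0 < Ca" "\<forall>C\<ge>Ca. \<forall>p. (\<forall>n. 0 \<le> p n \<and> p n \<le> 1) \<longrightarrow>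
      (\<forall>\<^sub>F n in sequentially. C * (log 2 (real n) / real n) powr (1 / (2 * real d + 1)) \<le> p n) \<longrightarrow>
      aas (\<lambda>n. gnp n (p n)) (\<lambda>n. universal (graph_class n d \<Delta>))"
    unfolding eq by (elim exE conjE) (rule that; assumption)
  have "\<exists>Cb>0. \<forall>C\<ge>Cb. \<forall>p. (\<forall>n. 0 \<le> p n \<and> p n \<le> 1) \<longrightarrow>
      (\<forall>\<^sub>F n in sequentially. C * (log 2 (real n) / real n) powr (1 / real (d + d)) \<le> p n) \<longrightarrow>
      aas (\<lambda>n. gnp n (p n)) (\<lambda>n. universal (graph_class (nat \<lfloor>(1 - \<gamma>) * real n\<rfloor>) d \<Delta>))"
    by (rule aas_universal[OF c d(1) order_refl]) (rule copy_b)
  then obtain Cb where Cb: "0 < Cb" "\<forall>C\<ge>Cb. \<forall>p. (\<forall>n. 0 \<le> p n \<and> p n \<le> 1) \<longrightarrow>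
      (\<forall>\<^sub>F n in sequentially. C * (log 2 (real n) / real n) powr (1 / (2 * real d)) \<le> p n) \<longrightarrow>
      aas (\<lambda>n. gnp n (p n)) (\<lambda>n. universal (graph_class (nat \<lfloor>(1 - \<gamma>) * real n\<rfloor>) d \<Delta>))"
    unfolding eq by (elim exE conjE) (rule that; assumption)
  have "Ca \<le> Ca + Cb" "Cb \<le> Ca + Cb" "0 < Ca + Cb" using Ca(1) Cb(1) by simp_all
  then show ?thesis using Ca(2) Cb(2) by (intro exI[of _ "Ca + Cb"]) blast
qed

end
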